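(* Let $q=2n+1$ be an odd prime power with $\mathrm{char}(\mathbb{F}_q)>3$, let $d\in\mathbb{F}_q^\times$, and write $\mathbb{F}_q^{\times 2}=\{x^2:x\in\mathbb{F}_q^\times\}=\{\alpha_1,\dots,\alpha_n\}$. Let $$D(d,q)=\det\left[(\alpha_i+d\alpha_j)\phi(\alpha_i+d\alpha_j)\right]_{1\le i,j\le n},$$ viewed as a determinant over $\mathbb{F}_q$ (the values $\phi(\cdot)\in\{0,\pm1\}$ regarded as elements of $\mathbb{F}_q$). Then: (i) If $q\equiv1\pmod4$, then $D(d,q)=d^{(q-1)/4}x_q(d)^2$ for some $x_q(d)\in\mathbb{F}_q$. If moreover $q=p$ is a prime ($p\equiv 1\pmod 4$), then one can take $x_p(d)\in\mathbb{F}_p^\times$. (ii) If $q\equiv3\pmod 4$, then $$D(d,q)=d^{(q+1)/4}(-1)^{(q-3)/4}\binom{(q+1)/2}{(q+1)/4}y_q(d)^2$$ for some $y_q(d)\in\mathbb{F}_q$ (the binomial coefficient being an integer read in $\mathbb{F}_q$). If moreover $q=p$ is a prime ($p\equiv3\pmod4$), then $$D(d,p)=d^{(p+1)/4}(-1)^{(h(-p)-1)/2}z_p(d)^2$$ for some $z_p(d)\in\mathbb{F}_p^\times$, where $h(-p)$ is the class number of $\mathbb{Q}(\sqrt{-p})$.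
   Context: $\phi$ denotes the unique quadratic multiplicative character of $\mathbb{F}_q$ (so $\phi(x)=1$ if $x$ is a nonzero square, $-1$ if $x$ is a nonsquare), with $\phi(0)=0$. *)

theory Defs
  imports
    "Jordan_Normal_Form.Determinant"
    "HOL-Algebra.Ideal"
    "HOL-Number_Theory.Cong"
    "HOL-Library.Cardinality"
    Complex_Main
begin

definition nonzero_squares :: "'a::field set" where
  "nonzero_squares = {x ^ 2 | x. x \<noteq> 0}"

definition quad_char :: "'a::field \<Rightarrow> int" where
  "quad_char x = (if x = 0 then 0 else if x \<in> nonzero_squares then 1 else - 1)"

text \<open>
  The enumeration of the squares is indexed from \<open>0\<close>, following the matrix library.
\<close>

definition D_matrix :: "nat \<Rightarrow> (nat \<Rightarrow> 'a) \<Rightarrow> 'a \<Rightarrow> 'a::field mat" where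
  "D_matrix n \<alpha> d =
     mat n n (\<lambda>(i, j). (\<alpha> i + d * \<alpha> j) * of_int (quad_char (\<alpha> i + d * \<alpha> j)))"

definition quadratic_field :: "int \<Rightarrow> complex set" where
  "quadratic_field m = {of_rat a + of_rat b * csqrt (of_int m) | a b. True}"

definition ring_of_integers :: "complex set \<Rightarrow> complex ring" where
  "ring_of_integers K =
     \<lparr>carrier = {z \<in> K. algebraic_int z}, mult = (*), one = 1, zero = 0, add = (+)\<rparr>"

definition nonzero_ideals :: "('a, 'b) ring_scheme \<Rightarrow> 'a set set" where
  "nonzero_ideals R = {I. ideal I R \<and> I \<noteq> {\<zero>\<^bsub>R\<^esub>}}"

text \<open>
  Ideal classes are formed from nonzero integral ideals, with \<open>I\<close> and \<open>J\<close> equivalent when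
  \<open>a I = b J\<close> for some nonzero ring elements \<open>a\<close> and \<open>b\<close>. For the integers of a number field
  these classes correspond to those of the fractional ideals modulo the principal ones, because
  every fractional ideal is a nonzero scalar multiple of an integral ideal.
\<close>

definition ideal_class_rel :: "('a, 'b) ring_scheme \<Rightarrow> ('a set \<times> 'a set) set" where
  "ideal_class_rel R = {(I, J). I \<in> nonzero_ideals R \<and> J \<in> nonzero_ideals R \<and>
     (\<exists>a \<in> carrier R - {\<zero>\<^bsub>R\<^esub>}. \<exists>b \<in> carrier R - {\<zero>\<^bsub>R\<^esub>}.
        (\<lambda>x. a \<otimes>\<^bsub>R\<^esub> x) ` I = (\<lambda>x. b \<otimes>\<^bsub>R\<^esub> x) ` J)}"

definition class_number :: "complex set \<Rightarrow> nat" where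
  "class_number K =
     card (nonzero_ideals (ring_of_integers K) // ideal_class_rel (ring_of_integers K))"

end

theory Submission
  imports
    "HOL-Analysis.Interval_Integral"
    "HOL-Real_Asymp.Real_Asymp"
    "HOL-Number_Theory.Number_Theory"
    Defs
begin

text \<open>
  Since \<open>x * quad_char x = x ^ (n + 1)\<close> in the field and \<open>x ^ n = 1\<close> on the nonzero squares, expanding
  binomially and reducing exponents modulo \<open>n\<close> factors the matrix through the Vandermonde matrix of
  the squares: up to the sign of \<open>k \<mapsto> 1 - k\<close>, the determinant is the squared Vandermonde determinant
  times a product of coefficients \<open>binom (n + 1) k * d ^ k\<close>, which pair off under \<open>k \<mapsto> n + 1 - k\<close>.
  For \<open>q \<equiv> 3 (mod 4)\<close> this leaves a central binomial coefficient; for prime \<open>q\<close> its quadratic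
  character is that of \<open>((q - 1) / 2)!\<close> up to an explicit sign, that is, the parity of the number of
  nonresidues below \<open>q / 2\<close>, so that Dirichlet's class number formula is needed.

  The class number formula comes from the behaviour as \<open>t \<rightarrow> 0\<close> of the sum of \<open>exp (- t * N J)\<close> over all
  nonzero ideals \<open>J\<close>. Within one ideal class the sum is \<open>(\<theta> t - 1) / 2\<close> for the theta series \<open>\<theta>\<close> of a
  binary quadratic form, and \<open>\<theta> t = c / t + o(1)\<close>. Over all classes it is the Lambert series
  \<open>\<Sum>e. \<chi> e / (exp (t * e) - 1)\<close>, because the number of ideals of norm \<open>m\<close> is \<open>\<Sum>e | m. \<chi> e\<close>. In the combination
  \<open>f t - 2 * f (2 * t)\<close> the terms \<open>c / t\<close> cancel and the Lambert series becomes \<open>\<Sum>e. \<chi> e / (exp (t * e) + 1)\<close>,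
  whose limit is half the mean of the partial sums of \<open>\<chi>\<close>. That mean is therefore the class number; no Gauss
  sum has to be evaluated.
\<close>

section \<open>The determinant up to squares\<close>

text \<open>The class number is a cardinality, which would be 0 for an infinite set of classes, so
  finiteness must be proved along with the formula. The same series gives it: every class has a
  theta series growing like one common positive constant over t, since that constant depends only on
  the discriminant -p, while t times the Lambert series stays bounded by p. In
  \<open>f t - 2 * f (2 * t)\<close> the constants -1 in (theta - 1) / 2 do not cancel: each class
  keeps exactly 1/2, so the limit counts the classes. This is why the theta error has to be o(1) and
  not merely o(1 / t). About t ^ (-1/2) rows of the form contribute, so the one-dimensional Gaussian
  sum needs an error better than t ^ (1/2), uniformly in its shift. Euler-Maclaurin with the third
  derivative is the first order whose bound achieves this; its error has order t. Characteristic
  above 3 enters twice: a factor 3/2 in the determinant must not vanish, and p = 3 would bring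
  additional units into the ideal classes.\<close>

text \<open>Multiplication by y permutes the nonzero elements, which gives y ^ (2 * n) = 1. So the n
  squares are roots of X ^ n - 1, and by degree they exhaust its roots.\<close>

lemma euler_square_iff:
  fixes x :: "'a::{field,finite}"
  assumes card: "CARD('a) = 2 * n + 1" and sq: "card (nonzero_squares :: 'a set) = n" and n: "n > 0"
    and x: "x \<noteq> 0"
  shows "x ^ n = 1 \<longleftrightarrow> x \<in> nonzero_squares" and "x ^ n = 1 \<or> x ^ n = - 1"
proof -
  have pow: "y ^ (2 * n) = 1" if "y \<noteq> 0" for y :: 'a
  proof -
    have "(\<Prod>z\<in>UNIV-{0}. y * z) = y ^ (2 * n) * \<Prod>(UNIV-{0})"
      using card by (simp add: prod.distrib)
    moreover have "(\<Prod>z\<in>UNIV-{0}. y * z) = \<Prod>(UNIV-{0})"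
      by (rule prod.reindex_bij_witness[of _ "\<lambda>z. z / y" "\<lambda>z. y * z"]) (use that in auto)
    ultimately show ?thesis by simp
  qed
  let ?P = "[:0, 1:] ^ n - 1 :: 'a poly"
  have poly: "poly ?P y = y ^ n - 1" for y by (simp add: poly_power)
  have deg: "degree ?P \<le> n"
    by (rule degree_diff_le) (auto simp: degree_linear_power intro: order.trans[OF degree_power_le])
  have "poly ?P 0 \<noteq> 0" using n by (simp add: poly power_0_left)
  hence nz: "?P \<noteq> 0" by force
  have sub: "nonzero_squares \<subseteq> {y. poly ?P y = 0}"
    using pow by (auto simp: nonzero_squares_def poly simp flip: power_mult)
  have "card {y. poly ?P y = 0} \<le> n"
    using card_poly_roots_bound[OF nz] deg by linarith
  hence "nonzero_squares = {y. poly ?P y = 0}"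
    using sub sq card_mono[OF poly_roots_finite[OF nz] sub] poly_roots_finite[OF nz]
    by (intro card_subset_eq) auto
  thus "x ^ n = 1 \<longleftrightarrow> x \<in> nonzero_squares" by (auto simp: poly)
  have "(x ^ n) ^ 2 = 1" using pow[OF x] by (simp add: power_mult mult.commute)
  thus "x ^ n = 1 \<or> x ^ n = - 1" by (simp add: power2_eq_1_iff)
qed

lemma of_int_quad_char:
  fixes x :: "'a::{field,finite}"
  assumes "CARD('a) = 2 * n + 1" and "card (nonzero_squares :: 'a set) = n" and "n > 0"
  shows "of_int (quad_char x) = x ^ n"
  using euler_square_iff[OF assms, of x] \<open>n > 0\<close> by (auto simp: quad_char_def)

section \<open>The permutation of exponents and its sign\<close>

definition reverse_perm :: "nat \<Rightarrow> nat \<Rightarrow> nat \<Rightarrow> nat" where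
  "reverse_perm a b k = (if a \<le> k \<and> k < b then a + b - 1 - k else k)"

lemma reverse_perm_permutes: "reverse_perm a b permutes {a..<b}"
proof (rule bij_imp_permutes)
  show "bij_betw (reverse_perm a b) {a..<b} {a..<b}"
    by (rule bij_betw_byWitness[where f' = "reverse_perm a b"]) (auto simp: reverse_perm_def)
qed (auto simp: reverse_perm_def)

text \<open>Each induction step splits off the transposition of the two endpoints.\<close>

lemma sign_reverse_perm: "sign (reverse_perm a b) = (-1) ^ ((b - a) div 2)"
proof (induction "b - a" arbitrary: a b rule: less_induct)
  case less
  show ?case
  proof (cases "b \<le> a + 1")
    case True
    hence "reverse_perm a b = id" by (auto simp: reverse_perm_def fun_eq_iff)
    moreover have "(b - a) div 2 = 0" using True by simp
    ultimately show ?thesis by simp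
  next
    case False
    have eq: "reverse_perm a b = Transposition.transpose a (b - 1) \<circ> reverse_perm (a + 1) (b - 1)"
      using False by (auto simp: reverse_perm_def fun_eq_iff Transposition.transpose_def)
    have "sign (reverse_perm a b) = - sign (reverse_perm (a + 1) (b - 1))"
      unfolding eq using False
      by (subst sign_compose)
        (auto simp: sign_swap_id permutation_swap_id intro: permutes_imp_permutation[OF _ reverse_perm_permutes])
    also have "sign (reverse_perm (a + 1) (b - 1)) = (-1) ^ ((b - 1 - (a + 1)) div 2)"
      using False by (intro less) auto
    also have "(b - a) div 2 = Suc ((b - 1 - (a + 1)) div 2)" using False by auto
    ultimately show ?thesis by simp
  qed
qed

text \<open>
  For \<open>x ^ n = 1\<close> the exponents in the binomial expansion of \<open>(x + d * y) ^ (n + 1)\<close> only matter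
  modulo \<open>n\<close>; \<open>expo\<close> and \<open>coef\<close> collect the exponent of \<open>x\<close> and the coefficient that go with \<open>y ^ k\<close>.
\<close>

definition expo :: "nat \<Rightarrow> nat \<Rightarrow> nat" where
  "expo n k = (if k = 0 then 1 else if k = 1 then 0 else if k < n then n + 1 - k else k)"

definition coef :: "nat \<Rightarrow> 'a::field \<Rightarrow> nat \<Rightarrow> 'a" where
  "coef n d k = (if k = 0 then 1 + of_nat (n + 1) * d ^ n
     else if k = 1 then of_nat (n + 1) * d + d ^ (n + 1) else of_nat ((n + 1) choose k) * d ^ k)"

text \<open>On the representatives 0, ..., n - 1 the map k -> 1 - k modulo n swaps 0 with 1 and
  reverses the rest, so its sign reduces to that of a reversal.\<close>

lemma expo_eq: "expo n = Transposition.transpose 0 1 \<circ> reverse_perm 2 n" if "n \<ge> 2"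
  using that by (auto simp: expo_def reverse_perm_def fun_eq_iff Transposition.transpose_def)

lemma expo_permutes: "n \<ge> 2 \<Longrightarrow> expo n permutes {0..<n}"
  unfolding expo_eq
  by (intro permutes_compose permutes_swap_id) (auto intro: permutes_subset[OF reverse_perm_permutes])

lemma sign_expo: "n \<ge> 2 \<Longrightarrow> sign (expo n) = (-1) ^ (n div 2)"
proof -
  assume n: "n \<ge> 2"
  have "sign (expo n) = - ((-1) ^ ((n - 2) div 2))"
    unfolding expo_eq[OF n]
    by (subst sign_compose)
      (auto simp: sign_swap_id permutation_swap_id sign_reverse_perm intro: permutes_imp_permutation[OF _ reverse_perm_permutes])
  also have "n div 2 = Suc ((n - 2) div 2)" using n by auto
  ultimately show ?thesis by simp
qed

text \<open>The n + 2 binomial terms fall into n exponent classes: term 0 meets term n in x, and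
  term 1 meets term n + 1 in y. These two collisions are the exceptional values of
  \<open>coef\<close>.\<close>

lemma binomial_collect:
  fixes x y d :: "'a::field"
  assumes x: "x ^ n = 1" and y: "y ^ n = 1" and n: "n \<ge> 2"
  shows "(x + d * y) ^ (n + 1) = (\<Sum>k<n. coef n d k * x ^ expo n k * y ^ k)"
proof -
  define f where "f k = of_nat ((n + 1) choose k) * (d * y) ^ k * x ^ (n + 1 - k)" for k
  have "(x + d * y) ^ (n + 1) = (\<Sum>k\<le>n + 1. f k)"
    by (subst add.commute, subst binomial_ring) (simp add: f_def)
  also have "{..n + 1} = {0, 1, n, n + 1} \<union> {2..<n}" using n by auto
  also have "sum f \<dots> = f 0 + f 1 + f n + f (n + 1) + sum f {2..<n}"
    using n by (subst sum.union_disjoint) (auto simp: add_ac)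
  also have "sum f {2..<n} = (\<Sum>k\<in>{2..<n}. coef n d k * x ^ expo n k * y ^ k)"
    by (intro sum.cong) (auto simp: f_def coef_def expo_def power_mult_distrib)
  also have "f 0 + f 1 + f n + f (n + 1) = (\<Sum>k\<in>{0,1}. coef n d k * x ^ expo n k * y ^ k)"
    using n by (simp add: f_def coef_def expo_def power_mult_distrib x y algebra_simps)
  also have "(\<Sum>k\<in>{0,1}. coef n d k * x ^ expo n k * y ^ k) + (\<Sum>k\<in>{2..<n}. coef n d k * x ^ expo n k * y ^ k)
    = (\<Sum>k\<in>{0,1} \<union> {2..<n}. coef n d k * x ^ expo n k * y ^ k)"
    by (subst sum.union_disjoint) auto
  also have "{0,1} \<union> {2..<n} = {..<n}" using n by auto
  finally show ?thesis .
qed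

section \<open>Factoring through the Vandermonde matrix\<close>

lemma det_scale_rows:
  "det (mat n n (\<lambda>(i, j). c i * M i j)) = (\<Prod>i<n. c i) * det (mat n n (\<lambda>(i, j). M i j :: 'a::comm_ring_1))"
proof -
  have "(\<Prod>i = 0..<n. mat n n (\<lambda>(i, j). c i * M i j) $$ (i, p i))
      = (\<Prod>i<n. c i) * (\<Prod>i = 0..<n. mat n n (\<lambda>(i, j). M i j) $$ (i, p i))" if "p permutes {0..<n}" for p
    using permutes_in_image[OF that]
    by (subst prod.cong[OF refl, of _ _ "\<lambda>i. c i * M i (p i)"])
      (auto simp: prod.distrib lessThan_atLeast0 intro!: prod.cong)
  thus ?thesis
    unfolding det_def by (auto simp: sum_distrib_left mult_ac simp del: index_mat intro!: sum.cong)
qed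

definition vandermonde_mat :: "nat \<Rightarrow> (nat \<Rightarrow> 'a) \<Rightarrow> 'a::comm_ring_1 mat" where
  "vandermonde_mat n \<alpha> = mat n n (\<lambda>(k, j). \<alpha> j ^ k)"

text \<open>A singular matrix would give a nonzero polynomial of degree below n with n distinct
  roots. The determinant enters the result squared, so nonvanishing is the relevant
  property.\<close>

lemma det_vandermonde_mat_nonzero:
  fixes \<alpha> :: "nat \<Rightarrow> 'a::field"
  assumes inj: "inj_on \<alpha> {..<n}"
  shows "det (vandermonde_mat n \<alpha>) \<noteq> 0"
proof
  let ?V = "vandermonde_mat n \<alpha>"
  have carr: "transpose_mat ?V \<in> carrier_mat n n" by (simp add: vandermonde_mat_def)
  assume "det ?V = 0"
  hence "det (transpose_mat ?V) = 0" by (subst det_transpose[of _ n]) (auto simp: vandermonde_mat_def)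
  then obtain v where v: "v \<in> carrier_vec n" "v \<noteq> 0\<^sub>v n" "transpose_mat ?V *\<^sub>v v = 0\<^sub>v n"
    using det_0_iff_vec_prod_zero_field[OF carr] by blast
  define P where "P = (\<Sum>k<n. Polynomial.monom (v $ k) k)"
  have "n > 0" using v by (cases n) auto
  have coeff: "Polynomial.coeff P k = v $ k" if "k < n" for k
    using that by (simp add: P_def coeff_sum)
  have "poly P (\<alpha> i) = 0" if "i < n" for i
  proof -
    have "0 = (transpose_mat ?V *\<^sub>v v) $ i" using v(3) that by simp
    also have "\<dots> = (\<Sum>k<n. \<alpha> i ^ k * v $ k)"
      using v(1) that by (simp add: vandermonde_mat_def scalar_prod_def lessThan_atLeast0)
    also have "\<dots> = poly P (\<alpha> i)" by (simp add: P_def poly_sum poly_monom mult.commute)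
    finally show ?thesis by simp
  qed
  hence sub: "\<alpha> ` {..<n} \<subseteq> {x. poly P x = 0}" by auto
  have "P = 0"
  proof (rule ccontr)
    assume "P \<noteq> 0"
    have "n = card (\<alpha> ` {..<n})" using inj by (simp add: card_image)
    also have "\<dots> \<le> degree P"
      using card_mono[OF poly_roots_finite[OF \<open>P \<noteq> 0\<close>] sub] card_poly_roots_bound[OF \<open>P \<noteq> 0\<close>] by linarith
    also have "\<dots> \<le> n - 1"
      unfolding P_def by (intro degree_sum_le) (auto intro!: order.trans[OF degree_monom_le])
    finally show False using \<open>n > 0\<close> by simp
  qed
  hence "v = 0\<^sub>v n" using coeff v by (intro eq_vecI) auto
  thus False using v by simp
qed

lemma det_D_matrix:
  fixes d :: "'a::{field,finite}" and \<alpha> :: "nat \<Rightarrow> 'a"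
  assumes card: "CARD('a) = 2 * n + 1" and n: "n \<ge> 2" and bij: "bij_betw \<alpha> {..<n} nonzero_squares"
  shows "det (D_matrix n \<alpha> d) = (\<Prod>k<n. coef n d k) * (-1) ^ (n div 2) * (det (vandermonde_mat n \<alpha>))\<^sup>2"
proof -
  have sq: "card (nonzero_squares :: 'a set) = n" using bij_betw_same_card[OF bij] by simp
  note euler = euler_square_iff[OF card sq] and quad = of_int_quad_char[OF card sq]
  have one: "\<alpha> i ^ n = 1" if "i < n" for i
  proof -
    have "\<alpha> i \<in> nonzero_squares" using bij that by (auto simp: bij_betw_def)
    thus ?thesis using euler(1)[of "\<alpha> i"] n by (auto simp: nonzero_squares_def)
  qed
  let ?V = "vandermonde_mat n \<alpha>"
  \<comment> \<open>The rows of \<open>A\<close> are those of \<open>?V\<close> permuted by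
    \<open>expo\<close> and scaled by \<open>coef\<close>, so that \<open>det ?V\<close> will appear
    twice.\<close>
  define A where "A = mat n n (\<lambda>(k, i). coef n d k * \<alpha> i ^ expo n k)"
  have "D_matrix n \<alpha> d = transpose_mat A * ?V"
  proof (rule eq_matI)
    fix i j assume "i < dim_row (transpose_mat A * ?V)" "j < dim_col (transpose_mat A * ?V)"
    hence ij: "i < n" "j < n" by (auto simp: A_def vandermonde_mat_def)
    have "D_matrix n \<alpha> d $$ (i, j) = (\<alpha> i + d * \<alpha> j) ^ (n + 1)"
      using ij n by (simp add: D_matrix_def quad)
    also have "\<dots> = (transpose_mat A * ?V) $$ (i, j)"
      using ij by (subst binomial_collect[OF one one n])
        (auto simp: A_def vandermonde_mat_def scalar_prod_def lessThan_atLeast0 intro!: sum.cong)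
    finally show "D_matrix n \<alpha> d $$ (i, j) = (transpose_mat A * ?V) $$ (i, j)" .
  qed (auto simp: D_matrix_def A_def vandermonde_mat_def)
  hence "det (D_matrix n \<alpha> d) = det A * det ?V"
    by (simp add: det_mult[of _ n] det_transpose[of _ n] A_def vandermonde_mat_def)
  also have "det A = (\<Prod>k<n. coef n d k) * det (mat n n (\<lambda>(k, i). \<alpha> i ^ expo n k))"
    unfolding A_def by (rule det_scale_rows)
  also have "mat n n (\<lambda>(k, i). \<alpha> i ^ expo n k) = mat n n (\<lambda>(k, i). ?V $$ (expo n k, i))"
    using permutes_in_image[OF expo_permutes[OF n]] by (intro eq_matI) (auto simp: vandermonde_mat_def)
  also have "det \<dots> = signof (expo n) * det ?V"
    by (rule det_permute_rows) (auto simp: vandermonde_mat_def expo_permutes n)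
  finally show ?thesis using n by (simp add: sign_expo power2_eq_square)
qed

section \<open>The product of the coefficients up to squares\<close>

lemma prod_symmetric_even:
  fixes m :: nat
  assumes "\<And>k. k \<in> {2..<2 * m} \<Longrightarrow> f (2 * m + 1 - k) = f k"
  shows "(\<Prod>k\<in>{2..<2 * m}. f k) = (\<Prod>k\<in>{2..m}. f k :: 'a::comm_monoid_mult)\<^sup>2"
proof -
  have "{2..<2 * m} = {2..m} \<union> {m+1..<2 * m}" by auto
  hence "(\<Prod>k\<in>{2..<2 * m}. f k) = (\<Prod>k\<in>{2..m}. f k) * (\<Prod>k\<in>{m+1..<2 * m}. f k)"
    by (simp, subst prod.union_disjoint) auto
  also have "(\<Prod>k\<in>{m+1..<2 * m}. f k) = (\<Prod>k\<in>{2..m}. f k)"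
    by (rule prod.reindex_bij_witness[where i = "\<lambda>k. 2 * m + 1 - k" and j = "\<lambda>k. 2 * m + 1 - k"])
      (use assms in auto)
  finally show ?thesis by (simp add: power2_eq_square)
qed

text \<open>The reflection k -> 2 * m + 2 - k fixes m + 1, whereas the reflection of the even case
  has no fixed point. The unpaired factor is the source of the central binomial coefficient.\<close>

lemma prod_symmetric_odd:
  fixes m :: nat
  assumes "\<And>k. k \<in> {2..<2 * m + 1} \<Longrightarrow> f (2 * m + 2 - k) = f k" and "m \<ge> 1"
  shows "(\<Prod>k\<in>{2..<2 * m + 1}. f k) = f (m + 1) * (\<Prod>k\<in>{2..m}. f k :: 'a::comm_monoid_mult)\<^sup>2"
proof -
  have "{2..<2 * m + 1} = insert (m + 1) ({2..m} \<union> {m+2..<2 * m + 1})" using assms(2) by auto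
  hence "(\<Prod>k\<in>{2..<2 * m + 1}. f k) = f (m + 1) * ((\<Prod>k\<in>{2..m}. f k) * (\<Prod>k\<in>{m+2..<2 * m + 1}. f k))"
    by (simp, subst prod.union_disjoint) auto
  also have "(\<Prod>k\<in>{m+2..<2 * m + 1}. f k) = (\<Prod>k\<in>{2..m}. f k)"
    by (rule prod.reindex_bij_witness[where i = "\<lambda>k. 2 * m + 2 - k" and j = "\<lambda>k. 2 * m + 2 - k"])
      (use assms in auto)
  finally show ?thesis by (simp add: power2_eq_square)
qed

lemma prod_coef:
  assumes "n \<ge> 2"
  shows "(\<Prod>k<n. coef n d k) = coef n d 0 * coef n d 1 * d ^ (n * (n - 1) div 2 - 1) *
    (\<Prod>k\<in>{2..<n}. of_nat ((n + 1) choose k))"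
proof -
  have "{..<n} = {0,1} \<union> {2..<n}" using assms by auto
  hence "(\<Prod>k<n. coef n d k) = coef n d 0 * coef n d 1 * (\<Prod>k\<in>{2..<n}. coef n d k)"
    by (simp only: prod.union_disjoint) (subst prod.union_disjoint, auto)
  also have "(\<Prod>k\<in>{2..<n}. coef n d k) = (\<Prod>k\<in>{2..<n}. of_nat ((n + 1) choose k)) * d ^ (\<Sum>k\<in>{2..<n}. k)"
    by (simp add: coef_def prod.distrib power_sum)
  also have "(\<Sum>k\<in>{2..<n}. k) = n * (n - 1) div 2 - 1"
  proof -
    have "{0..<n} = {0,1} \<union> {2..<n}" using assms by auto
    hence "(\<Sum>k\<in>{0..<n}. k) = 1 + (\<Sum>k\<in>{2..<n}. k)"
      by (simp only:) (subst sum.union_disjoint, auto)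
    thus ?thesis using Sum_Ico_nat[of 0 n] by simp
  qed
  finally show ?thesis by (simp add: mult_ac)
qed

text \<open>The binomial coefficient divides \<open>fact m\<close>, a product of numbers below the
  characteristic. The bound on m is what ties the nonvanishing claims to prime order.\<close>

lemma binomial_nonzero_prime_char:
  assumes "prime CHAR('a::field)" "m < CHAR('a)" "k \<le> m"
  shows "of_nat (m choose k) \<noteq> (0::'a)"
proof -
  have "\<not> CHAR('a) dvd fact m" using prime_dvd_fact_iff assms by (metis linorder_not_less)
  moreover have "(m choose k) dvd fact m"
    using binomial_fact_lemma[OF assms(3)] by (metis dvd_triv_right)
  ultimately show ?thesis by (metis of_nat_eq_0_iff_char_dvd dvd_trans)
qed

lemma D_matrix_square_classes:
  fixes d :: "'a::{field,finite}" and \<alpha> :: "nat \<Rightarrow> 'a"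
  assumes card: "CARD('a) = 2 * n + 1" and char: "CHAR('a) > 3" and d: "d \<noteq> 0"
    and bij: "bij_betw \<alpha> {..<n} nonzero_squares"
  shows D_matrix_even: "n = 2 * m \<Longrightarrow> \<exists>x. det (D_matrix n \<alpha> d) = d ^ m * x\<^sup>2 \<and> (prime (2 * n + 1) \<longrightarrow> x \<noteq> 0)"
    and D_matrix_odd: "n = 2 * m + 1 \<Longrightarrow> \<exists>y. det (D_matrix n \<alpha> d) =
      d ^ (m + 1) * (-1) ^ m * of_nat ((2 * m + 2) choose (m + 1)) * y\<^sup>2 \<and> (prime (2 * n + 1) \<longrightarrow> y \<noteq> 0)"
proof -
  have dvd: "CHAR('a) dvd 2 * n + 1" using CHAR_dvd_CARD[where 'a = 'a] card by simp
  hence n: "n \<ge> 2" using char dvd_imp_le[OF dvd] by auto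
  have sq: "card (nonzero_squares :: 'a set) = n" using bij_betw_same_card[OF bij] by simp
  note euler = euler_square_iff[OF card sq]
  let ?V = "det (vandermonde_mat n \<alpha>)"
  have V: "?V \<noteq> 0" using bij by (intro det_vandermonde_mat_nonzero) (simp add: bij_betw_def)
  have small: "of_nat k \<noteq> (0::'a)" if "0 < k" "k < CHAR('a)" for k
    using that by (metis of_nat_eq_0_iff_char_dvd nat_dvd_not_less)
  have two: "(2::'a) \<noteq> 0" and three: "(3::'a) \<noteq> 0" using small[of 2] small[of 3] char by auto
  have "of_nat (2 * n + 1) = (0::'a)" using dvd by (simp only: of_nat_eq_0_iff_char_dvd)
  hence "2 * of_nat (n + 1) = (1::'a)" by (simp add: algebra_simps)
  \<comment> \<open>In the field, n + 1 is (q + 1) / 2 with q = 0.\<close>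
  hence half: "of_nat (n + 1) = (1 / 2 :: 'a)" using two by (simp add: field_simps del: of_nat_Suc)
  have binom: "of_nat ((n + 1) choose k) \<noteq> (0::'a)" if "prime (2 * n + 1)" "k \<le> n + 1" for k
  proof -
    have "CHAR('a) = 2 * n + 1" using that(1) dvd char by (auto simp: prime_nat_iff)
    thus ?thesis using that n by (intro binomial_nonzero_prime_char) auto
  qed
  define P where "P = (\<Prod>k\<in>{2..m}. of_nat ((n + 1) choose k) :: 'a)"
  have symm: "(n + 1) choose (n + 1 - k) = (n + 1) choose k" if "k \<le> n + 1" for k
    using binomial_symmetric[OF that] by simp
  have minus1: "\<exists>u. u \<noteq> 0 \<and> u\<^sup>2 = y" if "y ^ n = 1" "y \<noteq> 0" for y :: 'a
    using euler(1)[of y] that n by (auto simp: nonzero_squares_def)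
  have det: "det (D_matrix n \<alpha> d) = coef n d 0 * coef n d 1 * d ^ (n * (n - 1) div 2 - 1) *
    (\<Prod>k\<in>{2..<n}. of_nat ((n + 1) choose k)) * (-1) ^ (n div 2) * ?V\<^sup>2"
    by (simp add: det_D_matrix[OF card n bij] prod_coef[OF n])
  \<comment> \<open>Since d ^ n is 1 or -1, the factor (1 + d ^ n / 2) * (1 / 2 + d ^ n) takes only
    the values 9 / 4 and -1 / 4.\<close>
  have c01: "coef n d 0 * coef n d 1 = (if d ^ n = 1 then d * (3 / 2)\<^sup>2 else - d * (1 / 2)\<^sup>2)"
  proof -
    have "coef n d 0 * coef n d 1 = d * ((1 + d ^ n / 2) * (1 / 2 + d ^ n))"
      unfolding coef_def half by (simp add: algebra_simps half)
    thus ?thesis using euler(2)[OF _ d] n two by (auto simp: field_simps power2_eq_square)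
  qed
  {
    assume nm: "n = 2 * m"
    \<comment> \<open>For even n the element -1 is a square, so the minus sign of the nonsquare case
      is absorbed.\<close>
    have "\<exists>t. t \<noteq> 0 \<and> coef n d 0 * coef n d 1 = d * t\<^sup>2"
    proof (cases "d ^ n = 1")
      case True
      thus ?thesis using c01 two three by (intro exI[of _ "3 / 2"]) auto
    next
      case False
      obtain u :: 'a where "u \<noteq> 0" "u\<^sup>2 = - 1" using minus1[of "-1"] nm by auto
      thus ?thesis using c01 False two by (intro exI[of _ "u / 2"]) (auto simp: power_divide)
    qed
    then obtain t where t: "t \<noteq> 0" "coef n d 0 * coef n d 1 = d * t\<^sup>2" by blast
    obtain s :: 'a where s: "s \<noteq> 0" "s\<^sup>2 = (-1) ^ m"
      using minus1[of "(-1) ^ m"] nm by (auto simp flip: power_mult)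
    have prod: "(\<Prod>k\<in>{2..<n}. of_nat ((n + 1) choose k)) = P\<^sup>2"
      unfolding P_def nm by (rule prod_symmetric_even) (use symm nm in auto)
    \<comment> \<open>The added 1 is the factor d left by the two exceptional coefficients; m * (2 *
      m - 1) is split into m and an even number.\<close>
    have "n * (n - 1) div 2 - 1 + 1 = m + (m - 1) * m * 2"
      using n unfolding nm by (cases m) (auto simp: algebra_simps)
    hence dpow: "d * d ^ (n * (n - 1) div 2 - 1) = d ^ m * (d ^ ((m - 1) * m))\<^sup>2"
      by (metis power_add power_mult power_Suc Suc_eq_plus1)
    have "det (D_matrix n \<alpha> d) = (d * d ^ (n * (n - 1) div 2 - 1)) * t\<^sup>2 * P\<^sup>2 * s\<^sup>2 * ?V\<^sup>2"
      unfolding det t prod s using nm by (simp add: mult_ac)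
    also have "\<dots> = d ^ m * (d ^ ((m - 1) * m) * t * P * s * ?V)\<^sup>2"
      unfolding dpow by (simp add: power_mult_distrib mult_ac)
    finally show "\<exists>x. det (D_matrix n \<alpha> d) = d ^ m * x\<^sup>2 \<and> (prime (2 * n + 1) \<longrightarrow> x \<noteq> 0)"
      using t s V d binom nm by (intro exI conjI) (auto simp: P_def)
  }
  {
    assume nm: "n = 2 * m + 1"
    hence m: "m \<ge> 1" using n by auto
    \<comment> \<open>For odd n exactly one of d and -d is a square, so a square root is available
      in either case.\<close>
    have "\<exists>t. t \<noteq> 0 \<and> coef n d 0 * coef n d 1 = t\<^sup>2"
    proof (cases "d ^ n = 1")
      case True
      then obtain u where "u \<noteq> 0" "u\<^sup>2 = d" using minus1[of d] d by auto
      thus ?thesis using c01 True two three by (intro exI[of _ "u * (3 / 2)"]) (auto simp: power_mult_distrib power_divide)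
    next
      case False
      hence "d ^ n = - 1" using euler(2)[OF _ d] n by auto
      hence "(- d) ^ n = 1" using nm by (simp add: power_minus_odd)
      then obtain u where "u \<noteq> 0" "u\<^sup>2 = - d" using minus1[of "- d"] d by auto
      thus ?thesis using c01 False two by (intro exI[of _ "u / 2"]) (auto simp: power_divide)
    qed
    then obtain t where t: "t \<noteq> 0" "coef n d 0 * coef n d 1 = t\<^sup>2" by blast
    have prod: "(\<Prod>k\<in>{2..<n}. of_nat ((n + 1) choose k)) = of_nat ((n + 1) choose (m + 1)) * P\<^sup>2"
      unfolding P_def nm by (rule prod_symmetric_odd) (use symm nm m in auto)
    have "n * (n - 1) div 2 - 1 = (m + 1) + (m - 1) * (m + 1) * 2"
      using m unfolding nm by (cases m) (auto simp: algebra_simps)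
    hence dpow: "d ^ (n * (n - 1) div 2 - 1) = d ^ (m + 1) * (d ^ ((m - 1) * (m + 1)))\<^sup>2"
      by (metis power_add power_mult)
    have "det (D_matrix n \<alpha> d) = d ^ (m + 1) * (-1) ^ m * of_nat ((2 * m + 2) choose (m + 1)) *
        (d ^ ((m - 1) * (m + 1)) * t * P * ?V)\<^sup>2"
      unfolding det t prod dpow using nm by (simp add: power_mult_distrib mult_ac)
    thus "\<exists>y. det (D_matrix n \<alpha> d) =
      d ^ (m + 1) * (-1) ^ m * of_nat ((2 * m + 2) choose (m + 1)) * y\<^sup>2 \<and> (prime (2 * n + 1) \<longrightarrow> y \<noteq> 0)"
      using t V d binom nm by (intro exI conjI) (auto simp: P_def)
  }
qed

section \<open>Counting ideals by their norm\<close>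

text \<open>Euler's criterion gives the identity modulo p, and both sides lie between -1 and 1 while
  p > 2.\<close>

lemma Legendre_mult:
  fixes a b :: int
  assumes p: "prime p" "2 < p"
  shows "Legendre (a * b) (int p) = Legendre a (int p) * Legendre b (int p)"
proof -
  let ?k = "(p - 1) div 2"
  have "[Legendre (a * b) (int p) = (a * b) ^ ?k] (mod int p)" by (rule euler_criterion[OF p])
  also have "(a * b) ^ ?k = a ^ ?k * b ^ ?k" by (rule power_mult_distrib)
  also have "[a ^ ?k * b ^ ?k = Legendre a (int p) * Legendre b (int p)] (mod int p)"
    by (intro cong_mult cong_sym[OF euler_criterion[OF p]])
  finally have "int p dvd Legendre (a * b) (int p) - Legendre a (int p) * Legendre b (int p)"
    by (simp add: cong_iff_dvd_diff)
  moreover have "\<bar>Legendre (a * b) (int p) - Legendre a (int p) * Legendre b (int p)\<bar> < int p"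
    using p(2) by (auto simp: Legendre_def)
  ultimately show ?thesis
    using dvd_imp_le_int[of "Legendre (a * b) (int p) - Legendre a (int p) * Legendre b (int p)" "int p"]
    by linarith
qed

lemma Legendre_cong: "[a = b] (mod m) \<Longrightarrow> Legendre a m = Legendre b m"
proof -
  assume ab: "[a = b] (mod m)"
  have "[a = 0] (mod m) \<longleftrightarrow> [b = 0] (mod m)" using ab by (meson cong_sym cong_trans)
  moreover have "QuadRes m a \<longleftrightarrow> QuadRes m b" unfolding QuadRes_def using ab by (meson cong_sym cong_trans)
  ultimately show ?thesis by (simp add: Legendre_def)
qed

text \<open>Among the primes congruent to 3 modulo 4 the bound leaves out 3, whose field has six
  units; for the others the units are 1 and -1.\<close>

locale prime_3_mod_4 =
  fixes p :: nat
  assumes p_prime: "prime p" and p_mod_4: "p mod 4 = 3" and p_gt_3: "p > 3"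
begin

text \<open>For omega = (1 + sqrt (-p)) / 2 the minimal equation is omega ^ 2 = omega -
  \<open>c0\<close>.\<close>

definition c0 :: int where "c0 = (int p + 1) div 4"

lemma p_eq: "int p = 4 * c0 - 1" and p_ge: "p \<ge> 7" and c0_ge: "c0 \<ge> 2"
proof -
  show "int p = 4 * c0 - 1" unfolding c0_def using p_mod_4 by presburger
  show "p \<ge> 7" using p_mod_4 p_gt_3 by presburger
  show "c0 \<ge> 2" unfolding c0_def using p_mod_4 p_gt_3 by presburger
qed

definition chi :: "int \<Rightarrow> int" where "chi a = Legendre a (int p)"

text \<open>The norm of b + omega. Its divisibility by m is the condition for the lattice spanned by
  m and b + omega to be an ideal.\<close>

definition nf :: "int \<Rightarrow> int" where "nf b = b\<^sup>2 + b + c0"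

lemma chi_mult: "chi (a * b) = chi a * chi b"
  unfolding chi_def using Legendre_mult[of p a b] p_prime p_gt_3 by simp

lemma chi_values: "chi a \<in> {0, 1, -1}"
  by (auto simp: chi_def Legendre_def)

lemma chi_0_iff: "chi a = 0 \<longleftrightarrow> int p dvd a"
  by (auto simp: chi_def Legendre_def cong_0_iff)

lemma chi_1 [simp]: "chi 1 = 1"
proof -
  have "chi 1 * chi 1 = chi 1" using chi_mult[of 1 1] by simp
  moreover have "chi 1 \<noteq> 0" using p_gt_3 by (simp add: chi_0_iff)
  ultimately show ?thesis by simp
qed

lemma chi_square: "\<not> int p dvd a \<Longrightarrow> chi a * chi a = 1"
  using chi_values[of a] chi_0_iff[of a] by auto

lemma chi_cong: "[a = b] (mod int p) \<Longrightarrow> chi a = chi b"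
  unfolding chi_def by (rule Legendre_cong)

lemma chi_minus_1: "chi (-1) = -1"
proof -
  have "[chi (-1) = (-1) ^ ((p - 1) div 2)] (mod int p)"
    unfolding chi_def using euler_criterion[of p "-1"] p_prime p_gt_3 by simp
  moreover have "odd ((p - 1) div 2)" using p_mod_4 by presburger
  ultimately have "[chi (-1) = -1] (mod int p)" by simp
  moreover have "\<not> int p dvd 1" "\<not> int p dvd 2" using p_ge by (auto dest: zdvd_imp_le)
  ultimately show ?thesis using chi_values[of "-1"] by (auto simp: cong_iff_dvd_diff)
qed

lemma chi_minus: "chi (- a) = - chi a"
  using chi_mult[of "-1" a] chi_minus_1 by simp

lemma prime_not_dvd: "prime l \<Longrightarrow> l \<noteq> p \<Longrightarrow> \<not> l dvd p" "prime l \<Longrightarrow> l \<noteq> p \<Longrightarrow> \<not> p dvd l"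
  using p_prime primes_dvd_imp_eq[of l p] primes_dvd_imp_eq[of p l] by auto

lemma nf_disc: "(2 * b + 1)\<^sup>2 = 4 * nf b - int p"
  by (simp add: nf_def p_eq power2_eq_square algebra_simps)

lemma nf_diff: "nf x - nf y = (x - y) * (x + y + 1)"
  by (simp add: nf_def power2_eq_square algebra_simps)

lemma nf_cong: "[x = y] (mod m) \<Longrightarrow> m dvd nf x \<longleftrightarrow> m dvd nf y"
proof -
  assume "[x = y] (mod m)"
  hence "[nf x = nf y] (mod m)" unfolding nf_def by (intro cong_add cong_pow cong_refl)
  thus ?thesis by (rule cong_dvd_iff)
qed

lemma not_dvd_twice_plus_1:
  assumes "prime l" "l \<noteq> p" "int l dvd nf b"
  shows "\<not> int l dvd 2 * b + 1"
proof
  assume "int l dvd 2 * b + 1"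
  hence "int l dvd (2 * b + 1)\<^sup>2" by (simp add: power2_eq_square)
  hence "int l dvd 4 * nf b - (2 * b + 1)\<^sup>2" using assms(3) by (intro dvd_diff) auto
  hence "l dvd p" unfolding nf_disc by simp
  thus False using assms by (simp add: prime_not_dvd)
qed

text \<open>Gauss's lemma: the doubles exceeding p / 2 come from the \<open>c0\<close> numbers k =
  \<open>c0\<close>, ..., 2 * \<open>c0\<close> - 1. The parity of \<open>c0\<close> is the form
  that fits \<open>nf\<close>, whose values are all congruent to \<open>c0\<close> modulo 2.\<close>

lemma chi_2: "chi 2 = (if even c0 then 1 else -1)"
proof -
  interpret G: GAUSS p 2
    using p_prime p_ge by unfold_locales (auto simp: cong_0_iff dest: zdvd_imp_le)
  have n: "(int p - 1) div 2 = 2 * c0 - 1" unfolding p_eq by simp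
  have "G.E = (\<lambda>k. 2 * k) ` {c0..2 * c0 - 1}"
  proof -
    have "G.C = (\<lambda>k. 2 * k) ` {0<..2 * c0 - 1}"
      unfolding G.C_def G.B_def G.A_def n image_image p_eq
      by (intro image_cong refl) (auto simp: mult.commute)
    thus ?thesis unfolding G.E_def n by auto
  qed
  hence "card G.E = nat c0" by (simp add: card_image inj_on_def)
  hence "chi 2 = (-1) ^ nat c0" using G.gauss_lemma by (simp add: chi_def)
  thus ?thesis using c0_ge by (simp add: even_nat_iff minus_one_power_iff)
qed

text \<open>For odd l, completing the square turns a root of \<open>nf\<close> modulo l into a
  square root of -p, and reciprocity with p congruent to 3 modulo 4 equates the symbol of -p modulo
  l with that of l modulo p. The prime 2 does not permit completing the square and is settled by
  \<open>chi_2\<close>.\<close>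

lemma chi_prime_eq_1_iff:
  assumes l: "prime l" "l \<noteq> p"
  shows "chi (int l) = 1 \<longleftrightarrow> (\<exists>b. int l dvd nf b)"
proof (cases "l = 2")
  case True
  have "even (nf b) \<longleftrightarrow> even c0" for b by (auto simp: nf_def)
  thus ?thesis using True chi_2 by auto
next
  case False
  hence l2: "l > 2" using prime_ge_2_nat[OF l(1)] by simp
  hence odd: "odd l" using l(1) prime_odd_nat by blast
  have p2: "2 < p" using p_gt_3 by simp
  have ndvd: "\<not> int l dvd int p" using l by (simp add: prime_not_dvd)
  let ?L = "\<lambda>a. Legendre a (int l)"
  have Leq: "?L (- int p) = chi (int l)"
  proof -
    have QR: "?L (int p) * chi (int l) = (-1) ^ ((p - 1) div 2 * ((l - 1) div 2))"
      using Quadratic_Reciprocity[OF p_prime p2 l(1) l2] l(2) by (simp add: chi_def)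
    have "odd ((p - 1) div 2)" using p_mod_4 by presburger
    hence "(-1::int) ^ ((p - 1) div 2 * ((l - 1) div 2)) = (-1) ^ ((l - 1) div 2)"
      by (simp add: power_mult)
    moreover have "?L (-1) = (-1) ^ ((l - 1) div 2)"
    proof -
      have "[?L (-1) = (-1) ^ ((l - 1) div 2)] (mod int l)"
        using euler_criterion[OF l(1) l2, of "-1"] by simp
      moreover have "\<not> int l dvd 1" "\<not> int l dvd 2" using l2 by (auto dest: zdvd_imp_le)
      ultimately show ?thesis
        by (cases "even ((l - 1) div 2)") (auto simp: Legendre_def cong_iff_dvd_diff split: if_splits)
    qed
    ultimately have "?L (int p) * chi (int l) = ?L (-1)" using QR by simp
    moreover have "?L (- int p) = ?L (-1) * ?L (int p)" using Legendre_mult[OF l(1) l2, of "-1" "int p"] by simp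
    moreover have "?L (int p) * ?L (int p) = 1" using ndvd by (simp add: Legendre_def cong_0_iff)
    ultimately show ?thesis by (metis mult.assoc mult.commute mult_1)
  qed
  have "chi (int l) = 1 \<longleftrightarrow> QuadRes (int l) (- int p)"
    unfolding Leq[symmetric] using ndvd by (auto simp: Legendre_def cong_0_iff)
  also have "\<dots> \<longleftrightarrow> (\<exists>b. int l dvd nf b)"
  proof
    assume "QuadRes (int l) (- int p)"
    then obtain y where y: "int l dvd y\<^sup>2 + int p" by (auto simp: QuadRes_def cong_iff_dvd_diff)
    \<comment> \<open>Adding the odd number l changes the parity, so there is a representative of
      the form 2 * b + 1.\<close>
    obtain z where z: "odd z" "[z = y] (mod int l)"
      by (cases "odd y") (use odd that[of y] that[of "y + int l"] in \<open>auto simp: cong_def\<close>)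
    then obtain b where b: "z = 2 * b + 1" by (auto elim: oddE)
    have "[z\<^sup>2 + int p = y\<^sup>2 + int p] (mod int l)" using z by (intro cong_add cong_pow) auto
    hence "int l dvd z\<^sup>2 + int p" using y by (simp add: cong_dvd_iff)
    hence "int l dvd 4 * nf b" using nf_disc[of b] b by simp
    moreover have "coprime (int l) 4"
    proof -
      have "coprime (int l) (2 ^ 2)" using odd by (simp only: coprime_power_right_iff) simp
      thus ?thesis by simp
    qed
    ultimately show "\<exists>b. int l dvd nf b" by (auto simp: coprime_dvd_mult_right_iff)
  next
    assume "\<exists>b. int l dvd nf b"
    then obtain b where "int l dvd nf b" by blast
    hence "int l dvd (2 * b + 1)\<^sup>2 + int p" using nf_disc[of b] by simp
    thus "QuadRes (int l) (- int p)" by (auto simp: QuadRes_def cong_iff_dvd_diff)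
  qed
  finally show ?thesis .
qed

section \<open>Roots of the norm polynomial modulo m\<close>

text \<open>These residues will parametrize the primitive ideals of norm m, those not divisible by
  an integer above 1.\<close>

definition roots :: "nat \<Rightarrow> int set" where "roots m = {b. 0 \<le> b \<and> b < int m \<and> int m dvd nf b}"

definition rho :: "nat \<Rightarrow> nat" where "rho m = card (roots m)"

lemma finite_roots [simp]: "finite (roots m)"
  by (rule finite_subset[of _ "{0..<int m}"]) (auto simp: roots_def)

lemma rho_1 [simp]: "rho (Suc 0) = 1"
proof -
  have "roots (Suc 0) = {0}" by (auto simp: roots_def)
  thus ?thesis by (simp add: rho_def)
qed

text \<open>The derivative 2 * x + 1 is invertible modulo l because the discriminant -p of
  \<open>nf\<close> is prime to l.\<close>

lemma hensel:
  assumes l: "prime l" "l \<noteq> p" and ex: "int l dvd nf b"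
  shows "\<exists>x. int (l ^ Suc k) dvd nf x"
proof (induction k)
  case 0
  show ?case using ex by auto
next
  case (Suc k)
  then obtain x u where u: "nf x = int (l ^ Suc k) * u" by (auto elim: dvdE)
  hence "int l dvd nf x" by simp
  hence "coprime (2 * x + 1) (int l)"
    using not_dvd_twice_plus_1[OF l] l(1) by (simp add: prime_imp_coprime coprime_commute)
  then obtain v where v: "[(2 * x + 1) * v = 1] (mod int l)" using cong_solve_coprime_int by blast
  \<comment> \<open>One Newton step: t solves u + t * (2 * x + 1) = 0 modulo l.\<close>
  define t where "t = - u * v"
  have "[u + t * (2 * x + 1) = u + - u * 1] (mod int l)"
    unfolding t_def using cong_mult[OF cong_refl[of "-u"] v] by (intro cong_add) (auto simp: mult_ac)
  hence d: "int l dvd u + t * (2 * x + 1)" by (simp add: cong_0_iff)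
  have "nf (x + t * int (l ^ Suc k)) = int (l ^ Suc k) * (u + t * (2 * x + 1)) + t\<^sup>2 * (int (l ^ Suc k) * int (l ^ Suc k))"
    using u by (simp add: nf_def power2_eq_square algebra_simps)
  also have "int (l ^ Suc (Suc k)) dvd \<dots>"
  proof (intro dvd_add)
    show "int (l ^ Suc (Suc k)) dvd int (l ^ Suc k) * (u + t * (2 * x + 1))"
      using mult_dvd_mono[OF dvd_refl[of "int (l ^ Suc k)"] d] by (simp add: mult_ac)
    have "int l dvd int (l ^ Suc k)" by simp
    from mult_dvd_mono[OF this dvd_refl[of "int (l ^ Suc k)"]]
    have "int (l ^ Suc (Suc k)) dvd int (l ^ Suc k) * int (l ^ Suc k)"
      by (simp only: power_Suc[of l "Suc k"] of_nat_mult)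
    thus "int (l ^ Suc (Suc k)) dvd t\<^sup>2 * (int (l ^ Suc k) * int (l ^ Suc k))"
      by (rule dvd_mult)
  qed
  finally show ?case by blast
qed

text \<open>The involution b -> -1 - b preserves \<open>nf\<close>, so one root x modulo the prime
  power yields a second one. There are no others: l cannot divide both x - y and x + y + 1, whose
  sum is 2 * x + 1.\<close>

lemma rho_prime_power:
  assumes l: "prime l" "l \<noteq> p" and k: "k > 0"
  shows "int (rho (l ^ k)) = 1 + chi (int l)"
proof (cases "\<exists>b. int l dvd nf b")
  case False
  hence "chi (int l) \<noteq> 1" using chi_prime_eq_1_iff[OF l] by simp
  moreover have "chi (int l) \<noteq> 0" using l by (simp add: chi_0_iff prime_not_dvd)
  moreover have "int l dvd int (l ^ k)" using k by simp
  hence "roots (l ^ k) = {}" using False unfolding roots_def by (metis (mono_tags, lifting) dvd_trans empty_Collect_eq)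
  ultimately show ?thesis using chi_values[of "int l"] by (auto simp: rho_def)
next
  case True
  hence chi: "chi (int l) = 1" using chi_prime_eq_1_iff[OF l] by simp
  define q where "q = int (l ^ k)"
  have lq: "int l dvd q" using k by (simp add: q_def)
  have q0: "q > 0" using l(1) by (simp add: q_def prime_gt_0_nat)
  obtain x' where x': "q dvd nf x'" using True hensel[OF l, of _ "k - 1"] k by (auto simp: q_def)
  define x where "x = x' mod q"
  have x: "0 \<le> x" "x < q" "q dvd nf x" using x' nf_cong[of x x' q] q0 by (auto simp: x_def cong_def)
  have nd: "\<not> int l dvd 2 * x + 1" using not_dvd_twice_plus_1[OF l] x(3) lq dvd_trans by blast
  have neg: "nf (q - 1 - x) = nf x + q * (q - 2 * x - 1)" by (simp add: nf_def power2_eq_square algebra_simps)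
  have "roots (l ^ k) = {x, q - 1 - x}"
  proof (intro equalityI subsetI)
    fix y assume "y \<in> roots (l ^ k)"
    hence y: "0 \<le> y" "y < q" "q dvd nf y" by (auto simp: roots_def q_def)
    have d: "q dvd (x - y) * (x + y + 1)" using x(3) y(3) unfolding nf_diff[symmetric] by simp
    have "\<not> (int l dvd x - y \<and> int l dvd x + y + 1)"
    proof
      assume "int l dvd x - y \<and> int l dvd x + y + 1"
      hence "int l dvd (x - y) + (x + y + 1)" using dvd_add by blast
      moreover have "(x - y) + (x + y + 1) = 2 * x + 1" by simp
      ultimately show False using nd by simp
    qed
    hence "coprime q (x - y) \<or> coprime q (x + y + 1)"
      using l(1) prime_imp_coprime[of "int l"] by (auto simp: q_def)
    hence "q dvd x + y + 1 \<or> q dvd x - y"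
      using d by (auto simp: coprime_dvd_mult_right_iff coprime_dvd_mult_left_iff)
    thus "y \<in> {x, q - 1 - x}"
    proof
      assume "q dvd x + y + 1"
      then obtain j where j: "x + y + 1 = q * j" by (auto elim: dvdE)
      have "0 < q * j" "q * j < q * 2" using j x y by linarith+
      hence "j > 0" "j < 2" using q0 by (simp_all add: zero_less_mult_iff mult_less_cancel_left)
      hence "j = 1" by simp
      thus ?thesis using j by auto
    next
      assume "q dvd x - y"
      hence "x mod q = y mod q" by (simp add: mod_eq_dvd_iff)
      thus ?thesis using x y by simp
    qed
  qed (use x neg in \<open>auto simp: roots_def simp del: of_nat_power simp flip: q_def\<close>)
  moreover have "x \<noteq> q - 1 - x"
  proof
    assume "x = q - 1 - x"
    hence "2 * x + 1 = q" by simp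
    thus False using nd lq by simp
  qed
  ultimately show ?thesis using chi by (simp add: rho_def)
qed

lemma p_dvd_nf_iff: "int p dvd nf b \<longleftrightarrow> int p dvd 2 * b + 1"
proof -
  have "coprime (int p) 4"
  proof -
    have "odd p" using p_mod_4 by presburger
    hence "coprime (int p) (2 ^ 2)" by (simp only: coprime_power_right_iff) simp
    thus ?thesis by simp
  qed
  hence "int p dvd nf b \<longleftrightarrow> int p dvd 4 * nf b" by (simp add: coprime_dvd_mult_right_iff)
  also have "\<dots> \<longleftrightarrow> int p dvd (2 * b + 1)\<^sup>2" unfolding nf_disc by (simp add: dvd_diff_left_iff)
  also have "\<dots> \<longleftrightarrow> int p dvd 2 * b + 1" using p_prime by (simp add: prime_dvd_power_iff)
  finally show ?thesis .
qed

lemma rho_p: "rho p = 1"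
proof -
  have "roots p = {2 * c0 - 1}"
  proof (intro equalityI subsetI)
    fix b assume "b \<in> roots p"
    hence b: "0 \<le> b" "b < int p" "int p dvd 2 * b + 1" by (auto simp: roots_def p_dvd_nf_iff)
    then obtain j where j: "2 * b + 1 = int p * j" by (auto elim: dvdE)
    have "0 < int p * j" "int p * j < int p * 2" using j b by linarith+
    hence "j > 0" "j < 2" using p_gt_3 by (simp_all add: zero_less_mult_iff mult_less_cancel_left)
    hence "j = 1" by simp
    thus "b \<in> {2 * c0 - 1}" using j p_eq by auto
  next
    fix b assume "b \<in> {2 * c0 - 1}"
    thus "b \<in> roots p" using c0_ge by (auto simp: roots_def p_dvd_nf_iff) (auto simp: p_eq)
  qed
  thus ?thesis by (simp add: rho_def)
qed

text \<open>A root would make p ^ 2 divide both \<open>nf b\<close> and (2 * b + 1) ^ 2, and hence p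
  itself.\<close>

lemma rho_p_power: "k \<ge> 2 \<Longrightarrow> rho (p ^ k) = 0"
proof -
  assume k: "k \<ge> 2"
  have "roots (p ^ k) = {}"
  proof (rule ccontr)
    assume "roots (p ^ k) \<noteq> {}"
    then obtain b where "int (p ^ k) dvd nf b" by (auto simp: roots_def)
    moreover have "int p ^ 2 dvd int (p ^ k)" using k by (simp add: le_imp_power_dvd)
    ultimately have 2: "int p ^ 2 dvd nf b" using dvd_trans by blast
    hence "int p dvd nf b" by (rule dvd_trans[rotated]) (simp add: power2_eq_square)
    hence "int p ^ 2 dvd (2 * b + 1) ^ 2" by (simp add: p_dvd_nf_iff)
    hence "int p ^ 2 dvd 4 * nf b - (2 * b + 1)\<^sup>2" using 2 by (intro dvd_diff) auto
    hence "int p ^ 2 dvd int p" unfolding nf_disc by simp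
    hence "p ^ 2 dvd p" by (metis of_nat_dvd_iff of_nat_power)
    hence "p ^ 2 \<le> p" using p_gt_3 by (intro dvd_imp_le) auto
    thus False using p_gt_3 by (simp add: power2_eq_square)
  qed
  thus ?thesis by (simp add: rho_def)
qed

lemma rho_mult:
  assumes "coprime a b" "a > 0" "b > 0"
  shows "rho (a * b) = rho a * rho b"
proof -
  have cop: "coprime (int a) (int b)" using assms by simp
  have "bij_betw (\<lambda>x. (x mod int a, x mod int b)) (roots (a * b)) (roots a \<times> roots b)"
  proof (rule bij_betwI')
    fix x y assume "x \<in> roots (a * b)" "y \<in> roots (a * b)"
    hence xy: "0 \<le> x" "x < int a * int b" "0 \<le> y" "y < int a * int b" by (auto simp: roots_def)
    show "((x mod int a, x mod int b) = (y mod int a, y mod int b)) = (x = y)"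
    proof
      assume "(x mod int a, x mod int b) = (y mod int a, y mod int b)"
      hence "[x = y] (mod int a)" "[x = y] (mod int b)" by (auto simp: cong_def)
      hence "[x = y] (mod int a * int b)" using cop by (rule coprime_cong_mult)
      thus "x = y" using xy by (simp add: cong_def)
    qed auto
  next
    fix x assume "x \<in> roots (a * b)"
    hence "int a dvd nf x" "int b dvd nf x" by (auto simp: roots_def intro: dvd_trans[rotated])
    thus "(x mod int a, x mod int b) \<in> roots a \<times> roots b"
      using assms nf_cong[of "x mod int a" x "int a"] nf_cong[of "x mod int b" x "int b"]
      by (auto simp: roots_def)
  next
    fix z assume "z \<in> roots a \<times> roots b"
    then obtain u v where z: "z = (u, v)" "u \<in> roots a" "v \<in> roots b" by auto
    obtain x where x: "[x = u] (mod int a)" "[x = v] (mod int b)"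
      using binary_chinese_remainder_int[OF cop] by blast
    define w where "w = x mod (int a * int b)"
    have w: "[w = u] (mod int a)" "[w = v] (mod int b)"
      using x unfolding w_def cong_def by (simp_all add: mod_mult_cong_left mod_mod_cancel)
    have "int a dvd nf w" "int b dvd nf w" using z nf_cong[OF w(1)] nf_cong[OF w(2)] by (auto simp: roots_def)
    hence "int a * int b dvd nf w" using cop by (rule divides_mult)
    hence "w \<in> roots (a * b)" using assms by (auto simp: roots_def w_def)
    moreover have "z = (w mod int a, w mod int b)" using w z by (auto simp: cong_def roots_def)
    ultimately show "\<exists>x\<in>roots (a * b). z = (x mod int a, x mod int b)" by blast
  qed
  thus ?thesis unfolding rho_def by (simp add: bij_betw_same_card card_cartesian_product)
qed

section \<open>From root counts to divisor sums of the character\<close>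

text \<open>An ideal of norm m is g times a primitive ideal of norm m / g ^ 2, so this is the number
  of ideals of norm m; the bijection behind it is set up in \<open>all_ideals_sum\<close>.\<close>

definition ideal_count :: "nat \<Rightarrow> nat" where
  "ideal_count m = (\<Sum>g | g\<^sup>2 dvd m. rho (m div g\<^sup>2))"

definition chi_divisor_sum :: "nat \<Rightarrow> int" where
  "chi_divisor_sum m = (\<Sum>e | e dvd m. chi (int e))"

lemma finite_square_divisors: "m > 0 \<Longrightarrow> finite {g. g\<^sup>2 dvd (m::nat)}"
  by (rule finite_subset[of _ "{..m}"])
    (auto dest!: dvd_imp_le simp: power2_eq_square intro: order_trans[OF le_square])

lemma gcd_split:
  fixes a b g :: nat
  assumes "coprime a b" "g dvd a * b"
  shows "gcd g a * gcd g b = g"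
proof -
  have "gcd g a * gcd g b dvd g" using assms(1)
    by (intro divides_mult) (auto intro: coprime_divisors[of _ a _ b])
  moreover have "g dvd gcd g a * gcd g b"
  proof -
    obtain x y where xy: "g = x * y" "x dvd a" "y dvd b" using division_decomp[OF assms(2)] by blast
    have "x dvd gcd g a" "y dvd gcd g b" using xy by auto
    thus ?thesis using xy(1) by (metis mult_dvd_mono)
  qed
  ultimately show ?thesis by (rule dvd_antisym)
qed

lemma gcd_mult_coprime_parts:
  fixes a b x y :: nat
  assumes "coprime a b" "x dvd a" "y dvd b"
  shows "gcd (x * y) a = x" "gcd (x * y) b = y"
proof -
  have "coprime a y" "coprime b x" using assms coprime_divisors[OF assms(2) dvd_refl assms(1)]
    coprime_divisors[OF dvd_refl assms(3) assms(1)] by (auto simp: coprime_commute)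
  thus "gcd (x * y) a = x" "gcd (x * y) b = y"
    using assms by (auto simp: gcd_mult_left_right_cancel gcd_mult_left_left_cancel gcd_nat.absorb1)
qed

lemma chi_divisor_sum_mult:
  assumes "coprime a b" "a > 0" "b > 0"
  shows "chi_divisor_sum (a * b) = chi_divisor_sum a * chi_divisor_sum b"
proof -
  have "chi_divisor_sum a * chi_divisor_sum b = (\<Sum>(x, y)\<in>{x. x dvd a} \<times> {y. y dvd b}. chi (int x) * chi (int y))"
    by (simp add: chi_divisor_sum_def sum_product sum.cartesian_product)
  also have "\<dots> = chi_divisor_sum (a * b)"
    unfolding chi_divisor_sum_def
    by (rule sum.reindex_bij_witness[where i = "\<lambda>g. (gcd g a, gcd g b)" and j = "\<lambda>(x, y). x * y"])
      (use assms in \<open>auto simp: gcd_split gcd_mult_coprime_parts chi_mult mult_dvd_mono\<close>)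
  finally show ?thesis ..
qed

lemma ideal_count_mult:
  assumes "coprime a b" "a > 0" "b > 0"
  shows "ideal_count (a * b) = ideal_count a * ideal_count b"
proof -
  have rho: "rho (a div x\<^sup>2) * rho (b div y\<^sup>2) = rho (a * b div (x * y)\<^sup>2)" if xy: "x\<^sup>2 dvd a" "y\<^sup>2 dvd b" for x y
  proof -
    obtain u v where uv: "a = x\<^sup>2 * u" "b = y\<^sup>2 * v" using xy by (auto elim!: dvdE)
    have "coprime u v" using assms(1) uv by simp
    moreover have "a * b div (x * y)\<^sup>2 = u * v"
    proof -
      have "a * b = (x * y)\<^sup>2 * (u * v)" using uv by (simp add: power_mult_distrib mult_ac)
      moreover have "(x * y)\<^sup>2 > 0" using assms uv by auto
      ultimately show ?thesis by simp
    qed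
    moreover have "u > 0" "v > 0" "x > 0" "y > 0" using assms uv by auto
    ultimately show ?thesis using uv rho_mult[of u v] by simp
  qed
  have "ideal_count a * ideal_count b =
      (\<Sum>(x, y)\<in>{x. x\<^sup>2 dvd a} \<times> {y. y\<^sup>2 dvd b}. rho (a div x\<^sup>2) * rho (b div y\<^sup>2))"
    by (simp add: ideal_count_def sum_product sum.cartesian_product)
  also have "\<dots> = ideal_count (a * b)"
    unfolding ideal_count_def
  proof (rule sum.reindex_bij_witness[where i = "\<lambda>g. (gcd g a, gcd g b)" and j = "\<lambda>(x, y). x * y"])
    fix g assume "g \<in> {g. g\<^sup>2 dvd a * b}"
    hence g2: "g\<^sup>2 dvd a * b" by simp
    hence g: "g dvd a * b" by (rule dvd_trans[rotated]) (simp add: power2_eq_square)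
    show "(case (gcd g a, gcd g b) of (x, y) \<Rightarrow> x * y) = g" using gcd_split[OF assms(1) g] by simp
    have "(gcd g a)\<^sup>2 dvd a * b" "(gcd g b)\<^sup>2 dvd a * b" using g2 by (meson dvd_trans dvd_power_same gcd_dvd1)+
    moreover have "coprime ((gcd g a)\<^sup>2) b" "coprime ((gcd g b)\<^sup>2) a"
      using coprime_divisors[OF gcd_dvd2 dvd_refl assms(1)]
        coprime_divisors[OF gcd_dvd2 dvd_refl assms(1)[unfolded coprime_commute[of a b]]] by simp_all
    ultimately show "(gcd g a, gcd g b) \<in> {x. x\<^sup>2 dvd a} \<times> {y. y\<^sup>2 dvd b}"
      by (auto simp: coprime_dvd_mult_left_iff coprime_dvd_mult_right_iff)
  next
    fix z assume "z \<in> {x. x\<^sup>2 dvd a} \<times> {y. y\<^sup>2 dvd b}"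
    then obtain x y where z: "z = (x, y)" "x\<^sup>2 dvd a" "y\<^sup>2 dvd b" by auto
    have xy: "x dvd a" "y dvd b" using z by (auto intro: dvd_trans[rotated] simp: power2_eq_square)
    show "(gcd (case z of (x, y) \<Rightarrow> x * y) a, gcd (case z of (x, y) \<Rightarrow> x * y) b) = z"
      using gcd_mult_coprime_parts[OF assms(1) xy] z by simp
    show "(case z of (x, y) \<Rightarrow> x * y) \<in> {g. g\<^sup>2 dvd a * b}"
      using z by (simp add: power_mult_distrib mult_dvd_mono)
    show "rho (a * b div (case z of (x, y) \<Rightarrow> x * y)\<^sup>2) = (case z of (x, y) \<Rightarrow> rho (a div x\<^sup>2) * rho (b div y\<^sup>2))"
      using rho[OF z(2,3)] z by simp
  qed
  finally show ?thesis ..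
qed

text \<open>Splitting off g = 1 and dividing the other g by l gives a recursion from exponent k to k
  + 2, in which the added root count equals the two new powers of
  \<open>chi (int l)\<close>.\<close>

lemma ideal_count_prime_power:
  assumes l: "prime l"
  shows "int (ideal_count (l ^ k)) = chi_divisor_sum (l ^ k)"
proof -
  have l0: "l > 1" using l prime_gt_1_nat by blast
  have divs: "{e. e dvd l ^ k} = (\<lambda>i. l ^ i) ` {..k}" for k
    using divides_primepow_nat[OF l] by (auto simp: image_iff)
  have inj: "inj_on (\<lambda>i. l ^ i) A" for A using l0 by (auto simp: inj_on_def)
  have chi_pow: "chi (int (l ^ i)) = chi (int l) ^ i" for i
    by (induction i) (auto simp: chi_mult)
  have D: "chi_divisor_sum (l ^ k) = (\<Sum>i\<le>k. chi (int l) ^ i)" for k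
    unfolding chi_divisor_sum_def divs by (subst sum.reindex[OF inj]) (simp add: chi_pow del: of_nat_power)
  have sqdivs: "{g. g\<^sup>2 dvd l ^ k} = (\<lambda>i. l ^ i) ` {i. 2 * i \<le> k}" for k
  proof (intro equalityI subsetI)
    fix g assume "g \<in> {g. g\<^sup>2 dvd l ^ k}"
    hence g2: "g\<^sup>2 dvd l ^ k" by simp
    hence "g dvd l ^ k" by (rule dvd_trans[rotated]) (simp add: power2_eq_square)
    then obtain i where i: "g = l ^ i" using divs by auto
    hence "l ^ (i * 2) dvd l ^ k" using g2 by (simp add: power_mult)
    hence "i * 2 \<le> k" using l0 power_dvd_imp_le by blast
    thus "g \<in> (\<lambda>i. l ^ i) ` {i. 2 * i \<le> k}" using i by auto
  qed (auto simp: power_mult[symmetric] mult.commute intro: le_imp_power_dvd)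
  have R: "ideal_count (l ^ k) = (\<Sum>i | 2 * i \<le> k. rho (l ^ (k - 2 * i)))" for k
  proof -
    have "ideal_count (l ^ k) = (\<Sum>i | 2 * i \<le> k. rho (l ^ k div (l ^ i)\<^sup>2))"
      unfolding ideal_count_def sqdivs by (subst sum.reindex[OF inj]) simp
    also have "\<dots> = (\<Sum>i | 2 * i \<le> k. rho (l ^ (k - 2 * i)))"
      using l0 by (intro sum.cong) (auto simp: power_diff mult.commute simp flip: power_mult)
    finally show ?thesis .
  qed
  \<comment> \<open>One formula for both cases: at l = p the character vanishes and
    \<open>0 ^ 0 = 1\<close> gives the single root modulo p, while elsewhere the value is 0 or
    2.\<close>
  have rho: "int (rho (l ^ Suc k)) = chi (int l) ^ k * (1 + chi (int l))" for k
  proof (cases "l = p")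
    case True
    have "chi (int p) = 0" by (simp add: chi_0_iff)
    thus ?thesis using True rho_p rho_p_power[of "Suc k"] by (cases k) auto
  next
    case False
    hence "chi (int l) = 1 \<or> chi (int l) = -1"
      using chi_values[of "int l"] chi_0_iff[of "int l"] prime_not_dvd[OF l] by auto
    thus ?thesis using rho_prime_power[OF l False, of "Suc k"] by auto
  qed
  show ?thesis
  proof (induction k rule: induct_nat_012)
    case 0
    have "{i::nat. 2 * i \<le> 0} = {0}" by auto
    thus ?case unfolding R D by simp
  next
    case 1
    have "{i::nat. 2 * i \<le> 1} = {0}" by auto
    thus ?case unfolding R D using rho[of 0] by simp
  next
    case (ge2 k)
    have "{i::nat. 2 * i \<le> Suc (Suc k)} = insert 0 (Suc ` {i. 2 * i \<le> k})"
    proof (intro equalityI subsetI)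
      fix i :: nat assume "i \<in> {i. 2 * i \<le> Suc (Suc k)}"
      thus "i \<in> insert 0 (Suc ` {i. 2 * i \<le> k})" by (cases i) auto
    qed auto
    moreover have "finite {i::nat. 2 * i \<le> k}" by (rule finite_subset[of _ "{..k}"]) auto
    ultimately have "ideal_count (l ^ Suc (Suc k)) = rho (l ^ Suc (Suc k)) + ideal_count (l ^ k)"
      unfolding R by (simp add: sum.reindex del: power_Suc)
    hence "int (ideal_count (l ^ Suc (Suc k))) = chi (int l) ^ Suc k * (1 + chi (int l)) + chi_divisor_sum (l ^ k)"
      using ge2 rho[of "Suc k"] by simp
    thus ?case unfolding D by (simp add: algebra_simps)
  qed
qed

theorem ideal_count_eq: "m > 0 \<Longrightarrow> int (ideal_count m) = chi_divisor_sum m"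
proof (induction m rule: less_induct)
  case (less m)
  show ?case
  proof (cases "m = 1")
    case True
    thus ?thesis using ideal_count_prime_power[of 2 0] by simp
  next
    case False
    then obtain l where l: "prime l" "l dvd m" using prime_factor_nat by blast
    define k where "k = multiplicity l m"
    obtain m' where m': "m = l ^ k * m'" "\<not> l dvd m'"
    proof (rule multiplicity_decompose')
      show "m \<noteq> 0" "\<not> is_unit l" using less.prems l(1) by (auto simp: not_prime_unit)
    qed (use that in \<open>auto simp: k_def\<close>)
    have "k > 0" using l m' by (cases k) auto
    hence "l ^ k > 1" using l(1) prime_gt_1_nat one_less_power by blast
    moreover have "m' > 0" using m' less.prems by (cases m') auto
    ultimately have lt: "m' < m" unfolding m'(1) by simp
    have cop: "coprime (l ^ k) m'" using l m' by (simp add: prime_imp_coprime)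
    show ?thesis unfolding m'(1) using \<open>m' > 0\<close> l(1) less.IH[OF lt]
      by (simp add: ideal_count_mult[OF cop] chi_divisor_sum_mult[OF cop] ideal_count_prime_power prime_gt_0_nat)
  qed
qed

end

section \<open>Theta series of binary quadratic forms\<close>

text \<open>Comparison with arctan bounds the antiderivative, since exp (- x^2) is at most 1 / (1 +
  x^2); being monotone and bounded, it converges at both ends.\<close>

lemma gaussian_antiderivative:
  obtains E :: "real \<Rightarrow> real" and a b where
    "\<And>x. (E has_real_derivative exp (- x\<^sup>2)) (at x)" "(E \<longlongrightarrow> a) at_bot" "(E \<longlongrightarrow> b) at_top" "a < b"
proof -
  obtain E where "\<forall>x::real. - \<infinity> < ereal x \<longrightarrow> ereal x < \<infinity> \<longrightarrow> (E has_vector_derivative exp (- x\<^sup>2)) (at x)"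
    using einterval_antiderivative[of "-\<infinity>" \<infinity> "\<lambda>x. exp (- x\<^sup>2)"] by (auto intro!: continuous_intros)
  hence E: "(E has_real_derivative exp (- x\<^sup>2)) (at x)" for x
    by (simp add: has_real_derivative_iff_has_vector_derivative)
  have le: "exp (- x\<^sup>2) \<le> 1 / (1 + x\<^sup>2)" for x :: real
    using exp_ge_add_one_self[of "x\<^sup>2"] by (simp add: exp_minus field_simps add_pos_nonneg)
  have mono: "strict_mono E"
    by (rule strict_monoI) (use E DERIV_pos_imp_increasing[of _ _ E] in \<open>blast intro: exp_gt_zero\<close>)
  define G where "G x = arctan x - E x" for x
  have G: "(G has_real_derivative (1 / (1 + x\<^sup>2) - exp (- x\<^sup>2))) (at x)" for x
    unfolding G_def by (auto intro!: derivative_eq_intros E simp: field_simps)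
  have Gmono: "G x \<le> G y" if "x \<le> y" for x y
    using DERIV_nonneg_imp_nondecreasing[of x y G] that G le by force
  have "E x < E 0 + pi / 2" if "x \<ge> 0" for x
    using Gmono[OF that] arctan_ubound[of x] by (simp add: G_def)
  hence ub: "E x < E 0 + pi / 2" for x
    using strict_mono_less_eq[OF mono, of x 0] pi_gt_zero by (cases "x \<ge> 0") (auto, smt (verit) pi_half_gt_zero)
  have "E x > E 0 - pi / 2" if "x \<le> 0" for x
    using Gmono[OF that] arctan_lbound[of x] by (simp add: G_def)
  hence lb: "E x > E 0 - pi / 2" for x
    using strict_mono_less_eq[OF mono, of 0 x] pi_gt_zero by (cases "x \<le> 0") (auto, smt (verit) pi_half_gt_zero)
  have "(E \<longlongrightarrow> Sup (range E)) at_top"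
  proof (rule tendstoI)
    fix e :: real assume "e > 0"
    have bdd: "bdd_above (range E)" using ub by (intro bdd_aboveI[of _ "E 0 + pi / 2"]) (auto intro: less_imp_le)
    obtain y where "E y > Sup (range E) - e"
      using less_cSupD[of "range E" "Sup (range E) - e"] \<open>e > 0\<close> by auto
    hence "dist (E x) (Sup (range E)) < e" if "x \<ge> y" for x
      using cSup_upper[OF _ bdd, of "E x"] strict_mono_less_eq[OF mono, of y x] that
      by (auto simp: dist_real_def)
    thus "\<forall>\<^sub>F x in at_top. dist (E x) (Sup (range E)) < e" by (auto simp: eventually_at_top_linorder)
  qed
  moreover have "(E \<longlongrightarrow> Inf (range E)) at_bot"
  proof (rule tendstoI)
    fix e :: real assume "e > 0"
    have bdd: "bdd_below (range E)" using lb by (intro bdd_belowI[of _ "E 0 - pi / 2"]) (auto intro: less_imp_le)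
    obtain y where "E y < Inf (range E) + e"
      using cInf_lessD[of "range E" "Inf (range E) + e"] \<open>e > 0\<close> by auto
    hence "dist (E x) (Inf (range E)) < e" if "x \<le> y" for x
      using cInf_lower[OF _ bdd, of "E x"] strict_mono_less_eq[OF mono, of x y] that
      by (auto simp: dist_real_def)
    thus "\<forall>\<^sub>F x in at_bot. dist (E x) (Inf (range E)) < e" by (auto simp: eventually_at_bot_linorder)
  qed
  moreover have "Inf (range E) < Sup (range E)"
  proof -
    have "Inf (range E) \<le> E 0" using lb by (intro cInf_lower bdd_belowI[of _ "E 0 - pi / 2"]) (auto intro: less_imp_le)
    also have "E 0 < E 1" using mono by (simp add: strict_mono_less)
    also have "E 1 \<le> Sup (range E)"
      using ub by (intro cSup_upper bdd_aboveI[of _ "E 0 + pi / 2"]) (auto intro: less_imp_le)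
    finally show ?thesis .
  qed
  ultimately show ?thesis using E that by blast
qed

text \<open>The remainder is controlled without integrals: \<open>W\<close> is an antiderivative of
  a majorant of the third derivative, so that g + W and W - g, for the g of the proof, are
  nondecreasing on the unit interval.\<close>

lemma euler_maclaurin_step:
  fixes E F F1 F2 F3 W D :: "real \<Rightarrow> real"
  assumes E: "\<And>x. (E has_real_derivative F x) (at x)"
    and F: "\<And>x. (F has_real_derivative F1 x) (at x)"
    and F1: "\<And>x. (F1 has_real_derivative F2 x) (at x)"
    and F2: "\<And>x. (F2 has_real_derivative F3 x) (at x)"
    and W: "\<And>x. (W has_real_derivative D x) (at x)"
    and D: "\<And>x. \<bar>F3 x\<bar> \<le> D x"
  defines "T \<equiv> \<lambda>x. E x - F x / 2 + F1 x / 12"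
  shows "\<bar>F x - (T (x + 1) - T x)\<bar> \<le> W (x + 1) - W x"
proof -
  \<comment> \<open>\<open>P\<close> is the Bernoulli polynomial B_3 divided by 6, and g combines
    B_1, B_2 / 2 and B_3 / 6, so that its derivative collapses to the remainder term. As
    \<open>P\<close> vanishes at 0 and 1, no boundary term with \<open>F2\<close> survives.\<close>
  define P where "P u = (u ^ 3 - 3 / 2 * u\<^sup>2 + u / 2) / 6" for u :: real
  define g where "g u = E (x + u) - (u - 1 / 2) * F (x + u) + (u\<^sup>2 - u + 1 / 6) / 2 * F1 (x + u)
      - P u * F2 (x + u)" for u
  have add: "((\<lambda>u. x + u) has_real_derivative 1) (at u)" for u
    by (auto intro!: derivative_eq_intros)
  have shift: "((\<lambda>u. h (x + u)) has_real_derivative h' (x + u)) (at u)"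
    if "\<And>x. (h has_real_derivative h' x) (at x)" for h h' u
    using DERIV_chain2[OF that add] by simp
  have g: "(g has_real_derivative (- P u * F3 (x + u))) (at u)" for u
    unfolding g_def P_def
    by (auto intro!: derivative_eq_intros shift[OF E] shift[OF F] shift[OF F1] shift[OF F2])
      (simp add: field_simps power2_eq_square power3_eq_cube)
  have P: "\<bar>P u\<bar> \<le> 1" if "0 \<le> u" "u \<le> 1" for u
  proof -
    have "u ^ 3 \<le> 1" "u\<^sup>2 \<le> 1" "u ^ 3 \<ge> 0" "u\<^sup>2 \<ge> 0" using that by (auto intro: power_le_one)
    hence "u ^ 3 - 3 / 2 * u\<^sup>2 + u / 2 \<le> 6" "- 6 \<le> u ^ 3 - 3 / 2 * u\<^sup>2 + u / 2" using that by argo+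
    thus ?thesis unfolding P_def abs_le_iff by simp
  qed
  have bound: "\<bar>P u * F3 (x + u)\<bar> \<le> D (x + u)" if "0 \<le> u" "u \<le> 1" for u
    using mult_mono[OF P[OF that] D[of "x + u"]] by (simp add: abs_mult)
  have 1: "((\<lambda>u. g u + W (x + u)) has_real_derivative (- P u * F3 (x + u) + D (x + u))) (at u)" for u
    by (intro DERIV_add g shift[OF W])
  have 2: "((\<lambda>u. W (x + u) - g u) has_real_derivative (D (x + u) - (- P u * F3 (x + u)))) (at u)" for u
    by (intro DERIV_diff g shift[OF W])
  have "g 0 + W (x + 0) \<le> g 1 + W (x + 1)"
    by (rule DERIV_nonneg_imp_nondecreasing[where f = "\<lambda>u. g u + W (x + u)"]) (use 1 bound in \<open>force simp: abs_le_iff\<close>)+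
  moreover have "W (x + 0) - g 0 \<le> W (x + 1) - g 1"
    by (rule DERIV_nonneg_imp_nondecreasing[where f = "\<lambda>u. W (x + u) - g u"]) (use 2 bound in \<open>force simp: abs_le_iff\<close>)+
  ultimately have "\<bar>g 1 - g 0\<bar> \<le> W (x + 1) - W x" by simp
  moreover have "g 1 - g 0 = - (F x - (T (x + 1) - T x))"
    by (simp add: g_def T_def P_def algebra_simps)
  ultimately show ?thesis by simp
qed

lemma filterlim_int_intervals: "filterlim (\<lambda>N. {- int N..<int N}) (finite_subsets_at_top UNIV) sequentially"
  unfolding filterlim_finite_subsets_at_top
proof safe
  fix X :: "int set" assume X: "finite X"
  obtain M where M: "\<And>x. x \<in> X \<Longrightarrow> \<bar>x\<bar> \<le> M" using X by (metis finite_imageI Max_ge imageI)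
  have "X \<subseteq> {- int N..<int N}" if "N > nat M" for N
    using M that by (force simp: abs_le_iff)
  thus "\<forall>\<^sub>F N in sequentially. finite {- int N..<int N} \<and> X \<subseteq> {- int N..<int N} \<and> {- int N..<int N} \<subseteq> UNIV"
    by (auto simp: eventually_at_top_dense)
qed

lemma sum_int_interval_Suc:
  "(\<Sum>k\<in>{- int (Suc N)..<int (Suc N)}. f k) = f (- int N - 1) + (\<Sum>k\<in>{- int N..<int N}. f k) + f (int N)"
proof -
  have "{- int (Suc N)..<int (Suc N)} = insert (- int N - 1) (insert (int N) {- int N..<int N})" by auto
  thus ?thesis by (simp add: add_ac)
qed

text \<open>Telescoping leaves boundary values, of which only the limits of \<open>E\<close> and
  \<open>W\<close> survive. Nonnegativity turns bounded symmetric partial sums into unconditional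
  summability.\<close>

lemma euler_maclaurin_int:
  fixes E F F1 F2 F3 W D :: "real \<Rightarrow> real"
  assumes E: "\<And>x. (E has_real_derivative F x) (at x)"
    and F: "\<And>x. (F has_real_derivative F1 x) (at x)"
    and F1: "\<And>x. (F1 has_real_derivative F2 x) (at x)"
    and F2: "\<And>x. (F2 has_real_derivative F3 x) (at x)"
    and W: "\<And>x. (W has_real_derivative D x) (at x)"
    and D: "\<And>x. \<bar>F3 x\<bar> \<le> D x"
    and nonneg: "\<And>x. F x \<ge> 0"
    and lims: "(E \<longlongrightarrow> a) at_bot" "(E \<longlongrightarrow> b) at_top" "(F \<longlongrightarrow> 0) at_bot" "(F \<longlongrightarrow> 0) at_top"
      "(F1 \<longlongrightarrow> 0) at_bot" "(F1 \<longlongrightarrow> 0) at_top" "(W \<longlongrightarrow> c) at_bot" "(W \<longlongrightarrow> d) at_top"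
  shows "\<exists>S. ((\<lambda>k::int. F (of_int k)) has_sum S) UNIV \<and> \<bar>S - (b - a)\<bar> \<le> d - c"
proof -
  define T where "T x = E x - F x / 2 + F1 x / 12" for x
  note step = euler_maclaurin_step[OF E F F1 F2 W D, folded T_def]
  define s where "s N = (\<Sum>k\<in>{- int N..<int N}. F (of_int k))" for N
  have bound: "\<bar>s N - (T N - T (- real N))\<bar> \<le> W N - W (- real N)" for N :: nat
  proof (induction N)
    case (Suc N)
    have "\<bar>F N - (T (N + 1) - T N)\<bar> \<le> W (N + 1) - W N" using step[of "real N"] by (simp add: add_ac)
    moreover have "\<bar>F (- real N - 1) - (T (- real N) - T (- real N - 1))\<bar> \<le> W (- real N) - W (- real N - 1)"
      using step[of "- real N - 1"] by simp
    moreover have "s (Suc N) = F (- real N - 1) + s N + F N"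
      by (simp add: s_def sum_int_interval_Suc del: of_nat_Suc)
    moreover have "real (Suc N) = real N + 1" "- (real N + 1) = - real N - 1" "real (N + 1) = real N + 1" by auto
    ultimately show ?case using Suc by (simp only: abs_le_iff) linarith
  qed (simp add: s_def)
  have real: "filterlim real at_top sequentially" by (rule filterlim_real_sequentially)
  have neg: "filterlim (\<lambda>N. - real N) at_bot sequentially"
    by (rule filterlim_compose[OF filterlim_uminus_at_bot_at_top real])
  have top: "(\<lambda>N. f (real N)) \<longlonglongrightarrow> l" if "(f \<longlongrightarrow> l) at_top" for f :: "real \<Rightarrow> real" and l
    by (rule filterlim_compose[OF that real])
  have bot: "(\<lambda>N. f (- real N)) \<longlonglongrightarrow> l" if "(f \<longlongrightarrow> l) at_bot" for f :: "real \<Rightarrow> real" and l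
    by (rule filterlim_compose[OF that neg])
  have limT: "(\<lambda>N. T N - T (- real N)) \<longlonglongrightarrow> b - a"
  proof -
    have "(\<lambda>N. T (real N)) \<longlonglongrightarrow> b - 0 / 2 + 0 / 12"
      unfolding T_def by (intro tendsto_add tendsto_diff tendsto_divide tendsto_const top[of E] top[of F] top[of F1] lims) auto
    moreover have "(\<lambda>N. T (- real N)) \<longlonglongrightarrow> a - 0 / 2 + 0 / 12"
      unfolding T_def by (intro tendsto_add tendsto_diff tendsto_divide tendsto_const bot[of E] bot[of F] bot[of F1] lims) auto
    ultimately show ?thesis by (auto dest: tendsto_diff)
  qed
  have limW: "(\<lambda>N. W N - W (- real N)) \<longlonglongrightarrow> d - c"
    by (intro tendsto_diff top[of W] bot[of W] lims)
  have "convergent (\<lambda>N. (T N - T (- real N)) + (W N - W (- real N)))"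
    using tendsto_add[OF limT limW] by (rule convergentI)
  hence "Bseq (\<lambda>N. (T N - T (- real N)) + (W N - W (- real N)))" by (rule convergent_imp_Bseq)
  then obtain K where K: "\<And>N. \<bar>(T N - T (- real N)) + (W N - W (- real N))\<bar> \<le> K"
    by (auto simp: Bseq_def)
  have sK: "s N \<le> K" for N using bound[of N] K[of N] by (simp add: abs_le_iff)
  have "(\<lambda>k::int. F (of_int k)) summable_on UNIV"
  proof (rule nonneg_bdd_above_summable_on)
    show "bdd_above (sum (\<lambda>k::int. F (of_int k)) ` {X. X \<subseteq> UNIV \<and> finite X})"
    proof (rule bdd_aboveI2)
      fix X :: "int set" assume "X \<in> {X. X \<subseteq> UNIV \<and> finite X}"
      hence "\<forall>\<^sub>F N in sequentially. X \<subseteq> {- int N..<int N}"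
        using filterlim_int_intervals unfolding filterlim_finite_subsets_at_top by (auto elim: eventually_mono)
      then obtain N where "X \<subseteq> {- int N..<int N}" by (auto simp: eventually_sequentially)
      hence "sum (\<lambda>k::int. F (of_int k)) X \<le> s N"
        unfolding s_def by (intro sum_mono2) (auto simp: nonneg)
      thus "sum (\<lambda>k::int. F (of_int k)) X \<le> K" using sK[of N] by linarith
    qed
  qed (simp add: nonneg)
  then obtain S where S: "((\<lambda>k::int. F (of_int k)) has_sum S) UNIV" by (auto simp: summable_on_def)
  hence "s \<longlonglongrightarrow> S"
    unfolding has_sum_def s_def by (rule filterlim_compose[OF _ filterlim_int_intervals])
  hence "(\<lambda>N. \<bar>s N - (T N - T (- real N))\<bar>) \<longlonglongrightarrow> \<bar>S - (b - a)\<bar>"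
    by (intro tendsto_intros limT)
  hence "\<bar>S - (b - a)\<bar> \<le> d - c"
    by (rule LIMSEQ_le[OF _ limW]) (auto simp: bound)
  thus ?thesis using S by blast
qed

text \<open>The left side is the third derivative of the Gaussian, the right side the derivative of
  28 * arctan, which serves as the majorant. The Taylor polynomial of exp (u^2) up to u^6 absorbs
  the numerator; 28 is dictated by the coefficient 14 of u^4.\<close>

lemma gaussian_third_derivative_bound: "\<bar>(12 * u - 8 * u ^ 3) * exp (- u\<^sup>2)\<bar> \<le> 28 / (1 + u\<^sup>2)" for u :: real
proof -
  have "(\<Sum>i<4. (u\<^sup>2) ^ i / fact i) \<le> exp (u\<^sup>2)"
    unfolding exp_def using summable_exp_generic[of "u\<^sup>2"]
    by (simp add: scaleR_conv_of_real divide_inverse mult.commute sum_le_suminf)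
  hence exp: "1 + u\<^sup>2 + u ^ 4 / 2 + u ^ 6 / 6 \<le> exp (u\<^sup>2)"
    by (simp add: numeral_eq_Suc fact_Suc power_mult flip: power_mult)
  have "\<bar>12 * u - 8 * u ^ 3\<bar> \<le> (6 + 4 * u\<^sup>2) * (1 + u\<^sup>2)"
  proof -
    have "\<bar>12 * u - 8 * u ^ 3\<bar> \<le> (12 + 8 * u\<^sup>2) * \<bar>u\<bar>"
    proof -
      have "\<bar>12 * u - 8 * u ^ 3\<bar> = \<bar>12 - 8 * u\<^sup>2\<bar> * \<bar>u\<bar>"
        by (simp add: algebra_simps power2_eq_square power3_eq_cube flip: abs_mult)
      also have "\<dots> \<le> (12 + 8 * u\<^sup>2) * \<bar>u\<bar>" by (intro mult_right_mono) (auto simp: abs_le_iff)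
      finally show ?thesis .
    qed
    also have "2 * \<bar>u\<bar> \<le> 1 + u\<^sup>2" using sum_squares_bound[of "\<bar>u\<bar>" 1] by simp
    hence "(12 + 8 * u\<^sup>2) * \<bar>u\<bar> \<le> (12 + 8 * u\<^sup>2) * ((1 + u\<^sup>2) / 2)" by (intro mult_left_mono) auto
    also have "\<dots> = (6 + 4 * u\<^sup>2) * (1 + u\<^sup>2)" by (simp add: field_simps)
    finally show ?thesis .
  qed
  hence "\<bar>12 * u - 8 * u ^ 3\<bar> * (1 + u\<^sup>2) \<le> (6 + 4 * u\<^sup>2) * (1 + u\<^sup>2) * (1 + u\<^sup>2)"
    by (intro mult_right_mono) auto
  also have "\<dots> = 6 + 16 * u\<^sup>2 + 14 * u ^ 4 + 4 * u ^ 6" by (simp add: eval_nat_numeral algebra_simps)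
  also have "\<dots> \<le> 28 * (1 + u\<^sup>2 + u ^ 4 / 2 + u ^ 6 / 6)"
  proof -
    have "u\<^sup>2 \<ge> 0" "u ^ 6 \<ge> 0" by (auto simp: zero_le_even_power)
    thus ?thesis by argo
  qed
  also have "\<dots> \<le> 28 * exp (u\<^sup>2)" using exp by simp
  finally show ?thesis by (simp add: abs_mult exp_minus field_simps add_pos_nonneg)
qed

text \<open>In the variable sqrt s * (x + \<beta>) the third derivative carries s ^ (3/2) and
  integration over x takes back s ^ (1/2), which leaves an error of order s. Uniformity in \<beta>
  matters because each row of a binary form has its own shift.\<close>

lemma gaussian_sum_estimate:
  obtains \<kappa> K :: real where "\<kappa> > 0"
    "\<And>s \<beta>. s > 0 \<Longrightarrow> \<exists>S. ((\<lambda>k::int. exp (- (s * (of_int k + \<beta>)\<^sup>2))) has_sum S) UNIV \<and> \<bar>S - \<kappa> / sqrt s\<bar> \<le> K * s"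
proof -
  obtain E a b where E: "\<And>x. (E has_real_derivative exp (- x\<^sup>2)) (at x)"
    and lims: "(E \<longlongrightarrow> a) at_bot" "(E \<longlongrightarrow> b) at_top" and ab: "a < b"
    using gaussian_antiderivative by metis
  have "\<exists>S. ((\<lambda>k::int. exp (- (s * (of_int k + \<beta>)\<^sup>2))) has_sum S) UNIV \<and> \<bar>S - (b - a) / sqrt s\<bar> \<le> (28 * pi) * s"
    if s: "s > 0" for s \<beta> :: real
  proof -
    define r where "r = sqrt s"
    have r: "r > 0" "s = r\<^sup>2" using s by (auto simp: r_def)
    define u where "u x = r * (x + \<beta>)" for x
    have u: "(u has_real_derivative r) (at x)" for x
      unfolding u_def by (auto intro!: derivative_eq_intros)
    have chain: "((\<lambda>x. h (u x)) has_real_derivative h' (u x) * r) (at x)"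
      if "\<And>x. (h has_real_derivative h' x) (at x)" for h h' x
      using DERIV_chain2[OF that u] .
    have bot: "filterlim u at_bot at_bot" and top: "filterlim u at_top at_top"
      unfolding u_def using r by real_asymp+
    have cbot: "((\<lambda>x. h (u x)) \<longlongrightarrow> l) at_bot" if "(h \<longlongrightarrow> l) at_bot" for h :: "real \<Rightarrow> real" and l
      by (rule filterlim_compose[OF that bot])
    have ctop: "((\<lambda>x. h (u x)) \<longlongrightarrow> l) at_top" if "(h \<longlongrightarrow> l) at_top" for h :: "real \<Rightarrow> real" and l
      by (rule filterlim_compose[OF that top])
    have "\<exists>S. ((\<lambda>k::int. exp (- (u (of_int k))\<^sup>2)) has_sum S) UNIV \<and>
        \<bar>S - (b / r - a / r)\<bar> \<le> 28 * r\<^sup>2 * (pi / 2) - 28 * r\<^sup>2 * (- (pi / 2))"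
    proof (rule euler_maclaurin_int)
      show "((\<lambda>x. E (u x) / r) has_real_derivative exp (- (u x)\<^sup>2)) (at x)" for x
        using DERIV_cdivide[OF chain[OF E], of r] r by simp
      show "((\<lambda>x. exp (- (u x)\<^sup>2)) has_real_derivative r * (- 2 * u x * exp (- (u x)\<^sup>2))) (at x)" for x
        by (auto intro!: derivative_eq_intros u)
      show "((\<lambda>x. r * (- 2 * u x * exp (- (u x)\<^sup>2))) has_real_derivative
          r\<^sup>2 * ((4 * (u x)\<^sup>2 - 2) * exp (- (u x)\<^sup>2))) (at x)" for x
        by (auto intro!: derivative_eq_intros u simp: algebra_simps power2_eq_square)
      show "((\<lambda>x. r\<^sup>2 * ((4 * (u x)\<^sup>2 - 2) * exp (- (u x)\<^sup>2))) has_real_derivative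
          r ^ 3 * ((12 * u x - 8 * u x ^ 3) * exp (- (u x)\<^sup>2))) (at x)" for x
        by (auto intro!: derivative_eq_intros u simp: algebra_simps power2_eq_square power3_eq_cube)
      show "((\<lambda>x. 28 * r\<^sup>2 * arctan (u x)) has_real_derivative r ^ 3 * (28 / (1 + (u x)\<^sup>2))) (at x)" for x
        by (auto intro!: derivative_eq_intros u simp: field_simps power2_eq_square power3_eq_cube)
      show "\<bar>r ^ 3 * ((12 * u x - 8 * u x ^ 3) * exp (- (u x)\<^sup>2))\<bar> \<le> r ^ 3 * (28 / (1 + (u x)\<^sup>2))" for x
        unfolding abs_mult[of "r ^ 3"] using r
        by (intro mult_mono gaussian_third_derivative_bound) auto
      show "((\<lambda>x. E (u x) / r) \<longlongrightarrow> a / r) at_bot" "((\<lambda>x. E (u x) / r) \<longlongrightarrow> b / r) at_top"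
        using r by (intro tendsto_intros cbot ctop lims; simp)+
      show "((\<lambda>x. exp (- (u x)\<^sup>2)) \<longlongrightarrow> 0) at_bot" by (rule cbot) real_asymp
      show "((\<lambda>x. exp (- (u x)\<^sup>2)) \<longlongrightarrow> 0) at_top" by (rule ctop) real_asymp
      show "((\<lambda>x. r * (- 2 * u x * exp (- (u x)\<^sup>2))) \<longlongrightarrow> 0) at_bot"
        by (rule cbot[of "\<lambda>u. r * (- 2 * u * exp (- u\<^sup>2))"]) real_asymp
      show "((\<lambda>x. r * (- 2 * u x * exp (- (u x)\<^sup>2))) \<longlongrightarrow> 0) at_top"
        by (rule ctop[of "\<lambda>u. r * (- 2 * u * exp (- u\<^sup>2))"]) real_asymp
      show "((\<lambda>x. 28 * r\<^sup>2 * arctan (u x)) \<longlongrightarrow> 28 * r\<^sup>2 * (- (pi / 2))) at_bot"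
        by (intro tendsto_intros cbot tendsto_arctan_at_bot)
      show "((\<lambda>x. 28 * r\<^sup>2 * arctan (u x)) \<longlongrightarrow> 28 * r\<^sup>2 * (pi / 2)) at_top"
        by (intro tendsto_intros ctop tendsto_arctan_at_top)
    qed auto
    thus ?thesis
      unfolding r(2) using r by (simp add: u_def power_mult_distrib diff_divide_distrib mult_ac)
  qed
  thus ?thesis using that[of "b - a" "28 * pi"] ab by auto
qed

section \<open>Binary theta series near zero\<close>

definition qform :: "int \<Rightarrow> int \<Rightarrow> int \<Rightarrow> int \<times> int \<Rightarrow> int" where
  "qform A B C = (\<lambda>(x, y). A * x\<^sup>2 + B * x * y + C * y\<^sup>2)"

definition theta :: "int \<Rightarrow> int \<Rightarrow> int \<Rightarrow> real \<Rightarrow> real" where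
  "theta A B C t = (\<Sum>\<^sub>\<infinity>v. exp (- (t * of_int (qform A B C v))))"

text \<open>Completing the square makes each row in x a shifted Gaussian sum, and the weights of the
  rows form another Gaussian sum in y. The leading constant depends on the form only through its
  discriminant.\<close>

lemma theta_estimate:
  obtains \<kappa> :: real where "\<kappa> > 0"
    "\<And>A B C t. A > 0 \<Longrightarrow> 4 * A * C - B\<^sup>2 > 0 \<Longrightarrow> t > 0 \<Longrightarrow>
      (\<lambda>v. exp (- ((t::real) * of_int (qform A B C v)))) summable_on UNIV"
    "\<And>A B C. A > 0 \<Longrightarrow> 4 * A * C - B\<^sup>2 > 0 \<Longrightarrow> \<exists>M. \<forall>t. 0 < t \<longrightarrow> t \<le> 1 \<longrightarrow>
      \<bar>theta A B C t - \<kappa> / sqrt (of_int (4 * A * C - B\<^sup>2)) / t\<bar> \<le> M * sqrt t"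
proof -
  obtain \<kappa> K where \<kappa>: "\<kappa> > 0" and est: "\<And>s \<beta>. s > 0 \<Longrightarrow>
      \<exists>S. ((\<lambda>k::int. exp (- (s * (of_int k + \<beta>)\<^sup>2))) has_sum S) UNIV \<and> \<bar>S - \<kappa> / sqrt s\<bar> \<le> K * s"
    using gaussian_sum_estimate by metis
  have "(\<forall>t>0. (\<lambda>v. exp (- ((t::real) * of_int (qform A B C v)))) summable_on UNIV) \<and>
    (\<exists>M. \<forall>t. 0 < t \<longrightarrow> t \<le> 1 \<longrightarrow>
      \<bar>theta A B C t - (2 * \<kappa>\<^sup>2) / sqrt (of_int (4 * A * C - B\<^sup>2)) / t\<bar> \<le> M * sqrt t)"
    if A: "A > 0" and disc: "4 * A * C - B\<^sup>2 > 0" for A B C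
  proof -
    have "K * 1 \<ge> 0" using est[of 1 0] by force
    hence K: "K \<ge> 0" by simp
    \<comment> \<open>The form becomes a * (x + \<beta> y)^2 + \<delta> * y^2 with a for
      \<open>A\<close>, so a * \<delta> is a quarter of 4 * A * C - B^2.\<close>
    define \<delta> :: real where "\<delta> = of_int (4 * A * C - B\<^sup>2) / of_int (4 * A)"
    have \<delta>: "\<delta> > 0" unfolding \<delta>_def using A disc by (intro divide_pos_pos) (simp_all only: of_int_0_less_iff)
    define a :: real where "a = of_int A"
    have a: "a > 0" using A by (simp add: a_def)
    define g where "g s \<beta> = (\<Sum>\<^sub>\<infinity>k::int. exp (- (s * (of_int k + \<beta>)\<^sup>2)))" for s \<beta> :: real
    have g: "((\<lambda>k::int. exp (- (s * (of_int k + \<beta>)\<^sup>2))) has_sum g s \<beta>) UNIV"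
      and gest: "\<bar>g s \<beta> - \<kappa> / sqrt s\<bar> \<le> K * s" if "s > 0" for s \<beta>
      using est[OF that, of \<beta>] unfolding g_def by (auto simp: infsumI)
    define \<beta> where "\<beta> y = of_int B * of_int y / (2 * a)" for y :: int
    have expand: "real_of_int (qform A B C (x, y)) = a * (of_int x + \<beta> y)\<^sup>2 + \<delta> * (of_int y)\<^sup>2" for x y
    proof -
      have "real_of_int (4 * A) * of_int (qform A B C (x, y)) = 4 * a * (a * (of_int x + \<beta> y)\<^sup>2 + \<delta> * (of_int y)\<^sup>2)"
        unfolding \<beta>_def \<delta>_def using a A by (simp add: qform_def a_def field_simps power2_eq_square)
      thus ?thesis using A by (simp add: a_def)
    qed
    define row where "row t y = exp (- (t * \<delta> * (of_int y)\<^sup>2)) * g (t * a) (\<beta> y)" for t :: real and y :: int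
    have main: "(\<lambda>v. exp (- (t * of_int (qform A B C v)))) summable_on UNIV \<and>
        \<bar>theta A B C t - \<kappa> / sqrt (t * a) * g (t * \<delta>) 0\<bar> \<le> K * (t * a) * g (t * \<delta>) 0" if t: "t > 0" for t
    proof -
      have ta: "t * a > 0" and td: "t * \<delta> > 0" using t a \<delta> by auto
      have g0: "((\<lambda>y::int. exp (- (t * \<delta> * (of_int y)\<^sup>2))) has_sum g (t * \<delta>) 0) UNIV"
        using g[OF td, of 0] by simp
      have rows: "((\<lambda>x. exp (- (t * of_int (qform A B C (x, y))))) has_sum row t y) UNIV" for y
        using has_sum_cmult_right[OF g[OF ta, of "\<beta> y"], of "exp (- (t * \<delta> * (of_int y)\<^sup>2))"]
        by (simp add: expand row_def algebra_simps flip: exp_add)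
      have row_nonneg: "row t y \<ge> 0" for y
        using rows by (rule has_sum_nonneg) simp
      have row_est: "\<bar>row t y - \<kappa> / sqrt (t * a) * exp (- (t * \<delta> * (of_int y)\<^sup>2))\<bar>
          \<le> K * (t * a) * exp (- (t * \<delta> * (of_int y)\<^sup>2))" for y
      proof -
        have "row t y - \<kappa> / sqrt (t * a) * exp (- (t * \<delta> * (of_int y)\<^sup>2))
            = exp (- (t * \<delta> * (of_int y)\<^sup>2)) * (g (t * a) (\<beta> y) - \<kappa> / sqrt (t * a))"
          by (simp add: row_def algebra_simps)
        thus ?thesis using mult_left_mono[OF gest[OF ta, of "\<beta> y"], of "exp (- (t * \<delta> * (of_int y)\<^sup>2))"]
          by (simp add: abs_mult mult_ac)
      qed
      have row_summable: "row t summable_on UNIV"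
      proof (rule summable_on_comparison_test)
        show "(\<lambda>y. (K * (t * a) + \<kappa> / sqrt (t * a)) * exp (- (t * \<delta> * (of_int y)\<^sup>2))) summable_on UNIV"
          using g0 by (intro summable_on_cmult_right) (auto simp: summable_on_def)
        show "row t y \<le> (K * (t * a) + \<kappa> / sqrt (t * a)) * exp (- (t * \<delta> * (of_int y)\<^sup>2))" for y
          using row_est[of y] by (simp add: algebra_simps abs_le_iff)
      qed (rule row_nonneg)
      then obtain S where S: "(row t has_sum S) UNIV" by (auto simp: summable_on_def)
      define f where "f = (\<lambda>(y, x). exp (- (t * of_int (qform A B C (x, y)))))"
      have rows': "((\<lambda>x. f (y, x)) has_sum row t y) UNIV" for y using rows by (simp add: f_def)
      have "f summable_on (UNIV \<times> UNIV)"
        by (rule summable_on_SigmaI[OF rows' row_summable]) (simp add: f_def)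
      hence "(f has_sum S) (UNIV \<times> UNIV)" by (intro has_sum_SigmaI[OF rows' S])
      hence "((\<lambda>v. exp (- (t * of_int (qform A B C v)))) has_sum S) UNIV"
        by (subst has_sum_reindex_bij_betw[of prod.swap UNIV UNIV, symmetric])
          (auto simp: f_def case_prod_unfold bij_swap prod.swap_def)
      hence sum: "(\<lambda>v. exp (- (t * of_int (qform A B C v)))) summable_on UNIV" and th: "theta A B C t = S"
        by (auto simp: theta_def infsumI summable_on_def)
      define G where "G = g (t * \<delta>) 0"
      define L where "L = \<kappa> / sqrt (t * a)"
      note g0' = has_sum_cmult_right[OF g0[folded G_def]]
      have "S \<le> (L + K * (t * a)) * G"
        by (rule has_sum_mono[OF S g0']) (use row_est in \<open>simp add: L_def algebra_simps abs_le_iff\<close>)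
      moreover have "(L - K * (t * a)) * G \<le> S"
        by (rule has_sum_mono[OF g0' S]) (use row_est in \<open>simp add: L_def algebra_simps abs_le_iff\<close>)
      ultimately show ?thesis
        using sum unfolding th G_def[symmetric] L_def[symmetric] by (simp add: algebra_simps abs_le_iff)
    qed
    define c where "c = \<kappa>\<^sup>2 / sqrt (a * \<delta>)"
    \<comment> \<open>The three terms are the row main term times the error in y, the row error
      times the main term in y, and the product of both errors, where t ^ 2 is bounded by sqrt
      t.\<close>
    define M where "M = \<kappa> * K * \<delta> / sqrt a + K * a * \<kappa> / sqrt \<delta> + K\<^sup>2 * a * \<delta>"
    have "\<bar>theta A B C t - c / t\<bar> \<le> M * sqrt t" if t: "0 < t" "t \<le> 1" for t
    proof -
      have td: "t * \<delta> > 0" and ta: "t * a > 0" using t \<delta> a by auto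
      define G where "G = g (t * \<delta>) 0"
      define L where "L = \<kappa> / sqrt (t * a)"
      have L: "L \<ge> 0" unfolding L_def using \<kappa> ta by simp
      have 1: "\<bar>theta A B C t - L * G\<bar> \<le> K * (t * a) * G" using main[OF t(1)] by (simp add: L_def G_def)
      have 2: "\<bar>G - \<kappa> / sqrt (t * \<delta>)\<bar> \<le> K * (t * \<delta>)" using gest[OF td] by (simp add: G_def)
      have sq: "sqrt t * sqrt t = t" "sqrt t > 0" using t by auto
      have tt: "t * t \<le> sqrt t"
      proof -
        have "sqrt t \<le> 1" using t by simp
        have "t * t = sqrt t * (sqrt t * t)" using sq(1) by (metis mult.assoc)
        also have "\<dots> \<le> sqrt t * 1" using t \<open>sqrt t \<le> 1\<close> sq by (intro mult_left_mono mult_le_one) auto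
        finally show ?thesis by simp
      qed
      have LK: "L * (\<kappa> / sqrt (t * \<delta>)) = c / t"
        using t by (simp add: L_def c_def real_sqrt_mult power2_eq_square)
      have "\<bar>L * G - c / t\<bar> \<le> L * (K * (t * \<delta>))"
        unfolding LK[symmetric] right_diff_distrib[symmetric] abs_mult using 2 L by (simp add: mult_left_mono)
      also have "L * (K * (t * \<delta>)) = \<kappa> * K * \<delta> / sqrt a * sqrt t"
        using t a sq by (simp add: L_def real_sqrt_mult field_simps)
      finally have 3: "\<bar>L * G - c / t\<bar> \<le> \<kappa> * K * \<delta> / sqrt a * sqrt t" .
      have "K * (t * a) * G \<le> K * (t * a) * (\<kappa> / sqrt (t * \<delta>) + K * (t * \<delta>))"
        using 2 K ta by (intro mult_left_mono) (auto simp: abs_le_iff)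
      also have "\<dots> = K * a * \<kappa> / sqrt \<delta> * sqrt t + K\<^sup>2 * a * \<delta> * (t * t)"
        using t \<delta> sq by (simp add: real_sqrt_mult field_simps power2_eq_square)
      also have "K\<^sup>2 * a * \<delta> * (t * t) \<le> K\<^sup>2 * a * \<delta> * sqrt t"
        using tt a \<delta> by (intro mult_left_mono) auto
      finally have "K * (t * a) * G \<le> (K * a * \<kappa> / sqrt \<delta> + K\<^sup>2 * a * \<delta>) * sqrt t"
        by (simp add: algebra_simps)
      with 1 3 show ?thesis by (simp add: M_def algebra_simps abs_le_iff)
    qed
    moreover have "c = (2 * \<kappa>\<^sup>2) / sqrt (of_int (4 * A * C - B\<^sup>2))"
    proof -
      have "real_of_int (4 * A * C - B\<^sup>2) = 4 * (a * \<delta>)" using A by (simp add: \<delta>_def a_def)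
      thus ?thesis by (simp add: c_def real_sqrt_mult)
    qed
    ultimately show ?thesis using main by blast
  qed
  thus ?thesis using \<kappa> by (intro that[of "2 * \<kappa>\<^sup>2"]) auto
qed

lemma theta_cancel:
  assumes "A > 0" "4 * A * C - B\<^sup>2 > 0"
  shows "((\<lambda>t. theta A B C t - 2 * theta A B C (2 * t)) \<longlongrightarrow> 0) (at_right 0)"
proof -
  obtain c M where est: "\<And>t. 0 < t \<Longrightarrow> t \<le> 1 \<Longrightarrow> \<bar>theta A B C t - c / t\<bar> \<le> M * sqrt t"
    using theta_estimate assms by metis
  show ?thesis
  proof (rule Lim_null_comparison)
    show "((\<lambda>t. M * sqrt t + 2 * (M * sqrt (2 * t))) \<longlongrightarrow> 0) (at_right 0)"
      by (auto intro!: tendsto_eq_intros)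
    have "norm (theta A B C t - 2 * theta A B C (2 * t)) \<le> M * sqrt t + 2 * (M * sqrt (2 * t))"
      if "0 < t" "t < 1 / 2" for t
      using est[of t] est[of "2 * t"] that by (simp add: abs_le_iff)
    thus "\<forall>\<^sub>F t in at_right 0. norm (theta A B C t - 2 * theta A B C (2 * t)) \<le> M * sqrt t + 2 * (M * sqrt (2 * t))"
      by (auto simp: eventually_at_right_field intro!: exI[of _ "1 / 2"])
  qed
qed

text \<open>Serves the finiteness of the set of ideal classes: forms of equal discriminant share the
  same positive growth rate.\<close>

lemma theta_growth:
  obtains \<kappa> :: real where "\<kappa> > 0"
    "\<And>A B C. A > 0 \<Longrightarrow> 4 * A * C - B\<^sup>2 > 0 \<Longrightarrow>
      ((\<lambda>t. t * theta A B C t) \<longlongrightarrow> \<kappa> / sqrt (of_int (4 * A * C - B\<^sup>2))) (at_right 0)"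
proof -
  obtain \<kappa> where \<kappa>: "\<kappa> > 0" and est: "\<And>A B C. A > 0 \<Longrightarrow> 4 * A * C - B\<^sup>2 > 0 \<Longrightarrow>
      \<exists>M. \<forall>t. 0 < t \<longrightarrow> t \<le> 1 \<longrightarrow>
      \<bar>theta A B C t - \<kappa> / sqrt (of_int (4 * A * C - B\<^sup>2)) / t\<bar> \<le> M * sqrt t"
    using theta_estimate by metis
  have "((\<lambda>t. t * theta A B C t) \<longlongrightarrow> \<kappa> / sqrt (of_int (4 * A * C - B\<^sup>2))) (at_right 0)"
    if AC: "A > 0" "4 * A * C - B\<^sup>2 > 0" for A B C
  proof -
    define c where "c = \<kappa> / sqrt (of_int (4 * A * C - B\<^sup>2))"
    obtain M where M: "\<And>t. 0 < t \<Longrightarrow> t \<le> 1 \<Longrightarrow> \<bar>theta A B C t - c / t\<bar> \<le> M * sqrt t"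
      using est[OF AC] unfolding c_def by blast
    have "((\<lambda>t. t * theta A B C t - c) \<longlongrightarrow> 0) (at_right 0)"
    proof (rule Lim_null_comparison)
      show "((\<lambda>t. t * (M * sqrt t)) \<longlongrightarrow> 0) (at_right 0)"
        by (auto intro!: tendsto_eq_intros)
      have "norm (t * theta A B C t - c) \<le> t * (M * sqrt t)" if "0 < t" "t < 1" for t
      proof -
        have "t * theta A B C t - c = t * (theta A B C t - c / t)" using that by (simp add: algebra_simps)
        thus ?thesis using mult_left_mono[OF M[of t], of t] that by (simp add: abs_mult)
      qed
      thus "\<forall>\<^sub>F t in at_right 0. norm (t * theta A B C t - c) \<le> t * (M * sqrt t)"
        by (auto simp: eventually_at_right_field intro!: exI[of _ 1])
    qed
    thus ?thesis unfolding c_def by (simp add: LIM_zero_cancel)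
  qed
  thus ?thesis using that \<kappa> by blast
qed

lemma theta_summable:
  fixes t :: real
  assumes "A > 0" "4 * A * C - B\<^sup>2 > 0" "t > 0"
  shows "(\<lambda>v. exp (- (t * of_int (qform A B C v)))) summable_on UNIV"
  using theta_estimate assms by metis

section \<open>The Lambert series of the quadratic character\<close>

lemma summation_by_parts:
  fixes c h :: "nat \<Rightarrow> real"
  shows "(\<Sum>e<n. c e * h e) = (\<Sum>e<n. c e) * h n + (\<Sum>e<n. (\<Sum>j<Suc e. c j) * (h e - h (Suc e)))"
  by (induction n) (auto simp: algebra_simps)

lemma abel_bound:
  fixes c h :: "nat \<Rightarrow> real"
  assumes S: "\<And>n. \<bar>\<Sum>e<n. c e\<bar> \<le> M" and h: "\<And>n. h (Suc n) \<le> h n" "\<And>n. h n \<ge> 0"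
  shows "\<bar>\<Sum>e<n. c e * h e\<bar> \<le> M * h 0"
proof -
  have "\<bar>\<Sum>e<n. c e * h e\<bar> \<le> \<bar>(\<Sum>e<n. c e) * h n\<bar> + (\<Sum>e<n. \<bar>(\<Sum>j<Suc e. c j) * (h e - h (Suc e))\<bar>)"
    unfolding summation_by_parts[of c h] by (rule order_trans[OF abs_triangle_ineq add_left_mono[OF sum_abs]])
  also have "\<dots> \<le> M * h n + (\<Sum>e<n. M * (h e - h (Suc e)))"
    using S h by (intro add_mono sum_mono) (auto simp: abs_mult simp del: sum.lessThan_Suc intro!: mult_right_mono)
  also have "\<dots> = M * h n + M * (h 0 - h n)"
    by (simp add: sum_lessThan_telescope' flip: sum_distrib_left)
  finally show ?thesis by (simp add: algebra_simps)
qed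

lemma periodic_partial_sum_bound:
  fixes c :: "nat \<Rightarrow> real"
  assumes p: "p > 0" and per: "\<And>n. c (n + p) = c n" and zero: "(\<Sum>e<p. c e) = 0" and B: "\<And>n. \<bar>c n\<bar> \<le> B"
  shows "(\<Sum>e<n + p. c e) = (\<Sum>e<n. c e)" and "\<bar>\<Sum>e<n. c e\<bar> \<le> p * B"
proof -
  show shift: "(\<Sum>e<n + p. c e) = (\<Sum>e<n. c e)" for n
  proof (induction n)
    case (Suc n)
    thus ?case using per[of n] by simp
  qed (simp add: zero)
  have B0: "B \<ge> 0" using B[of 0] by linarith
  show "\<bar>\<Sum>e<n. c e\<bar> \<le> p * B"
  proof (induction n rule: less_induct)
    case (less n)
    show ?case
    proof (cases "n < p")
      case True
      have "\<bar>\<Sum>e<n. c e\<bar> \<le> (\<Sum>e<n. \<bar>c e\<bar>)" by (rule sum_abs)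
      also have "\<dots> \<le> (\<Sum>e<n. B)" by (intro sum_mono B)
      also have "\<dots> \<le> p * B" using True B0 by (simp add: mult_right_mono)
      finally show ?thesis .
    next
      case False
      thus ?thesis using less[of "n - p"] p shift[of "n - p"] by simp
    qed
  qed
qed

text \<open>It arises from 1 / (x - 1) - 2 / (x^2 - 1) = 1 / (x + 1) at x = exp u.\<close>

definition fermi :: "real \<Rightarrow> real" where "fermi u = 1 / (exp u + 1)"

lemma fermi_diff: "fermi u - fermi (u + t) = (exp t - 1) / (exp t * exp u + exp (- u) + exp t + 1)"
proof -
  define x s where "x = exp u" and "s = exp t"
  have x: "x > 0" "s > 0" by (auto simp: x_def s_def)
  hence pos: "x + 1 > 0" "x * s + 1 > 0" by (auto intro: add_pos_pos)
  have "1 / (x + 1) - 1 / (x * s + 1) = x * (s - 1) / ((x + 1) * (x * s + 1))"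
    using pos by (simp add: divide_simps) (simp add: algebra_simps)
  also have "(x + 1) * (x * s + 1) = x * (s * x + inverse x + s + 1)"
    using x by (simp add: field_simps)
  also have "x * (s - 1) / \<dots> = (s - 1) / (s * x + inverse x + s + 1)" using x by simp
  finally show ?thesis by (simp add: fermi_def x_def s_def exp_add exp_minus)
qed

text \<open>A discrete convexity for nonnegative arguments. In the denominator of
  \<open>fermi_diff\<close> only s * x + 1 / x depends on u, with x = exp u and s = exp t, and it
  increases once x and s are at least 1.\<close>

lemma fermi_diff_antimono:
  assumes "0 \<le> u" "u \<le> v" "t \<ge> 0"
  shows "fermi v - fermi (v + t) \<le> fermi u - fermi (u + t)"
proof -
  define x y s where "x = exp u" and "y = exp v" and "s = exp t"
  have x: "x \<ge> 1" "x \<le> y" "s \<ge> 1" using assms by (auto simp: x_def y_def s_def)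
  have "x * y \<ge> 1 * 1" using x by (intro mult_mono) auto
  hence "(y - x) / (x * y) \<le> (y - x) / 1" using x by (intro divide_left_mono) auto
  moreover have "1 * (y - x) \<le> s * (y - x)" using x by (intro mult_right_mono) auto
  moreover have "inverse x - inverse y = (y - x) / (x * y)" using x by (simp add: field_simps)
  ultimately have "s * x + inverse x \<le> s * y + inverse y" by (simp add: algebra_simps)
  hence "(s - 1) / (s * y + inverse y + s + 1) \<le> (s - 1) / (s * x + inverse x + s + 1)"
    using x by (intro divide_left_mono mult_pos_pos add_pos_pos) auto
  thus ?thesis unfolding fermi_diff by (simp add: x_def y_def s_def exp_minus)
qed

lemma fermi_antimono: "u \<le> v \<Longrightarrow> fermi v \<le> fermi u"
  unfolding fermi_def by (intro divide_left_mono mult_pos_pos add_pos_pos) auto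

text \<open>Abel summation is applied twice. The first brings in the partial sums of
  \<open>c\<close>, whose mean m telescopes to m * \<open>fermi 0\<close>, that is m / 2. The
  partial sums minus m are again periodic with zero sum, and the second summation bounds their
  contribution by the first decrement of \<open>fermi\<close>.\<close>

lemma abel_fermi_bound:
  fixes c :: "nat \<Rightarrow> real" and t :: real
  assumes p: "p > 0" and per: "\<And>n. c (n + p) = c n" and zero: "(\<Sum>e<p. c e) = 0" and B: "\<And>n. \<bar>c n\<bar> \<le> 1"
  defines "m \<equiv> (\<Sum>x<p. \<Sum>j<Suc x. c j) / p"
  assumes t: "t > 0" and sums: "(\<lambda>e. c e * fermi (t * e)) sums A"
  shows "\<bar>A - m / 2\<bar> \<le> real p * (2 * real p) * (fermi 0 - fermi t)"
proof -
  define S where "S n = (\<Sum>j<n. c j)" for n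
  note S = periodic_partial_sum_bound[OF p per zero B, folded S_def]
  define h where "h e = fermi (t * real e)" for e :: nat
  have Sb: "\<bar>S n\<bar> \<le> p" for n using S(2)[of n] by simp
  have m: "\<bar>m\<bar> \<le> p"
  proof -
    have "\<bar>\<Sum>x<p. S (Suc x)\<bar> \<le> (\<Sum>x<p. \<bar>S (Suc x)\<bar>)" by (rule sum_abs)
    also have "\<dots> \<le> (\<Sum>x<p. real p)" by (intro sum_mono Sb)
    finally show ?thesis using p by (simp add: m_def S_def[symmetric] field_simps del: sum.lessThan_Suc)
  qed
  have hlim: "h \<longlonglongrightarrow> 0" unfolding h_def fermi_def using t by real_asymp
  have bound: "\<bar>(\<Sum>e<n. (S (Suc e) - m) * (h e - h (Suc e)))\<bar> \<le> real p * (2 * real p) * (h 0 - h (Suc 0))" for n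
  proof (rule abel_bound)
    show "\<bar>\<Sum>e<n. S (Suc e) - m\<bar> \<le> real p * (2 * real p)" for n
    proof (rule periodic_partial_sum_bound(2)[OF p])
      show "S (Suc (n + p)) - m = S (Suc n) - m" for n using S(1)[of "Suc n"] by simp
      show "(\<Sum>e<p. S (Suc e) - m) = 0"
        using p by (simp add: sum_subtractf m_def S_def[symmetric] del: sum.lessThan_Suc)
      show "\<bar>S (Suc n) - m\<bar> \<le> 2 * real p" for n using Sb[of "Suc n"] m by linarith
    qed
    show "h (Suc n) - h (Suc (Suc n)) \<le> h n - h (Suc n)" for n
      using fermi_diff_antimono[of "t * real n" "t * real (Suc n)" t] t by (simp add: h_def algebra_simps)
    show "0 \<le> h n - h (Suc n)" for n
      using t by (simp add: h_def fermi_antimono mult_left_mono)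
  qed
  have eq: "(\<Sum>e<n. c e * h e) = S n * h n + m * (h 0 - h n) + (\<Sum>e<n. (S (Suc e) - m) * (h e - h (Suc e)))" for n
  proof -
    have "(\<Sum>e<n. m * (h e - h (Suc e))) = m * (h 0 - h n)"
      by (simp add: sum_lessThan_telescope' flip: sum_distrib_left)
    thus ?thesis unfolding summation_by_parts[of c h] S_def[symmetric]
      by (simp add: left_diff_distrib sum_subtractf)
  qed
  have S0: "(\<lambda>n. S n * h n) \<longlonglongrightarrow> 0"
  proof (rule Lim_null_comparison)
    show "\<forall>\<^sub>F n in sequentially. norm (S n * h n) \<le> p * \<bar>h n\<bar>"
      using Sb by (intro always_eventually allI) (auto simp: abs_mult intro!: mult_right_mono)
    show "(\<lambda>n. p * \<bar>h n\<bar>) \<longlonglongrightarrow> 0" by (intro tendsto_mult_right_zero tendsto_rabs_zero hlim)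
  qed
  have "(\<lambda>n. \<Sum>e<n. c e * h e) \<longlonglongrightarrow> A" using sums by (simp add: sums_def h_def)
  hence "(\<lambda>n. \<bar>(\<Sum>e<n. c e * h e) - (S n * h n + m * (h 0 - h n))\<bar>) \<longlonglongrightarrow> \<bar>A - (0 + m * (h 0 - 0))\<bar>"
    by (intro tendsto_intros S0 hlim)
  moreover have "\<bar>(\<Sum>e<n. c e * h e) - (S n * h n + m * (h 0 - h n))\<bar> \<le> real p * (2 * real p) * (h 0 - h (Suc 0))" for n
    using bound[of n] unfolding eq[of n] by simp
  ultimately have "\<bar>A - (0 + m * (h 0 - 0))\<bar> \<le> real p * (2 * real p) * (h 0 - h (Suc 0))"
    by (intro LIMSEQ_le_const2) auto
  thus ?thesis by (simp add: h_def fermi_def)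
qed

section \<open>The Lambert series and its behaviour at zero\<close>

context prime_3_mod_4
begin

definition chr :: "nat \<Rightarrow> real" where "chr e = of_int (chi (int e))"

lemma chr_props: "chr (n + p) = chr n" "\<bar>chr n\<bar> \<le> 1" "chr 0 = 0"
proof -
  show "chr (n + p) = chr n" unfolding chr_def of_int_eq_iff by (rule chi_cong) (simp add: Cong.cong_def)
  show "\<bar>chr n\<bar> \<le> 1" using chi_values[of "int n"] by (auto simp: chr_def)
  show "chr 0 = 0" by (simp add: chr_def chi_0_iff)
qed

lemma chi_reflect: "chi (int p - a) = - chi a"
proof -
  have "chi (int p - a) = chi (- a)" by (rule chi_cong) (simp add: cong_iff_dvd_diff)
  thus ?thesis by (simp add: chi_minus)
qed

lemma sum_chi_period: "(\<Sum>e<p. chi (int e)) = 0"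
proof -
  have "{..<p} = insert 0 {1..<p}" using p_gt_3 by auto
  hence "(\<Sum>e<p. chi (int e)) = (\<Sum>e\<in>{1..<p}. chi (int e))" by (simp add: chi_0_iff)
  also have "\<dots> = (\<Sum>e\<in>{1..<p}. - chi (int e))"
    by (rule sum.reindex_bij_witness[of _ "\<lambda>e. p - e" "\<lambda>e. p - e"]) (auto simp: chi_reflect of_nat_diff)
  also have "\<dots> = - (\<Sum>e<p. chi (int e))"
    using \<open>(\<Sum>e<p. chi (int e)) = (\<Sum>e\<in>{1..<p}. chi (int e))\<close> by (simp add: sum_negf)
  finally show ?thesis by simp
qed

lemma sum_chr_period: "(\<Sum>e<p. chr e) = 0"
  using arg_cong[OF sum_chi_period, of real_of_int] by (simp add: chr_def)

definition lambert :: "real \<Rightarrow> real" where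
  "lambert t = (\<Sum>\<^sub>\<infinity>e\<in>{1..}. chr e / (exp (t * e) - 1))"

text \<open>Both are rearrangements of the absolutely convergent double series with terms
  \<open>chr e\<close> * exp (- t * e * k): summation over k is geometric, and grouping by m = e * k
  produces the divisor sum.\<close>

lemma lambert_has_sum:
  assumes t: "t > 0"
  shows "((\<lambda>e. chr e / (exp (t * e) - 1)) has_sum lambert t) {1..}"
    and "((\<lambda>m. of_int (chi_divisor_sum m) * exp (- (t * m))) has_sum lambert t) {1..}"
proof -
  define f where "f = (\<lambda>(e::nat, k::nat). chr e * exp (- (t * e * k)))"
  have geom: "((\<lambda>k::nat. exp (- (t * e * k))) has_sum 1 / (exp (t * e) - 1)) {1..}" if "e \<ge> 1" for e :: nat
  proof -
    have "norm (exp (- (t * e))) < 1" using t that by simp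
    note has_sum_geometric_from_1[OF this]
    moreover have "exp (- (t * e)) / (1 - exp (- (t * e))) = 1 / (exp (t * e) - 1)"
      by (simp add: exp_minus field_simps)
    ultimately show ?thesis by (simp add: mult_ac flip: exp_of_nat_mult)
  qed
  have "(\<lambda>(e::nat, k::nat). exp (- (t * e * k))) summable_on Sigma {1..} (\<lambda>_. {1..})"
  proof (rule summable_on_SigmaI)
    show "((\<lambda>k. (\<lambda>(e::nat, k::nat). exp (- (t * e * k))) (e, k)) has_sum 1 / (exp (t * e) - 1)) {1..}"
      if "e \<in> {1..}" for e using geom[of e] that by simp
    show "(\<lambda>e. 1 / (exp (t * real e) - 1)) summable_on {1..}"
    proof (rule summable_on_comparison_test)
      have "norm (exp (- t)) < 1" using t by simp
      from has_sum_geometric_from_1[OF this]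
      have "(\<lambda>e. exp (- t) ^ e) summable_on {1..}" by (auto simp: summable_on_def)
      thus "(\<lambda>e. 1 / (1 - exp (- t)) * exp (- t) ^ e) summable_on {1..}" by (rule summable_on_cmult_right)
      fix e :: nat assume "e \<in> {1..}"
      hence e: "e \<ge> 1" by simp
      have x: "exp (- (t * e)) \<le> exp (- t)" "exp (- t) < 1" using t e by auto
      have "1 / (exp (t * e) - 1) = exp (- (t * e)) / (1 - exp (- (t * e)))"
        by (simp add: exp_minus field_simps)
      also have "\<dots> \<le> exp (- (t * e)) / (1 - exp (- t))"
        using x by (intro divide_left_mono mult_pos_pos) auto
      also have "exp (- (t * e)) = exp (- t) ^ e" by (simp add: mult_ac flip: exp_of_nat_mult)
      finally show "1 / (exp (t * e) - 1) \<le> 1 / (1 - exp (- t)) * exp (- t) ^ e" by simp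
      show "0 \<le> 1 / (exp (t * e) - 1)" using t by simp
    qed
  qed auto
  hence "(\<lambda>x. norm (f x)) summable_on Sigma {1..} (\<lambda>_. {1..})"
    by (rule summable_on_comparison_test)
      (use chr_props(2) in \<open>auto simp: f_def abs_mult intro!: mult_left_le_one_le\<close>)
  hence "f summable_on Sigma {1..} (\<lambda>_. {1..})" by (rule abs_summable_summable)
  then obtain A where A: "(f has_sum A) (Sigma {1..} (\<lambda>_. {1..}))" by (auto simp: summable_on_def)
  have rows: "((\<lambda>e. chr e / (exp (t * e) - 1)) has_sum A) {1..}"
  proof (rule has_sum_SigmaD[OF A])
    show "((\<lambda>k. f (e, k)) has_sum chr e / (exp (t * e) - 1)) {1..}" if "e \<in> {1..}" for e
      using has_sum_cmult_right[OF geom[of e], of "chr e"] that by (simp add: f_def)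
  qed
  hence lam: "lambert t = A" by (simp add: lambert_def infsumI)
  thus "((\<lambda>e. chr e / (exp (t * e) - 1)) has_sum lambert t) {1..}" using rows by simp
  define g where "g = (\<lambda>(m::nat, e::nat). chr e * exp (- (t * m)))"
  have "(g has_sum A) (Sigma {1..} (\<lambda>m. {e. e dvd m}))"
    using A
    by (subst has_sum_reindex_bij_witness[where i = "\<lambda>(e, k). (e * k, e)" and j = "\<lambda>(m, e). (e, m div e)" and h = f and T = "Sigma {1..} (\<lambda>_. {1..})"])
      (auto simp: f_def g_def mult_ac Suc_le_eq elim!: dvdE)
  hence "((\<lambda>m. of_int (chi_divisor_sum m) * exp (- (t * m))) has_sum A) {1..}"
  proof (rule has_sum_SigmaD)
    fix m :: nat assume "m \<in> {1..}"
    hence "finite {e. e dvd m}" by simp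
    thus "((\<lambda>e. g (m, e)) has_sum of_int (chi_divisor_sum m) * exp (- (t * m))) {e. e dvd m}"
      by (intro has_sum_finiteI) (simp_all add: g_def chi_divisor_sum_def chr_def sum_distrib_right)
  qed
  thus "((\<lambda>m. of_int (chi_divisor_sum m) * exp (- (t * m))) has_sum lambert t) {1..}" using lam by simp
qed

lemma has_sum_from_1_imp_sums:
  assumes "(f has_sum A) {1..}"
  shows "(\<lambda>n. f (Suc n)) sums (A :: real)"
proof -
  have "bij_betw Suc UNIV {1..}"
    by (rule bij_betw_byWitness[where f' = "\<lambda>n. n - 1"]) auto
  hence "((\<lambda>n. f (Suc n)) has_sum A) UNIV" using assms by (simp add: has_sum_reindex_bij_betw)
  thus ?thesis by (rule has_sum_imp_sums)
qed

text \<open>Abel summation gives at most p / (exp t - 1), hence at most p / t. The growth of the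
  theta series is weighed against this bound to obtain finiteness.\<close>

lemma lambert_bound:
  assumes t: "t > 0"
  shows "\<bar>t * lambert t\<bar> \<le> p"
proof -
  define h where "h e = 1 / (exp (t * real (Suc e)) - 1)" for e
  have "(\<lambda>e. chr (Suc e) * h e) sums lambert t"
    using has_sum_from_1_imp_sums[OF lambert_has_sum(1)[OF t]] by (simp add: h_def)
  hence lim: "(\<lambda>n. \<Sum>e<n. chr (Suc e) * h e) \<longlonglongrightarrow> lambert t" by (simp add: sums_def)
  have "\<bar>\<Sum>e<n. chr (Suc e)\<bar> \<le> p" for n
    using periodic_partial_sum_bound(2)[OF _ chr_props(1) sum_chr_period chr_props(2), of "Suc n"] p_gt_3 chr_props(3)
    by (simp add: sum.lessThan_Suc_shift del: sum.lessThan_Suc)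
  hence "\<bar>\<Sum>e<n. chr (Suc e) * h e\<bar> \<le> p * h 0" for n
  proof (rule abel_bound)
    show "h (Suc n) \<le> h n" for n unfolding h_def using t by (intro divide_left_mono mult_pos_pos) auto
    show "0 \<le> h n" for n using t by (simp add: h_def)
  qed
  hence "\<bar>lambert t\<bar> \<le> p * h 0"
    by (intro LIMSEQ_le_const2[OF tendsto_rabs[OF lim]]) auto
  hence "t * \<bar>lambert t\<bar> \<le> t * (p * h 0)" using t by (intro mult_left_mono) auto
  also have "\<dots> = p * (t / (exp t - 1))" by (simp add: h_def)
  also have "t / (exp t - 1) \<le> 1" using t exp_ge_add_one_self[of t] by (simp add: field_simps)
  hence "p * (t / (exp t - 1)) \<le> p" using mult_left_mono[of "t / (exp t - 1)" 1 "real p"] by simp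
  finally show ?thesis using t by (simp add: abs_mult)
qed

definition chi_mean :: real where "chi_mean = (\<Sum>x<p. \<Sum>j<Suc x. chr j) / p"

lemma lambert_limit: "((\<lambda>t. lambert t - 2 * lambert (2 * t)) \<longlongrightarrow> chi_mean / 2) (at_right 0)"
proof -
  have est: "\<bar>lambert t - 2 * lambert (2 * t) - chi_mean / 2\<bar> \<le> real p * (2 * real p) * (fermi 0 - fermi t)" if t: "t > 0" for t
  proof -
    have eq: "chr e / (exp (t * e) - 1) - 2 * (chr e / (exp (2 * t * e) - 1)) = chr e * fermi (t * e)"
      if "e \<ge> 1" for e :: nat
    proof -
      define x where "x = exp (t * e)"
      have x: "x > 1" using t that by (simp add: x_def)
      have "exp (2 * t * e) = x\<^sup>2" by (simp add: x_def mult_ac flip: exp_of_nat_mult)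
      moreover have "x\<^sup>2 - 1 = (x - 1) * (x + 1)" by (simp add: power2_eq_square algebra_simps)
      moreover have "x - 1 \<noteq> 0" "x + 1 \<noteq> 0" using x by auto
      ultimately show ?thesis by (simp add: fermi_def x_def[symmetric] divide_simps) (simp add: algebra_simps)
    qed
    have "((\<lambda>e. chr e / (exp (t * e) - 1) + - (2 * (chr e / (exp (2 * t * e) - 1)))) has_sum
        (lambert t + - (2 * lambert (2 * t)))) {1..}"
      using lambert_has_sum(1)[of t] lambert_has_sum(1)[of "2 * t"] t
      by (intro has_sum_add has_sum_uminusI has_sum_cmult_right) auto
    hence "((\<lambda>e. chr e * fermi (t * e)) has_sum (lambert t - 2 * lambert (2 * t))) {1..}"
      using eq by (subst has_sum_cong[where g = "\<lambda>e. chr e / (exp (t * e) - 1) + - (2 * (chr e / (exp (2 * t * e) - 1)))"]) auto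
    hence "(\<lambda>n. chr (Suc n) * fermi (t * Suc n)) sums (lambert t - 2 * lambert (2 * t))"
      by (rule has_sum_from_1_imp_sums)
    \<comment> \<open>The series may start at 0 because \<open>chr 0\<close> vanishes; full periods
      then begin at the first term.\<close>
    hence sums: "(\<lambda>n. chr n * fermi (t * n)) sums (lambert t - 2 * lambert (2 * t))"
      by (subst (asm) sums_Suc_iff) (simp add: chr_props)
    show ?thesis
      unfolding chi_mean_def using p_gt_3
      by (intro abel_fermi_bound[OF _ chr_props(1) sum_chr_period chr_props(2) t sums]) simp
  qed
  have "((\<lambda>t. (lambert t - 2 * lambert (2 * t)) - chi_mean / 2) \<longlongrightarrow> 0) (at_right 0)"
  proof (rule Lim_null_comparison)
    show "\<forall>\<^sub>F t in at_right 0. norm ((lambert t - 2 * lambert (2 * t)) - chi_mean / 2) \<le> real p * (2 * real p) * (fermi 0 - fermi t)"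
      using est by (auto simp: eventually_at_right_field intro!: exI[of _ 1])
    show "((\<lambda>t. real p * (2 * real p) * (fermi 0 - fermi t)) \<longlongrightarrow> 0) (at_right 0)"
      unfolding fermi_def by real_asymp
  qed
  thus ?thesis by (simp add: LIM_zero_cancel)
qed

end

section \<open>Ideals of the ring of integers\<close>

text \<open>If n is the reduced denominator, then n ^ k divides D for every k, which leaves only n =
  1.\<close>

lemma rational_bounded_denominator_imp_int:
  fixes r :: real
  assumes r: "r \<in> \<rat>" and D: "D \<noteq> 0" and int: "\<And>k. of_int D * r ^ k \<in> \<int>"
  shows "r \<in> \<int>"
proof -
  obtain m n :: nat where mn: "n \<noteq> 0" "\<bar>r\<bar> = real m / real n" "coprime m n"
    using Rats_abs_nat_div_natE[OF r] by blast
  have "n ^ k dvd nat \<bar>D\<bar>" for k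
  proof -
    obtain j where j: "of_int D * r ^ k = of_int j" using int[of k] by (auto elim: Ints_cases)
    have "\<bar>of_int D\<bar> * \<bar>r\<bar> ^ k = \<bar>real_of_int j\<bar>" using j by (metis abs_mult power_abs)
    hence "real (nat \<bar>D\<bar>) * (real m ^ k / real n ^ k) = real (nat \<bar>j\<bar>)"
      by (simp add: mn power_divide)
    hence "real (nat \<bar>D\<bar> * m ^ k) = real (nat \<bar>j\<bar> * n ^ k)"
      using mn(1) by (simp add: field_simps)
    hence "nat \<bar>D\<bar> * m ^ k = nat \<bar>j\<bar> * n ^ k" by (simp only: of_nat_eq_iff)
    hence "n ^ k dvd nat \<bar>D\<bar> * m ^ k" by simp
    moreover have "coprime (n ^ k) (m ^ k)" using mn(3) by (simp add: coprime_commute)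
    ultimately show ?thesis by (simp add: coprime_dvd_mult_left_iff)
  qed
  hence le: "n ^ k \<le> nat \<bar>D\<bar>" for k using D by (intro dvd_imp_le) auto
  have "n = 1"
  proof (rule ccontr)
    assume "n \<noteq> 1"
    hence "2 \<le> n" using mn(1) by simp
    hence "2 ^ nat \<bar>D\<bar> \<le> n ^ nat \<bar>D\<bar>" by (rule power_mono) simp
    thus False using le[of "nat \<bar>D\<bar>"] less_exp[of "nat \<bar>D\<bar>"] by linarith
  qed
  hence "\<bar>r\<bar> = of_int (int m)" using mn by simp
  thus ?thesis by (metis Ints_of_int Ints_minus abs_if minus_minus)
qed

context prime_3_mod_4
begin

definition omega :: complex where "omega = Complex (1 / 2) (sqrt p / 2)"

definition ok :: "int \<Rightarrow> int \<Rightarrow> complex" where "ok x y = of_int x + of_int y * omega"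

definition OK :: "complex set" where "OK = {ok x y | x y. True}"

lemma OK_I [simp, intro]: "ok x y \<in> OK" by (auto simp: OK_def)

lemma OK_E: assumes "u \<in> OK" obtains x y where "u = ok x y" using assms by (auto simp: OK_def)

lemma Re_ok: "Re (ok x y) = x + y / 2" and Im_ok: "Im (ok x y) = y * sqrt p / 2"
  by (simp_all add: ok_def omega_def)

lemma omega_square: "omega * omega = omega - of_int c0"
proof -
  have "real_of_int (4 * c0) = p + 1" using p_eq by simp
  thus ?thesis by (simp add: omega_def complex_eq_iff)
qed

lemma ok_eq_iff [simp]: "ok x y = ok u v \<longleftrightarrow> x = u \<and> y = v"
  using p_gt_3 by (auto simp: complex_eq_iff Re_ok Im_ok)

lemma ok_add: "ok x y + ok u v = ok (x + u) (y + v)"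
  by (simp add: ok_def algebra_simps)

lemma ok_uminus: "- ok x y = ok (- x) (- y)"
  by (simp add: ok_def)

lemma ok_mult: "ok x y * ok u v = ok (x * u - c0 * y * v) (x * v + y * u + y * v)"
proof -
  have "ok x y * ok u v = of_int (x * u) + of_int (x * v + y * u) * omega + of_int (y * v) * (omega * omega)"
    by (simp add: ok_def algebra_simps)
  thus ?thesis unfolding omega_square by (simp add: ok_def algebra_simps)
qed

lemma ok_int: "of_int x = ok x 0" by (simp add: ok_def)

lemma ok_0: "0 = ok 0 0" by (simp add: ok_def)

lemma ok_scale: "of_int n * ok x y = ok (n * x) (n * y)"
  by (simp add: ok_def algebra_simps)

lemma cnj_ok: "cnj (ok x y) = ok (x + y) (- y)"
  by (simp add: complex_eq_iff Re_ok Im_ok)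

lemma cmod_ok: "(cmod (ok x y))\<^sup>2 = of_int (x\<^sup>2 + x * y + c0 * y\<^sup>2)"
proof -
  have "of_int ((x\<^sup>2 + x * y + c0 * y\<^sup>2)) = ok x y * cnj (ok x y)"
    unfolding cnj_ok ok_mult ok_int by (simp add: algebra_simps power2_eq_square)
  also have "\<dots> = of_real ((cmod (ok x y))\<^sup>2)" by (rule complex_norm_square[symmetric])
  finally have "complex_of_real ((cmod (ok x y))\<^sup>2) = complex_of_real (of_int (x\<^sup>2 + x * y + c0 * y\<^sup>2))" by simp
  thus ?thesis unfolding of_real_eq_iff .
qed

lemma OK_add: "u \<in> OK \<Longrightarrow> v \<in> OK \<Longrightarrow> u + v \<in> OK"
  by (auto elim!: OK_E simp: ok_add)

lemma OK_mult: "u \<in> OK \<Longrightarrow> v \<in> OK \<Longrightarrow> u * v \<in> OK"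
  by (auto elim!: OK_E simp: ok_mult)

lemma OK_uminus: "u \<in> OK \<Longrightarrow> - u \<in> OK"
  by (auto elim!: OK_E simp: ok_uminus)

lemma OK_int [simp]: "of_int n \<in> OK" and OK_0 [simp]: "0 \<in> OK" and OK_1 [simp]: "1 \<in> OK"
  and OK_nat [simp]: "of_nat k \<in> OK"
proof -
  show n: "of_int n \<in> OK" for n by (simp add: ok_int)
  show "0 \<in> OK" "1 \<in> OK" "of_nat k \<in> OK" using n[of 0] n[of 1] n[of "int k"] by simp_all
qed

lemma OK_cnj: "u \<in> OK \<Longrightarrow> cnj u \<in> OK"
  by (auto elim!: OK_E simp: cnj_ok)

lemma OK_power: "u \<in> OK \<Longrightarrow> u ^ k \<in> OK"
  by (induction k) (auto intro: OK_mult)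

lemma OK_sum: "(\<And>i. i \<in> A \<Longrightarrow> f i \<in> OK) \<Longrightarrow> sum f A \<in> OK"
  by (induction A rule: infinite_finite_induct) (auto intro: OK_add)

lemma cmod_OK: "u \<in> OK \<Longrightarrow> (cmod u)\<^sup>2 \<in> \<int>"
  by (auto elim!: OK_E simp: cmod_ok)

lemma csqrt_eq: "csqrt (of_int (- int p)) = 2 * omega - 1"
  by (simp add: complex_eq_iff omega_def)

lemma ok_in_field: "ok x y \<in> quadratic_field (- int p)"
proof -
  have "ok x y = of_rat (of_int x + of_int y / 2) + of_rat (of_int y / 2) * csqrt (of_int (- int p))"
    unfolding csqrt_eq by (simp add: ok_def of_rat_add of_rat_divide algebra_simps)
  thus ?thesis unfolding quadratic_field_def by blast
qed

lemma algebraic_int_ok: "algebraic_int (ok x y)"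
proof (rule algebraic_int.intros)
  let ?P = "[:of_int (x\<^sup>2 + x * y + c0 * y\<^sup>2), of_int (- (2 * x + y)), 1:] :: complex poly"
  show "lead_coeff ?P = 1" by simp
  show "\<forall>i. Polynomial.coeff ?P i \<in> \<int>" by (auto simp: coeff_pCons split: nat.splits)
  have "poly ?P (ok x y) = ok (x\<^sup>2 + x * y + c0 * y\<^sup>2) 0 + ok x y * (ok (- (2 * x + y)) 0 + ok x y)"
    unfolding ok_int[symmetric] by simp
  also have "\<dots> = 0" unfolding ok_add ok_mult ok_0 by (simp add: algebra_simps power2_eq_square)
  finally show "poly ?P (ok x y) = 0" .
qed

text \<open>The monic equation of degree n expresses z ^ k for k at least n by lower powers, and d ^
  n clears the denominators of all powers below n.\<close>

lemma algebraic_int_bounded_denominator: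
  assumes alg: "algebraic_int z" and d: "d \<noteq> 0" "of_int d * z \<in> OK"
  shows "\<exists>D. D \<noteq> 0 \<and> (\<forall>k. of_int D * z ^ k \<in> OK)"
proof -
  obtain P :: "int poly" where P: "poly (map_poly of_int P) z = 0" "lead_coeff P = 1"
    using alg unfolding algebraic_int_altdef_ipoly by blast
  define n where "n = degree P"
  have "(\<Sum>i\<le>n. of_int (Polynomial.coeff P i) * z ^ i) = 0"
    using P(1) by (simp add: poly_altdef n_def degree_map_poly coeff_map_poly)
  moreover have "(\<Sum>i\<le>n. of_int (Polynomial.coeff P i) * z ^ i) = (\<Sum>i<n. of_int (Polynomial.coeff P i) * z ^ i) + z ^ n"
    using P(2) unfolding lessThan_Suc_atMost[symmetric] sum.lessThan_Suc by (simp add: n_def)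
  ultimately have zn: "z ^ n = - (\<Sum>i<n. of_int (Polynomial.coeff P i) * z ^ i)"
    by (metis add.commute eq_neg_iff_add_eq_0)
  have "of_int (d ^ n) * z ^ k \<in> OK" for k
  proof (induction k rule: less_induct)
    case (less k)
    show ?case
    proof (cases "k < n")
      case True
      hence "of_int (d ^ n) * z ^ k = of_int (d ^ (n - k)) * (of_int d * z) ^ k"
        by (simp add: power_mult_distrib flip: power_add mult.assoc)
      thus ?thesis using d by (simp add: OK_mult OK_power del: of_int_power)
    next
      case False
      hence "of_int (d ^ n) * z ^ k = of_int (d ^ n) * (z ^ n * z ^ (k - n))"
        by (simp flip: power_add)
      also have "\<dots> = - (\<Sum>i<n. of_int (Polynomial.coeff P i) * (of_int (d ^ n) * z ^ (i + (k - n))))"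
        unfolding zn by (simp add: sum_distrib_left sum_distrib_right power_add mult_ac)
      also have "\<dots> \<in> OK"
        using False by (intro OK_uminus OK_sum OK_mult less) auto
      finally show ?thesis .
    qed
  qed
  thus ?thesis using d(1) by (intro exI[of _ "d ^ n"]) auto
qed

text \<open>The powers of z and of z + 1 have a common denominator, hence so do the powers of their
  norms, which are therefore integers; the difference of the two norms yields the trace
  \<open>2 * a\<close>. Integrality of \<open>2 * b\<close> then follows because p is
  squarefree.\<close>

lemma field_algebraic_int_imp_OK:
  assumes K: "z \<in> quadratic_field (- int p)" and alg: "algebraic_int z"
  shows "z \<in> OK"
proof -
  obtain a b where ab: "z = of_rat a + of_rat b * (2 * omega - 1)"
    using K unfolding quadratic_field_def csqrt_eq by blast
  have of_rat: "complex_of_rat x = of_real (of_rat x)" for x by (cases x) (simp add: of_rat_rat)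
  have Re: "Re z = of_rat a" and Im: "Im z = of_rat b * sqrt p"
    unfolding ab by (simp_all add: omega_def of_rat)
  obtain i j where a: "a = Rat.Fract i j" "j > 0" by (cases a)
  obtain k l where b: "b = Rat.Fract k l" "l > 0" by (cases b)
  have "of_int (j * l) * z = ok (i * l - k * j) (2 * k * j)"
    unfolding ab a b using a b by (simp add: of_rat_rat ok_def field_simps)
  hence "of_int (j * l) * z \<in> OK" by simp
  moreover have "j * l \<noteq> 0" using a b by simp
  ultimately obtain D where D: "D \<noteq> 0" "\<And>k. of_int D * z ^ k \<in> OK"
    using algebraic_int_bounded_denominator[OF alg] by blast
  have D1: "of_int D * (z + 1) ^ k \<in> OK" for k
  proof -
    have "of_int D * (z + 1) ^ k = (\<Sum>i\<le>k. of_nat (k choose i) * (of_int D * z ^ i))"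
      by (subst binomial_ring) (simp add: sum_distrib_left mult_ac)
    also have "\<dots> \<in> OK" by (intro OK_sum OK_mult[OF OK_nat D(2)])
    finally show ?thesis .
  qed
  have int: "(cmod w)\<^sup>2 \<in> \<int>" if w: "\<And>k. of_int D * w ^ k \<in> OK" and rat: "(cmod w)\<^sup>2 \<in> \<rat>" for w
  proof (rule rational_bounded_denominator_imp_int[OF rat])
    show "D\<^sup>2 \<noteq> 0" using D by simp
    have "(cmod (of_int D * w ^ k))\<^sup>2 = of_int (D\<^sup>2) * ((cmod w)\<^sup>2) ^ k" for k
      by (simp add: norm_mult norm_power power_mult_distrib power2_abs mult.commute flip: power_mult)
    thus "of_int (D\<^sup>2) * ((cmod w)\<^sup>2) ^ k \<in> \<int>" for k using cmod_OK[OF w[of k]] by metis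
  qed
  have N: "(cmod z)\<^sup>2 = of_rat (a\<^sup>2 + of_nat p * b\<^sup>2)"
    unfolding cmod_power2 Re Im by (simp add: of_rat_add of_rat_mult of_rat_power power_mult_distrib)
  have N1: "(cmod (z + 1))\<^sup>2 = of_rat ((a + 1)\<^sup>2 + of_nat p * b\<^sup>2)"
    unfolding cmod_power2 by (simp add: Re Im of_rat_add of_rat_mult of_rat_power power_mult_distrib)
  obtain s where s: "(cmod z)\<^sup>2 = of_int s" using int[OF D(2)] N by (auto elim: Ints_cases)
  obtain s1 where s1: "(cmod (z + 1))\<^sup>2 = of_int s1" using int[OF D1] N1 by (auto elim: Ints_cases)
  have "of_rat (2 * a) = real_of_int (s1 - s - 1)"
    using N N1 s s1 by (simp add: of_rat_add of_rat_mult of_rat_power power2_eq_square algebra_simps)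
  hence m: "2 * a = of_int (s1 - s - 1)" by (metis of_rat_eq_iff of_rat_of_int_eq)
  define m where "m = s1 - s - 1"
  have "real_of_rat (a\<^sup>2 + of_nat p * b\<^sup>2) = of_rat (of_int s)" using N s by simp
  hence "a\<^sup>2 + of_nat p * b\<^sup>2 = of_int s" unfolding of_rat_eq_iff .
  moreover have "a = of_int m / 2" using m by (simp add: m_def field_simps)
  ultimately have pb: "of_nat p * (2 * b)\<^sup>2 = of_int (4 * s - m\<^sup>2)"
    by (simp add: power2_eq_square field_simps)
  have "real_of_rat (2 * b) \<in> \<rat>" by simp
  then obtain u v :: nat where uv: "v \<noteq> 0" "\<bar>real_of_rat (2 * b)\<bar> = real u / real v" "coprime u v"
    using Rats_abs_nat_div_natE by blast
  have "real p * (real_of_rat (2 * b))\<^sup>2 = of_int (4 * s - m\<^sup>2)"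
    using arg_cong[OF pb, of real_of_rat] by (simp add: of_rat_mult of_rat_power of_rat_diff)
  hence "real p * (real u / real v)\<^sup>2 = of_int (4 * s - m\<^sup>2)" by (simp only: uv(2)[symmetric] power2_abs)
  hence "real_of_int (int (p * u\<^sup>2)) = real_of_int ((4 * s - m\<^sup>2) * int (v\<^sup>2))"
    using uv(1) by (simp add: field_simps power_divide)
  hence puv: "int (p * u\<^sup>2) = (4 * s - m\<^sup>2) * int (v\<^sup>2)" by (simp only: of_int_eq_iff)
  hence "int (v\<^sup>2) dvd int (p * u\<^sup>2)" by simp
  hence "v\<^sup>2 dvd p * u\<^sup>2" by (simp only: of_nat_dvd_iff)
  moreover have "coprime (v\<^sup>2) (u\<^sup>2)" using uv(3) by (simp add: coprime_commute)
  ultimately have vp: "v\<^sup>2 dvd p" by (simp add: coprime_dvd_mult_left_iff)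
  have "v = 1"
  proof -
    have "v dvd p" using vp by (rule dvd_trans[rotated]) (simp add: power2_eq_square)
    hence "v = 1 \<or> v = p" using p_prime by (simp add: prime_nat_iff)
    moreover have "\<not> p\<^sup>2 dvd p" using p_gt_3 dvd_imp_le[of "p\<^sup>2" p] by (auto simp: power2_eq_square)
    ultimately show ?thesis using vp by auto
  qed
  hence "\<bar>real_of_rat (2 * b)\<bar> = of_int (int u)" using uv by simp
  then obtain n :: int where "real_of_rat (2 * b) = of_int n" by (metis abs_if minus_minus of_int_minus)
  hence n: "2 * b = of_int n" by (metis of_rat_eq_iff of_rat_of_int_eq)
  have "of_int (int p * n\<^sup>2) = (of_int (4 * s - m\<^sup>2) :: rat)" using pb unfolding n by simp
  hence "int p * n\<^sup>2 = 4 * s - m\<^sup>2" by (simp only: of_int_eq_iff)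
  \<comment> \<open>Since p is -1 modulo 4, m and n have equal parity, which is what singles out the
    span of 1 and omega among half-integral coordinates.\<close>
  hence "4 * s = m\<^sup>2 + (4 * c0 - 1) * n\<^sup>2" unfolding p_eq by simp
  hence "m\<^sup>2 - n\<^sup>2 = 4 * (s - c0 * n\<^sup>2)" by (simp add: algebra_simps)
  hence "even (m\<^sup>2 - n\<^sup>2)" by simp
  hence "even (m - n)" by simp
  then obtain x where x: "m - n = 2 * x" unfolding dvd_def by blast
  have "z = ok x n"
  proof -
    have "complex_of_rat (2 * a) = of_int m" "complex_of_rat (2 * b) = of_int n"
      unfolding n m m_def by (simp_all only: of_rat_of_int_eq)
    hence "2 * z = of_int m + of_int n * (2 * omega - 1)"
      unfolding ab by (simp add: of_rat_mult algebra_simps)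
    also have "of_int m = (of_int n + of_int (2 * x) :: complex)"
      unfolding of_int_add[symmetric] of_int_eq_iff using x by simp
    also have "\<dots> + of_int n * (2 * omega - 1) = 2 * ok x n" by (simp add: ok_def algebra_simps)
    finally show ?thesis by simp
  qed
  thus ?thesis by simp
qed

section \<open>Ideals as lattices in normal form\<close>

abbreviation "R \<equiv> ring_of_integers (quadratic_field (- int p))"

lemma carrier_R: "carrier R = OK"
  using field_algebraic_int_imp_OK ok_in_field algebraic_int_ok
  by (auto simp: ring_of_integers_def elim!: OK_E)

lemma R_simps [simp]: "mult R = (*)" "one R = 1" "zero R = 0" "add R = (+)"
  by (simp_all add: ring_of_integers_def)

lemma ring_R: "ring R"
proof (rule ringI)
  show "abelian_group R"
    by (rule abelian_groupI) (auto simp: carrier_R OK_add algebra_simps intro: bexI[OF _ OK_uminus])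
  show "monoid R" by (rule monoidI) (auto simp: carrier_R OK_mult)
qed (auto simp: algebra_simps)

definition idl :: "complex set \<Rightarrow> bool" where
  "idl I \<longleftrightarrow> I \<subseteq> OK \<and> 0 \<in> I \<and> (\<forall>u\<in>I. \<forall>v\<in>I. u + v \<in> I) \<and> (\<forall>r\<in>OK. \<forall>u\<in>I. r * u \<in> I)"

lemma ideal_R_iff: "ideal I R \<longleftrightarrow> idl I"
proof
  assume "ideal I R"
  then interpret ideal I R .
  show "idl I"
    using a_subset additive_subgroup.zero_closed[OF is_additive_subgroup]
      additive_subgroup.a_closed[OF is_additive_subgroup] I_l_closed
    unfolding idl_def carrier_R by auto
next
  assume I: "idl I"
  interpret ring R by (rule ring_R)
  show "ideal I R"
  proof (rule idealI[OF ring_R])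
    show "subgroup I (add_monoid R)"
    proof
      fix x assume x: "x \<in> I"
      have "inv\<^bsub>add_monoid R\<^esub> x = - x"
        unfolding a_inv_def[symmetric] using x I
        by (intro minus_equality) (auto simp: idl_def carrier_R intro: OK_uminus)
      moreover have "- 1 * x \<in> I" using x I OK_uminus[OF OK_1] unfolding idl_def by blast
      ultimately show "inv\<^bsub>add_monoid R\<^esub> x \<in> I" by simp
    qed (use I in \<open>auto simp: idl_def carrier_R\<close>)
    fix a x assume "a \<in> I" "x \<in> carrier R"
    hence "x * a \<in> I" using I by (auto simp: idl_def carrier_R)
    thus "x \<otimes>\<^bsub>R\<^esub> a \<in> I" "a \<otimes>\<^bsub>R\<^esub> x \<in> I" by (simp_all add: mult.commute)
  qed
qed

lemma nonzero_ideals_R: "nonzero_ideals R = {I. idl I \<and> I \<noteq> {0}}"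
  by (simp add: nonzero_ideals_def ideal_R_iff)

text \<open>The lattice g * (Z a + Z (b + omega)) in the coordinates of \<open>ok\<close>, the
  Hermite normal form of an ideal.\<close>

definition lat :: "int \<Rightarrow> int \<Rightarrow> int \<Rightarrow> complex set" where
  "lat g a b = {ok (g * (x * a + y * b)) (g * y) | x y. True}"

text \<open>The divisibility is what makes the lattice closed under multiplication by omega.\<close>

definition lat_data :: "int \<Rightarrow> int \<Rightarrow> int \<Rightarrow> bool" where
  "lat_data g a b \<longleftrightarrow> g > 0 \<and> a > 0 \<and> a dvd nf b"

lemma lat_mem_iff: "ok u v \<in> lat g a b \<longleftrightarrow> (\<exists>x y. u = g * (x * a + y * b) \<and> v = g * y)"
  by (auto simp: lat_def)

lemma lat_basis: "ok (g * a) 0 \<in> lat g a b" "ok (g * b) g \<in> lat g a b"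
  unfolding lat_mem_iff by (rule exI[of _ 1], rule exI[of _ 0], simp) (rule exI[of _ 0], rule exI[of _ 1], simp)

lemma idl_lat:
  assumes "lat_data g a b"
  shows "idl (lat g a b)" "lat g a b \<noteq> {0}"
proof -
  obtain C where C: "nf b = a * C" using assms by (auto simp: lat_data_def elim: dvdE)
  have ga: "g > 0" "a > 0" using assms by (auto simp: lat_data_def)
  show "idl (lat g a b)"
    unfolding idl_def
  proof (intro conjI ballI)
    show "lat g a b \<subseteq> OK" by (auto simp: lat_def)
    show "0 \<in> lat g a b" unfolding ok_0 lat_mem_iff by (intro exI[of _ 0]) auto
    fix u v assume "u \<in> lat g a b" "v \<in> lat g a b"
    then obtain x y x' y' where "u = ok (g * (x * a + y * b)) (g * y)" "v = ok (g * (x' * a + y' * b)) (g * y')"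
      by (auto simp: lat_def)
    hence "u + v = ok (g * ((x + x') * a + (y + y') * b)) (g * (y + y'))"
      by (simp add: ok_add algebra_simps)
    thus "u + v \<in> lat g a b" by (auto simp: lat_def)
  next
    fix r u assume "r \<in> OK" "u \<in> lat g a b"
    then obtain s t x y where r: "r = ok s t" and u: "u = ok (g * (x * a + y * b)) (g * y)"
      by (auto simp: lat_def elim!: OK_E)
    define y' where "y' = s * y + t * (x * a + y * b) + t * y"
    define x' where "x' = s * x - t * b * x - t * y * C"
    have c0: "c0 = a * C - b * b - b" using C by (simp add: nf_def power2_eq_square)
    have "r * u = ok (g * (x' * a + y' * b)) (g * y')"
      unfolding r u ok_mult ok_eq_iff x'_def y'_def c0 by (simp add: algebra_simps)
    thus "r * u \<in> lat g a b" by (auto simp: lat_def)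
  qed
  note lat_basis(1)[of g a b]
  moreover have "ok (g * a) 0 \<noteq> 0" using ga unfolding ok_0 by simp
  ultimately show "lat g a b \<noteq> {0}" by blast
qed

lemma int_subgroup_generator:
  fixes Y :: "int set"
  assumes sub: "\<And>x y. x \<in> Y \<Longrightarrow> y \<in> Y \<Longrightarrow> x + y \<in> Y" "\<And>x n. x \<in> Y \<Longrightarrow> n * x \<in> Y" and nz: "y0 \<in> Y" "y0 \<noteq> 0"
  obtains g where "g > 0" "g \<in> Y" "\<And>y. y \<in> Y \<Longrightarrow> g dvd y"
proof -
  define P where "P n \<longleftrightarrow> n > 0 \<and> int n \<in> Y" for n
  have "\<bar>y0\<bar> \<in> Y" using sub(2)[OF nz(1), of 1] sub(2)[OF nz(1), of "-1"] by (auto simp: abs_if)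
  hence ex: "P (nat \<bar>y0\<bar>)" using nz by (simp add: P_def)
  define g where "g = (LEAST n. P n)"
  have g: "P g" unfolding g_def by (rule LeastI[of P, OF ex])
  have "int g dvd y" if y: "y \<in> Y" for y
  proof -
    have "y mod int g \<in> Y"
      using sub(1)[OF y sub(2)[of "int g" "- (y div int g)"]] g by (simp add: P_def minus_div_mult_eq_mod)
    moreover have "0 \<le> y mod int g" "y mod int g < int g" using g by (auto simp: P_def)
    ultimately have "\<not> y mod int g > 0"
      using not_less_Least[of "nat (y mod int g)" P] unfolding g_def[symmetric] by (auto simp: P_def)
    thus ?thesis using \<open>0 \<le> y mod int g\<close> by auto
  qed
  thus ?thesis using that[of "int g"] g by (auto simp: P_def)
qed

text \<open>N generates the rational integers of I, and g generates the omega coordinates occurring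
  in I. Multiplication by omega moves a first coordinate into the second, which forces g to divide
  both.\<close>

lemma idl_imp_lat:
  assumes I: "idl I" and nz: "I \<noteq> {0}"
  obtains g a b where "lat_data g a b" "0 \<le> b" "b < a" "I = lat g a b"
proof -
  have sub: "I \<subseteq> OK" and zero: "0 \<in> I" and add: "\<And>u v. u \<in> I \<Longrightarrow> v \<in> I \<Longrightarrow> u + v \<in> I"
    and mult: "\<And>r u. r \<in> OK \<Longrightarrow> u \<in> I \<Longrightarrow> r * u \<in> I"
    using I by (auto simp: idl_def)
  have scale: "ok (n * x) (n * y) \<in> I" if "ok x y \<in> I" for n x y
    using mult[OF OK_int that, of n] by (simp add: ok_scale)
  have add': "ok (x + u) (y + v) \<in> I" if "ok x y \<in> I" "ok u v \<in> I" for x y u v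
    using add[OF that] by (simp add: ok_add)
  have omega: "ok (- c0 * y) (x + y) \<in> I" if "ok x y \<in> I" for x y
    using mult[OF OK_I that, of 0 1] by (simp add: ok_mult)
  obtain w where w: "w \<in> I" "w \<noteq> 0" using nz zero by blast
  then obtain u v where "w = ok u v" using sub by (auto elim!: OK_E)
  hence uv: "ok u v \<in> I" "ok u v \<noteq> 0" using w by auto
  define X where "X = {x. ok x 0 \<in> I}"
  define Y where "Y = {y. \<exists>x. ok x y \<in> I}"
  have norm: "ok (u\<^sup>2 + u * v + c0 * v\<^sup>2) 0 \<in> I"
    using mult[OF OK_I uv(1), of "u + v" "- v"] by (simp add: ok_mult algebra_simps power2_eq_square)
  have "4 * (u\<^sup>2 + u * v + c0 * v\<^sup>2) = (2 * u + v)\<^sup>2 + int p * v\<^sup>2"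
    unfolding p_eq by (simp add: power2_eq_square algebra_simps)
  also have "\<dots> \<noteq> 0"
  proof
    assume *: "(2 * u + v)\<^sup>2 + int p * v\<^sup>2 = 0"
    have "int p * v\<^sup>2 \<ge> 0" "(2 * u + v)\<^sup>2 \<ge> 0" by auto
    with * have "int p * v\<^sup>2 = 0" "(2 * u + v)\<^sup>2 = 0" by linarith+
    thus False using uv(2) p_gt_3 unfolding ok_0 by auto
  qed
  finally have Xnz: "u\<^sup>2 + u * v + c0 * v\<^sup>2 \<noteq> 0" by auto
  obtain N where N: "N > 0" "ok N 0 \<in> I" "\<And>x. ok x 0 \<in> I \<Longrightarrow> N dvd x"
  proof (rule int_subgroup_generator[of X "u\<^sup>2 + u * v + c0 * v\<^sup>2"])
    show "x + y \<in> X" if "x \<in> X" "y \<in> X" for x y using add'[of x 0 y 0] that by (simp add: X_def)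
    show "n * x \<in> X" if "x \<in> X" for n x using scale[of x 0 n] that by (simp add: X_def)
  qed (use norm Xnz that in \<open>auto simp: X_def\<close>)
  have "N \<in> Y" using omega[OF N(2)] by (auto simp: Y_def)
  obtain g where g: "g > 0" "g \<in> Y" "\<And>y. y \<in> Y \<Longrightarrow> g dvd y"
  proof (rule int_subgroup_generator[of Y N])
    show "x + y \<in> Y" if "x \<in> Y" "y \<in> Y" for x y using add' that unfolding Y_def by blast
    show "n * x \<in> Y" if "x \<in> Y" for n x using scale that unfolding Y_def by blast
  qed (use N \<open>N \<in> Y\<close> that in auto)
  obtain x0 where x0: "ok x0 g \<in> I" using g(2) by (auto simp: Y_def)
  have "g dvd N" using g(3) \<open>N \<in> Y\<close> by blast
  then obtain a where a: "N = g * a" by (auto elim: dvdE)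
  have a0: "a > 0" using N(1) g(1) a by (simp add: zero_less_mult_iff)
  have "g dvd x0 + g" using omega[OF x0] by (intro g(3)) (auto simp: Y_def)
  hence "g dvd x0" by simp
  then obtain b0 where b0: "x0 = g * b0" by (auto elim: dvdE)
  define b where "b = b0 mod a"
  have b: "0 \<le> b" "b < a" using a0 by (auto simp: b_def)
  have beta: "ok (g * b) g \<in> I"
  proof -
    have "ok (x0 + - (b0 div a) * N) (g + - (b0 div a) * 0) \<in> I" by (intro add' scale x0 N)
    moreover have "x0 + - (b0 div a) * N = g * b"
      unfolding a b0 b_def by (simp add: algebra_simps minus_div_mult_eq_mod[symmetric])
    ultimately show ?thesis by simp
  qed
  \<comment> \<open>The multiplier is the conjugate of b + omega, so the product is g times the norm
    \<open>nf b\<close>.\<close>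
  have "ok (b + 1) (-1) * ok (g * b) g \<in> I" by (intro mult beta OK_I)
  also have "ok (b + 1) (-1) * ok (g * b) g = ok (g * nf b) 0"
    by (simp add: ok_mult nf_def algebra_simps power2_eq_square)
  finally have "g * a dvd g * nf b" using N(3) a by blast
  hence dvd: "a dvd nf b" using g(1) by simp
  have "I = lat g a b"
  proof (intro equalityI subsetI)
    fix w assume w: "w \<in> I"
    then obtain s t where st: "w = ok s t" using sub by (auto elim!: OK_E)
    hence "g dvd t" using w by (intro g(3)) (auto simp: Y_def)
    then obtain y where y: "t = g * y" by (auto elim: dvdE)
    have "ok (s + - y * (g * b)) (t + - y * g) \<in> I" using w st by (intro add' scale beta) auto
    hence "N dvd s + - y * (g * b)" using y by (intro N(3)) (simp add: mult.commute)
    then obtain x where "s + - y * (g * b) = g * a * x" unfolding a by (auto elim: dvdE)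
    hence "s = g * (x * a + y * b)" by (simp add: algebra_simps)
    thus "w \<in> lat g a b" using st y by (auto simp: lat_def)
  next
    fix w assume "w \<in> lat g a b"
    then obtain x y where w: "w = ok (g * (x * a + y * b)) (g * y)" by (auto simp: lat_def)
    have "ok (x * N + y * (g * b)) (x * 0 + y * g) \<in> I" by (intro add' scale N beta)
    thus "w \<in> I" unfolding w a by (simp add: algebra_simps)
  qed
  thus ?thesis using that[of g a b] g a0 dvd b by (simp add: lat_data_def)
qed

lemma lat_inj:
  assumes 1: "lat_data g a b" "0 \<le> b" "b < a" and 2: "lat_data g' a' b'" "0 \<le> b'" "b' < a'"
    and eq: "lat g a b = lat g' a' b'"
  shows "g = g'" "a = a'" "b = b'"
proof -
  have gen: "g dvd g' \<and> (g = g' \<longrightarrow> a dvd a' \<and> a dvd b' - b)" if "lat g' a' b' \<subseteq> lat g a b" "g > 0" for g a b g' a' b' :: int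
  proof -
    have "ok (g' * b') g' \<in> lat g a b" using that(1) lat_basis by blast
    then obtain x y where xy: "g' * b' = g * (x * a + y * b)" "g' = g * y" unfolding lat_mem_iff by blast
    have "ok (g' * a') 0 \<in> lat g a b" using that(1) lat_basis by blast
    then obtain x' y' where xy': "g' * a' = g * (x' * a + y' * b)" "0 = g * y'" unfolding lat_mem_iff by blast
    have "a dvd a' \<and> a dvd b' - b" if "g = g'"
    proof
      show "a dvd a'" using xy' \<open>g > 0\<close> that by auto
      have "y = 1" using xy(2) \<open>g > 0\<close> that by simp
      hence "b' = x * a + b" using xy(1) \<open>g > 0\<close> that by simp
      thus "a dvd b' - b" by simp
    qed
    thus ?thesis using xy by auto
  qed
  have pos: "g > 0" "g' > 0" "a > 0" "a' > 0" using 1 2 by (auto simp: lat_data_def)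
  show g: "g = g'" using gen[of g' a' b' g a b] gen[of g a b g' a' b'] eq pos zdvd_antisym_nonneg[of g g'] by auto
  show a: "a = a'" using gen[of g' a' b' g a b] gen[of g a b g' a' b'] eq pos g zdvd_antisym_nonneg[of a a'] by auto
  have "a dvd b' - b" using gen[of g' a' b' g a b] eq pos g by auto
  hence "b' mod a = b mod a" by (simp add: mod_eq_dvd_iff)
  thus "b = b'" using 1 2 a by simp
qed

section \<open>Norms of ideals and multipliers preserving an ideal\<close>

text \<open>The condition says that the inverse of I is the conjugate of I divided by N. It
  determines N without counting residue classes and transforms transparently when I is scaled by a
  complex number.\<close>

definition is_norm :: "complex set \<Rightarrow> real \<Rightarrow> bool" where
  "is_norm I N \<longleftrightarrow> N > 0 \<and> (\<forall>l. (\<forall>w\<in>I. l * w \<in> OK) \<longleftrightarrow> of_real N * cnj l \<in> I)"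

lemma is_norm_lat:
  assumes "lat_data g a b"
  shows "is_norm (lat g a b) (of_int (g\<^sup>2 * a))"
proof -
  obtain C where C: "nf b = a * C" using assms by (auto simp: lat_data_def elim: dvdE)
  have ga: "g > 0" "a > 0" using assms by (auto simp: lat_data_def)
  have c0: "c0 = a * C - b * b - b" using C by (simp add: nf_def power2_eq_square)
  have "(\<forall>w\<in>lat g a b. l * w \<in> OK) \<longleftrightarrow> of_real (of_int (g\<^sup>2 * a)) * cnj l \<in> lat g a b" for l
  proof
    assume l: "\<forall>w\<in>lat g a b. l * w \<in> OK"
    have "l * ok (g * a) 0 \<in> OK" and 2: "l * ok (g * b) g \<in> OK" using l lat_basis by auto
    then obtain s t where st: "l * ok (g * a) 0 = ok s t" by (auto elim: OK_E)
    obtain s' t' where st': "l * ok (g * b) g = ok s' t'" using 2 by (auto elim: OK_E)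
    have "of_int a * (l * ok (g * b) g) = l * ok (g * a) 0 * ok b 1"
      by (simp add: ok_def algebra_simps)
    hence "ok (a * s') (a * t') = ok s t * ok b 1" unfolding st st' by (simp add: ok_scale)
    hence t': "a * t' = s + t * b + t" by (simp add: ok_mult)
    have "of_real (of_int (g\<^sup>2 * a)) * cnj l = of_int g * cnj (l * ok (g * a) 0)"
      by (simp add: ok_def power2_eq_square mult_ac)
    also have "\<dots> = ok (g * (s + t)) (g * - t)" unfolding st by (simp add: cnj_ok ok_scale)
    also have "\<dots> \<in> lat g a b"
      unfolding lat_mem_iff using t' by (intro exI[of _ t'] exI[of _ "- t"]) (simp add: algebra_simps)
    finally show "of_real (of_int (g\<^sup>2 * a)) * cnj l \<in> lat g a b" .
  next
    assume "of_real (of_int (g\<^sup>2 * a)) * cnj l \<in> lat g a b"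
    then obtain x y where "of_real (of_int (g\<^sup>2 * a)) * cnj l = ok (g * (x * a + y * b)) (g * y)"
      by (auto simp: lat_def)
    hence "cnj (of_real (of_int (g\<^sup>2 * a)) * cnj l) = cnj (ok (g * (x * a + y * b)) (g * y))" by simp
    hence l: "of_int (g\<^sup>2 * a) * l = ok (g * (x * a + y * b) + g * y) (- (g * y))" by (simp add: cnj_ok)
    show "\<forall>w\<in>lat g a b. l * w \<in> OK"
    proof
      fix w assume "w \<in> lat g a b"
      then obtain x' y' where w: "w = ok (g * (x' * a + y' * b)) (g * y')" by (auto simp: lat_def)
      have "of_int (g\<^sup>2 * a) * (l * w) = (of_int (g\<^sup>2 * a) * l) * w" by (simp only: mult.assoc)
      also have "\<dots> = ok (g\<^sup>2 * a * (x * x' * a + x * y' * b + y * x' * (b + 1) + y * y' * C)) (g\<^sup>2 * a * (x * y' - y * x'))"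
        unfolding l w ok_mult c0 ok_eq_iff by (simp add: algebra_simps power2_eq_square)
      also have "\<dots> = of_int (g\<^sup>2 * a) * ok (x * x' * a + x * y' * b + y * x' * (b + 1) + y * y' * C) (x * y' - y * x')"
        by (simp only: ok_scale)
      finally have "l * w = ok (x * x' * a + x * y' * b + y * x' * (b + 1) + y * y' * C) (x * y' - y * x')"
        using ga by simp
      thus "l * w \<in> OK" by simp
    qed
  qed
  thus ?thesis using ga unfolding is_norm_def by simp
qed

lemma is_norm_scale:
  assumes N: "is_norm I N" and m: "m \<noteq> 0"
  shows "is_norm ((*) m ` I) ((cmod m)\<^sup>2 * N)"
  unfolding is_norm_def
proof (intro conjI allI)
  show "(cmod m)\<^sup>2 * N > 0" using N m by (simp add: is_norm_def)
  fix l
  have "(\<forall>w\<in>(*) m ` I. l * w \<in> OK) \<longleftrightarrow> (\<forall>w\<in>I. (l * m) * w \<in> OK)" by (simp add: mult.assoc)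
  also have "\<dots> \<longleftrightarrow> of_real N * cnj (l * m) \<in> I" using N unfolding is_norm_def by blast
  also have "\<dots> \<longleftrightarrow> m * (of_real N * cnj (l * m)) \<in> (*) m ` I" using m by (auto simp: image_iff)
  also have "m * (of_real N * cnj (l * m)) = of_real ((cmod m)\<^sup>2 * N) * cnj l"
    by (simp add: complex_norm_square[unfolded of_real_power] mult_ac)
  finally show "(\<forall>w\<in>(*) m ` I. l * w \<in> OK) \<longleftrightarrow> of_real ((cmod m)\<^sup>2 * N) * cnj l \<in> (*) m ` I" .
qed

text \<open>Were N < N', multiplication by N / N' would map I into itself and shrink a nonzero
  element of least absolute value.\<close>

lemma is_norm_unique:
  assumes N: "is_norm I N" "is_norm I N'" and I: "I \<subseteq> OK" "I \<noteq> {0}" "0 \<in> I"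
  shows "N = N'"
proof -
  have "\<not> N < N'" if N: "is_norm I N" "is_norm I N'" for N N'
  proof
    assume lt: "N < N'"
    have pos: "N > 0" "N' > 0" using N by (auto simp: is_norm_def)
    define r where "r = N / N'"
    have r: "0 < r" "r < 1" using pos lt by (auto simp: r_def)
    have step: "of_real r * u \<in> I" if "u \<in> I" for u
    proof -
      have "of_real N' * cnj (cnj u / of_real N') \<in> I" using that pos by simp
      hence "of_real N * cnj (cnj u / of_real N') \<in> I" using N unfolding is_norm_def by blast
      thus ?thesis by (simp add: r_def)
    qed
    define f where "f u = nat \<lfloor>(cmod u)\<^sup>2\<rfloor>" for u
    obtain u where u: "u \<in> I - {0}" "\<And>v. v \<in> I - {0} \<Longrightarrow> f u \<le> f v"
      using ex_has_least_nat[of "\<lambda>u. u \<in> I - {0}" _ f] I by blast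
    have ru: "of_real r * u \<in> I - {0}" using step u r by auto
    obtain n where n: "(cmod u)\<^sup>2 = of_int n" using cmod_OK[of u] u I by (auto elim: Ints_cases)
    obtain m where m: "(cmod (of_real r * u))\<^sup>2 = of_int m" using cmod_OK[of "of_real r * u"] ru I by (auto elim: Ints_cases)
    have "(cmod (of_real r * u))\<^sup>2 = r\<^sup>2 * (cmod u)\<^sup>2" by (simp add: norm_mult power_mult_distrib)
    also have "\<dots> < 1 * (cmod u)\<^sup>2"
      using r u by (intro mult_strict_right_mono) (auto simp: abs_square_less_1)
    finally have "m < n" using m n by simp
    moreover have "m \<ge> 0" using m by (metis of_int_0_le_iff zero_le_power2)
    ultimately show False using u(2)[OF ru] by (simp add: f_def m n)
  qed
  thus ?thesis using N by (meson linorder_neqE_linordered_idom)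
qed

definition nrm :: "complex set \<Rightarrow> real" where "nrm I = (THE N. is_norm I N)"

lemma nrm_eqI: "idl I \<Longrightarrow> I \<noteq> {0} \<Longrightarrow> is_norm I N \<Longrightarrow> nrm I = N"
  unfolding nrm_def by (rule the_equality) (auto simp: idl_def intro: is_norm_unique)

lemma nrm_lat: "lat_data g a b \<Longrightarrow> nrm (lat g a b) = of_int (g\<^sup>2 * a)"
  by (rule nrm_eqI[OF idl_lat is_norm_lat])

lemma is_norm_nrm:
  assumes I: "idl I" "I \<noteq> {0}"
  shows "is_norm I (nrm I)"
proof -
  obtain g a b where lat: "lat_data g a b" "I = lat g a b" by (rule idl_imp_lat[OF I])
  thus ?thesis using is_norm_lat[OF lat(1)] nrm_lat[OF lat(1)] by simp
qed

text \<open>Comparing norms gives absolute value 1, but e is an arbitrary complex number. That it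
  lies in \<open>OK\<close> is read off from the lattice, whose form (a, 2 * b + 1, C) is primitive
  because its discriminant -p is squarefree. For p at least 7 the norm equation then leaves 1 and
  -1.\<close>

lemma unit_of_idl:
  assumes I: "idl I" "I \<noteq> {0}" and e: "(*) e ` I = I"
  shows "e = 1 \<or> e = - 1"
proof -
  obtain g a b where lat: "lat_data g a b" "I = lat g a b" by (rule idl_imp_lat[OF I])
  obtain C where C: "nf b = a * C" using lat by (auto simp: lat_data_def elim: dvdE)
  have ga: "g > 0" "a > 0" using lat by (auto simp: lat_data_def)
  have c0: "c0 = a * C - b * b - b" using C by (simp add: nf_def power2_eq_square)
  have "e \<noteq> 0" using e I by (auto simp: idl_def)
  have "is_norm I ((cmod e)\<^sup>2 * nrm I)" using is_norm_scale[OF is_norm_nrm[OF I] \<open>e \<noteq> 0\<close>] e by simp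
  from nrm_eqI[OF I this] have "(cmod e)\<^sup>2 * nrm I = nrm I" by simp
  moreover have "nrm I > 0" using is_norm_nrm[OF I] by (simp add: is_norm_def)
  ultimately have e1: "(cmod e)\<^sup>2 = 1" by simp
  have "ok (g * a) 0 \<in> I" "ok (g * b) g \<in> I"
    unfolding lat by (rule lat_basis)+
  hence "e * ok (g * a) 0 \<in> lat g a b" "e * ok (g * b) g \<in> lat g a b" using e lat by blast+
  then obtain x y x' y' where 1: "e * ok (g * a) 0 = ok (g * (x * a + y * b)) (g * y)"
    and 2: "e * ok (g * b) g = ok (g * (x' * a + y' * b)) (g * y')" by (auto simp: lat_def)
  have cancel: "u = v" if "of_int g * u = of_int g * v" for u v :: complex using that ga by simp
  have 1: "e * of_int a = ok (x * a + y * b) y"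
    by (rule cancel) (use 1 in \<open>simp add: ok_scale[symmetric] ok_int[symmetric] mult_ac\<close>)
  have "of_int g * (e * ok b 1) = e * ok (g * b) g" by (simp add: ok_def algebra_simps)
  also have "\<dots> = of_int g * ok (x' * a + y' * b) y'" unfolding 2 by (simp only: ok_scale)
  finally have 2: "e * ok b 1 = ok (x' * a + y' * b) y'" by (rule cancel)
  have "ok (x * a + y * b) y * ok b 1 = of_int a * ok (x' * a + y' * b) y'"
    unfolding 1[symmetric] 2[symmetric] by (simp add: mult_ac)
  hence A: "(x * a + y * b) * b - c0 * y = a * (x' * a + y' * b)" and B: "(x * a + y * b) + y * b + y = a * y'"
    by (auto simp: ok_mult ok_scale)
  have "a dvd y * (2 * b + 1)"
  proof -
    have "y * (2 * b + 1) = a * (y' - x)" using B by (simp add: algebra_simps)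
    thus ?thesis by simp
  qed
  moreover have "a dvd y * C"
  proof -
    have "a * (x' * a) = (x * a + y * b) * b - c0 * y - b * (a * y')" using A by (simp add: algebra_simps)
    also have "\<dots> = - (a * (y * C))" unfolding B[symmetric] c0 by (simp add: algebra_simps)
    finally have "a * (x' * a + y * C) = 0" by (simp add: algebra_simps)
    hence "x' * a + y * C = 0" using ga by simp
    hence "y * C = a * (- x')" by (simp add: algebra_simps)
    thus ?thesis by simp
  qed
  moreover have gcd: "a dvd y * gcd u v" if "a dvd y * u" "a dvd y * v" for u v
  proof -
    obtain s t where "s * u + t * v = gcd u v" using bezout_int by blast
    hence "y * gcd u v = y * (s * u + t * v)" by simp
    hence "y * gcd u v = s * (y * u) + t * (y * v)" by (simp only: algebra_simps)
    thus ?thesis using that by (simp add: dvd_add)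
  qed
  ultimately have "a dvd y * gcd (gcd a (2 * b + 1)) C" by (intro gcd dvd_triv_right)
  \<comment> \<open>The square of a common divisor divides 4 * a * C - (2 * b + 1)^2 = p.\<close>
  moreover have "gcd (gcd a (2 * b + 1)) C = 1"
  proof -
    define d where "d = gcd (gcd a (2 * b + 1)) C"
    have d: "d dvd a" "d dvd 2 * b + 1" "d dvd C" by (auto simp: d_def intro: dvd_trans)
    have "d * d dvd 4 * (a * C) - (2 * b + 1) * (2 * b + 1)"
      using mult_dvd_mono[OF d(1,3)] mult_dvd_mono[OF d(2,2)] by (intro dvd_diff dvd_mult[of _ _ 4])
    also have "4 * (a * C) - (2 * b + 1) * (2 * b + 1) = int p"
      using nf_disc[of b] C by (simp add: power2_eq_square)
    finally have dp: "d * d dvd int p" .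
    have d0: "d > 0" unfolding d_def using ga by simp
    have "d dvd int p" using dp by (rule dvd_trans[rotated]) simp
    moreover have "prime (int p)" using p_prime by simp
    ultimately have "d = 1 \<or> d = int p" using d0 unfolding prime_int_iff by auto
    moreover have "d \<noteq> int p"
    proof
      assume "d = int p"
      hence "int p * int p \<le> int p * 1" using dp p_gt_3 by (simp add: zdvd_imp_le)
      thus False using p_gt_3 by simp
    qed
    ultimately show ?thesis unfolding d_def by blast
  qed
  ultimately have "a dvd y" by simp
  then obtain y1 where "y = a * y1" by (auto elim: dvdE)
  hence "of_int a * e = of_int a * ok (x + y1 * b) y1" using 1 by (simp add: ok_scale algebra_simps)
  hence eok: "e = ok (x + y1 * b) y1" using ga by simp
  define s where "s = x + y1 * b"
  have "s\<^sup>2 + s * y1 + c0 * y1\<^sup>2 = 1" using e1 unfolding eok cmod_ok s_def by (simp only: of_int_eq_1_iff)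
  hence four: "(2 * s + y1)\<^sup>2 + int p * y1\<^sup>2 = 4" unfolding p_eq by (simp add: power2_eq_square algebra_simps)
  have "y1 = 0"
  proof (rule ccontr)
    assume "y1 \<noteq> 0"
    hence "y1\<^sup>2 \<ge> 1" by (simp add: int_one_le_iff_zero_less)
    hence "int p * 1 \<le> int p * y1\<^sup>2" by (intro mult_left_mono) auto
    moreover have "(2 * s + y1)\<^sup>2 \<ge> 0" by simp
    ultimately show False using four p_ge by linarith
  qed
  hence "s\<^sup>2 = 1" using four by (simp add: power_mult_distrib)
  hence "s = 1 \<or> s = -1" by (simp add: power2_eq_1_iff)
  thus ?thesis using eok \<open>y1 = 0\<close> by (auto simp: s_def ok_def)
qed

end

section \<open>The class number formula\<close>

context prime_3_mod_4
begin

section \<open>The members of one ideal class\<close>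

lemma idl_scale:
  assumes I: "idl I" "I \<noteq> {0}" and m: "\<And>w. w \<in> I \<Longrightarrow> m * w \<in> OK" and m0: "m \<noteq> 0"
  shows "idl ((*) m ` I)" "(*) m ` I \<noteq> {0}"
proof -
  show "idl ((*) m ` I)"
    unfolding idl_def
  proof (intro conjI ballI)
    show "0 \<in> (*) m ` I" using I by (auto simp: idl_def image_iff)
    fix u v assume "u \<in> (*) m ` I" "v \<in> (*) m ` I"
    then obtain u' v' where "u = m * u'" "v = m * v'" "u' \<in> I" "v' \<in> I" by auto
    thus "u + v \<in> (*) m ` I" using I(1) by (auto simp: idl_def image_iff simp flip: distrib_left)
  next
    fix r u assume r: "r \<in> OK" and "u \<in> (*) m ` I"
    then obtain u' where "u = m * u'" "u' \<in> I" by auto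
    moreover hence "r * u' \<in> I" using I(1) r by (auto simp: idl_def)
    ultimately show "r * u \<in> (*) m ` I" by (auto simp: image_iff mult_ac intro!: bexI[of _ "r * u'"])
  qed (use m in auto)
  obtain w where "w \<in> I" "w \<noteq> 0" using I unfolding idl_def by blast
  hence "m * w \<in> (*) m ` I" "m * w \<noteq> 0" using m0 by auto
  thus "(*) m ` I \<noteq> {0}" by blast
qed

lemma nrm_pos: "idl I \<Longrightarrow> I \<noteq> {0} \<Longrightarrow> nrm I > 0"
  using is_norm_nrm by (simp add: is_norm_def)

lemma nrm_int:
  assumes "idl I" "I \<noteq> {0}"
  obtains n :: int where "nrm I = of_int n"
proof -
  obtain g a b where "lat_data g a b" "I = lat g a b" by (rule idl_imp_lat[OF assms])
  thus ?thesis using nrm_lat[of g a b] that[of "g\<^sup>2 * a"] by simp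
qed

text \<open>As v runs over the nonzero elements of I, this runs over the ideals in the class of I,
  each hit by exactly v and -v. In this way the norm form of one lattice lists a whole
  class.\<close>

definition twist :: "complex set \<Rightarrow> complex \<Rightarrow> complex set" where
  "twist I v = (*) (cnj v / of_real (nrm I)) ` I"

lemma twist:
  assumes I: "idl I" "I \<noteq> {0}" and v: "v \<in> I" "v \<noteq> 0"
  shows "idl (twist I v)" "twist I v \<noteq> {0}" "nrm (twist I v) = (cmod v)\<^sup>2 / nrm I"
proof -
  let ?m = "cnj v / of_real (nrm I)"
  have N: "nrm I > 0" using nrm_pos[OF I] .
  have "of_real (nrm I) * cnj ?m \<in> I" using v N by simp
  hence "\<forall>w\<in>I. ?m * w \<in> OK" using is_norm_nrm[OF I] unfolding is_norm_def by blast
  moreover have m0: "?m \<noteq> 0" using v N by simp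
  ultimately show 1: "idl (twist I v)" "twist I v \<noteq> {0}"
    unfolding twist_def using idl_scale[OF I, of ?m] by blast+
  have "is_norm (twist I v) ((cmod ?m)\<^sup>2 * nrm I)"
    unfolding twist_def by (rule is_norm_scale[OF is_norm_nrm[OF I] m0])
  hence "nrm (twist I v) = (cmod ?m)\<^sup>2 * nrm I" by (rule nrm_eqI[OF 1])
  also have "\<dots> = (cmod v)\<^sup>2 / nrm I" using N by (simp add: norm_divide power_divide power2_eq_square)
  finally show "nrm (twist I v) = (cmod v)\<^sup>2 / nrm I" .
qed

lemma scale_image_eqD: "(*) a ` I = (*) b ` J \<Longrightarrow> b \<noteq> 0 \<Longrightarrow> J = (*) (a / b :: complex) ` I"
proof -
  assume eq: "(*) a ` I = (*) b ` J" and b: "b \<noteq> 0"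
  have "J = (*) (1 / b) ` (*) b ` J" using b by (force simp: image_image)
  also have "\<dots> = (*) (a / b) ` I" unfolding eq[symmetric] by (simp add: image_image)
  finally show ?thesis .
qed

text \<open>From a * I = b * J the factor a / b maps I into \<open>OK\<close>, so the defining
  property of the norm puts v, namely \<open>nrm I\<close> times the conjugate of a / b, into
  I.\<close>

lemma class_rel_iff:
  assumes I: "idl I" "I \<noteq> {0}"
  shows "(I, J) \<in> ideal_class_rel R \<longleftrightarrow> (\<exists>v\<in>I - {0}. J = twist I v)"
proof
  assume "(I, J) \<in> ideal_class_rel R"
  then obtain a b where J: "idl J" "J \<noteq> {0}" and ab: "a \<noteq> 0" "b \<noteq> 0" "(*) a ` I = (*) b ` J"
    by (auto simp: ideal_class_rel_def nonzero_ideals_R carrier_R)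
  have Jeq: "J = (*) (a / b) ` I" by (rule scale_image_eqD[OF ab(3,2)])
  hence "\<forall>w\<in>I. a / b * w \<in> OK" using J by (auto simp: idl_def)
  hence v: "of_real (nrm I) * cnj (a / b) \<in> I" using is_norm_nrm[OF I] unfolding is_norm_def by blast
  have "J = twist I (of_real (nrm I) * cnj (a / b))"
    unfolding twist_def using Jeq nrm_pos[OF I] by simp
  moreover have "of_real (nrm I) * cnj (a / b) \<noteq> 0" using ab nrm_pos[OF I] by simp
  ultimately show "\<exists>v\<in>I - {0}. J = twist I v" using v by blast
next
  assume "\<exists>v\<in>I - {0}. J = twist I v"
  then obtain v where v: "v \<in> I" "v \<noteq> 0" "J = twist I v" by auto
  obtain n where n: "nrm I = of_int n" using nrm_int[OF I] .
  have "(*) (cnj v) ` I = (*) (of_int n) ` J"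
    using nrm_pos[OF I] unfolding v(3) twist_def by (simp add: image_image n)
  moreover have "cnj v \<in> OK - {0}" using v I OK_cnj by (auto simp: idl_def)
  moreover have "of_int n \<in> OK - {0 :: complex}" using nrm_pos[OF I] n by auto
  ultimately have "\<exists>a\<in>OK - {0}. \<exists>b\<in>OK - {0}. (*) a ` I = (*) b ` J" by blast
  thus "(I, J) \<in> ideal_class_rel R"
    using I twist(1,2)[OF I v(1,2)] v(3) by (simp add: ideal_class_rel_def nonzero_ideals_R carrier_R)
qed

lemma twist_eqD:
  assumes I: "idl I" "I \<noteq> {0}" and v: "v \<noteq> 0" and v': "v' \<noteq> 0" and eq: "twist I v = twist I v'"
  shows "v' = v \<or> v' = - v"
proof -
  let ?N = "complex_of_real (nrm I)"
  have N: "?N \<noteq> 0" using nrm_pos[OF I] by simp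
  have "I = (*) ((cnj v' / ?N) / (cnj v / ?N)) ` I"
    by (rule scale_image_eqD) (use eq v N in \<open>auto simp: twist_def\<close>)
  hence "(cnj v' / ?N) / (cnj v / ?N) = 1 \<or> (cnj v' / ?N) / (cnj v / ?N) = - 1"
    using unit_of_idl[OF I] by metis
  hence "cnj v' = cnj v \<or> cnj v' = - cnj v" using v N by (auto simp: field_simps)
  thus ?thesis by (metis complex_cnj_cancel_iff complex_cnj_minus)
qed

lemma twist_minus:
  assumes "idl I"
  shows "twist I (- v) = twist I v"
proof -
  have neg: "- w \<in> I" if "w \<in> I" for w
    using assms that OK_uminus[OF OK_1] unfolding idl_def by (metis mult_minus1)
  show ?thesis unfolding twist_def by (force simp: image_iff intro: bexI[OF _ neg])
qed

lemma equiv_class_rel: "equiv (nonzero_ideals R) (ideal_class_rel R)"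
proof (rule equivI)
  show "ideal_class_rel R \<subseteq> nonzero_ideals R \<times> nonzero_ideals R" by (auto simp: ideal_class_rel_def)
  show "refl_on (nonzero_ideals R) (ideal_class_rel R)"
    by (rule refl_onI) (auto simp: ideal_class_rel_def carrier_R intro!: bexI[of _ 1])
  show "sym (ideal_class_rel R)"
  proof (rule symI)
    fix I J assume "(I, J) \<in> ideal_class_rel R"
    then obtain a b where mem: "I \<in> nonzero_ideals R" "J \<in> nonzero_ideals R"
      and ab: "a \<in> OK - {0}" "b \<in> OK - {0}" and eq: "(*) a ` I = (*) b ` J"
      by (auto simp: ideal_class_rel_def carrier_R)
    have "\<exists>a\<in>OK - {0}. \<exists>b\<in>OK - {0}. (*) a ` J = (*) b ` I"
      using ab eq[symmetric] by blast
    thus "(J, I) \<in> ideal_class_rel R" using mem by (simp add: ideal_class_rel_def carrier_R)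
  qed
  show "trans (ideal_class_rel R)"
  proof (rule transI)
    fix I J K assume "(I, J) \<in> ideal_class_rel R" "(J, K) \<in> ideal_class_rel R"
    then obtain a b c d where mem: "I \<in> nonzero_ideals R" "K \<in> nonzero_ideals R"
      and abcd: "a \<in> OK - {0}" "b \<in> OK - {0}" "c \<in> OK - {0}" "d \<in> OK - {0}"
      and eq: "(*) a ` I = (*) b ` J" "(*) c ` J = (*) d ` K"
      by (auto simp: ideal_class_rel_def carrier_R)
    have "(*) (c * a) ` I = (*) c ` (*) a ` I" by (simp add: image_image mult.assoc)
    also have "\<dots> = (*) b ` (*) c ` J" unfolding eq(1) by (simp add: image_image mult.left_commute)
    also have "\<dots> = (*) (b * d) ` K" unfolding eq(2) by (simp add: image_image mult.assoc)
    finally have "(*) (c * a) ` I = (*) (b * d) ` K" .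
    moreover have "c * a \<in> OK - {0}" "b * d \<in> OK - {0}" using abcd OK_mult by auto
    ultimately have "\<exists>a\<in>OK - {0}. \<exists>b\<in>OK - {0}. (*) a ` I = (*) b ` K" by blast
    thus "(I, K) \<in> ideal_class_rel R" using mem by (simp add: ideal_class_rel_def carrier_R)
  qed
qed

text \<open>Dividing the norm of a lattice point by g^2 * a leaves the integral form (a, 2 * b + 1,
  C) of discriminant -p.\<close>

lemma lat_theta:
  assumes lat: "lat_data g a b" and t: "t > 0"
  shows "((\<lambda>v. exp (- (t * ((cmod v)\<^sup>2 / nrm (lat g a b))))) has_sum theta a (2 * b + 1) (nf b div a) t) (lat g a b)"
proof -
  define C where "C = nf b div a"
  have C: "nf b = a * C" using lat by (auto simp: C_def lat_data_def)
  have ga: "g > 0" "a > 0" using lat by (auto simp: lat_data_def)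
  have c0: "c0 = a * C - b * b - b" using C by (simp add: nf_def power2_eq_square)
  have "4 * a * C - (2 * b + 1)\<^sup>2 = int p" using nf_disc[of b] C by simp
  hence disc: "4 * a * C - (2 * b + 1)\<^sup>2 > 0" using p_gt_3 by simp
  have sum: "((\<lambda>v. exp (- (t * of_int (qform a (2 * b + 1) C v)))) has_sum theta a (2 * b + 1) C t) UNIV"
    unfolding theta_def using theta_summable[OF ga(2) disc t] by simp
  define F where "F = (\<lambda>(x, y). ok (g * (x * a + y * b)) (g * y))"
  have bij: "bij_betw F UNIV (lat g a b)"
    unfolding bij_betw_def
  proof
    show "inj F" using ga by (auto simp: F_def inj_def)
    show "range F = lat g a b" by (auto simp: F_def lat_def)
  qed
  have norm: "(cmod (F v))\<^sup>2 / nrm (lat g a b) = of_int (qform a (2 * b + 1) C v)" for v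
  proof -
    obtain x y where v: "v = (x, y)" by (cases v)
    have "(g * (x * a + y * b))\<^sup>2 + g * (x * a + y * b) * (g * y) + c0 * (g * y)\<^sup>2 = (g\<^sup>2 * a) * qform a (2 * b + 1) C v"
      unfolding v qform_def c0 by (simp add: power2_eq_square algebra_simps)
    hence "(cmod (F v))\<^sup>2 = of_int ((g\<^sup>2 * a) * qform a (2 * b + 1) C v)"
      unfolding v F_def case_prod_conv cmod_ok by simp
    moreover have "real_of_int (g\<^sup>2 * a) \<noteq> 0" using ga by simp
    ultimately show ?thesis unfolding nrm_lat[OF lat] of_int_mult[of "g\<^sup>2 * a"] by (metis nonzero_mult_div_cancel_left)
  qed
  have "((\<lambda>v. exp (- (t * ((cmod (F v))\<^sup>2 / nrm (lat g a b))))) has_sum theta a (2 * b + 1) C t) UNIV"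
    unfolding norm by (rule sum)
  thus ?thesis
    using has_sum_reindex_bij_betw[OF bij, of "\<lambda>v. exp (- (t * ((cmod v)\<^sup>2 / nrm (lat g a b))))"]
    by (simp add: C_def)
qed

text \<open>The removed zero vector accounts for the -1, and the two-element fibres of
  \<open>twist\<close> for the factor 2.\<close>

lemma class_theta:
  assumes lat: "lat_data g a b" and t: "t > 0"
  shows "((\<lambda>J. 2 * exp (- (t * nrm J))) has_sum (theta a (2 * b + 1) (nf b div a) t - 1)) (ideal_class_rel R `` {lat g a b})"
proof -
  define I where "I = lat g a b"
  have I: "idl I" "I \<noteq> {0}" using idl_lat[OF lat] by (auto simp: I_def)
  define f where "f v = exp (- (t * ((cmod v)\<^sup>2 / nrm I)))" for v
  define \<theta> where "\<theta> = theta a (2 * b + 1) (nf b div a) t"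
  have f: "(f has_sum \<theta>) I" using lat_theta[OF lat t] by (simp add: f_def[abs_def] I_def \<theta>_def)
  have "f summable_on (I - {0})"
    by (rule summable_on_subset_banach[OF has_sum_imp_summable[OF f]]) auto
  then obtain S where S: "(f has_sum S) (I - {0})" by (auto simp: summable_on_def)
  have "(f has_sum (f 0 + S)) (insert 0 (I - {0}))" by (rule has_sum_insert[OF _ S]) simp
  moreover have "insert 0 (I - {0}) = I" using I by (auto simp: idl_def)
  ultimately have "S = \<theta> - 1" using has_sum_unique[OF f] by (simp add: f_def)
  hence f0: "(f has_sum (\<theta> - 1)) (I - {0})" using S by simp
  let ?fib = "\<lambda>J. {v \<in> I - {0}. twist I v = J}"
  let ?C = "ideal_class_rel R `` {I}"
  have C: "J \<in> ?C \<longleftrightarrow> (\<exists>v\<in>I - {0}. J = twist I v)" for J using class_rel_iff[OF I] by auto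
  have bij: "bij_betw (\<lambda>v. (twist I v, v)) (I - {0}) (Sigma ?C ?fib)"
    by (rule bij_betw_byWitness[where f' = snd]) (use C in auto)
  have "((\<lambda>v. (\<lambda>(J, v). exp (- (t * nrm J))) (twist I v, v)) has_sum (\<theta> - 1)) (I - {0})"
    by (subst has_sum_cong[where g = f]) (use f0 twist(3)[OF I] in \<open>auto simp: f_def\<close>)
  hence "((\<lambda>(J, v). exp (- (t * nrm J))) has_sum (\<theta> - 1)) (Sigma ?C ?fib)"
    unfolding has_sum_reindex_bij_betw[OF bij] .
  hence "((\<lambda>J. 2 * exp (- (t * nrm J))) has_sum (\<theta> - 1)) ?C"
  proof (rule has_sum_SigmaD)
    fix J assume "J \<in> ?C"
    then obtain v where v: "v \<in> I" "v \<noteq> 0" "J = twist I v" using C by auto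
    have "- v \<in> I" using v(1) I(1) OK_uminus[OF OK_1] unfolding idl_def by (metis mult_minus1)
    hence fib: "?fib J = {v, - v}"
      using v twist_minus[OF I(1), of v] twist_eqD[OF I v(2)] by auto
    have "v \<noteq> - v" using v(2) by (simp add: eq_neg_iff_add_eq_0 flip: mult_2)
    thus "((\<lambda>v. case (J, v) of (J, v) \<Rightarrow> exp (- (t * nrm J))) has_sum 2 * exp (- (t * nrm J))) (?fib J)"
      unfolding fib by (intro has_sum_finiteI) auto
  qed
  thus ?thesis by (simp add: I_def \<theta>_def)
qed

section \<open>Summation over all ideals and over all classes\<close>

text \<open>Triples (m, g, b) with a = m / g^2 encode the ideals of norm m; existence and uniqueness
  of the normal form make this a bijection, and \<open>ideal_count_eq\<close> turns the fibre sizes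
  into divisor sums.\<close>

lemma all_ideals_sum:
  assumes t: "t > 0"
  shows "((\<lambda>J. exp (- (t * nrm J))) has_sum lambert t) (nonzero_ideals R)"
proof -
  let ?B = "\<lambda>m::nat. Sigma {g. g\<^sup>2 dvd m} (\<lambda>g. roots (m div g\<^sup>2))"
  define F where "F = (\<lambda>(m, g, b). lat (int g) (int (m div g\<^sup>2)) b)"
  have data: "lat_data (int g) (int (m div g\<^sup>2)) b \<and> 0 \<le> b \<and> b < int (m div g\<^sup>2) \<and> int m = (int g)\<^sup>2 * int (m div g\<^sup>2)"
    if "(m, g, b) \<in> Sigma {1..} ?B" for m g b
  proof -
    have m: "m > 0" "g\<^sup>2 dvd m" and b: "b \<in> roots (m div g\<^sup>2)" using that by auto
    obtain a where a: "m = g\<^sup>2 * a" using m by (auto elim: dvdE)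
    have "g > 0" "a > 0" using m a by auto
    moreover from this have "m div g\<^sup>2 = a" using a by simp
    ultimately show ?thesis using b a by (simp add: lat_data_def roots_def)
  qed
  have bij: "bij_betw F (Sigma {1..} ?B) (nonzero_ideals R)"
    unfolding bij_betw_def
  proof
    show "inj_on F (Sigma {1..} ?B)"
    proof (rule inj_onI)
      fix z z' assume z: "z \<in> Sigma {1..} ?B" "z' \<in> Sigma {1..} ?B" "F z = F z'"
      obtain m g b m' g' b' where zz: "z = (m, g, b)" "z' = (m', g', b')" by (cases z, cases z')
      note d = data[OF z(1)[unfolded zz]] data[OF z(2)[unfolded zz]]
      have "lat (int g) (int (m div g\<^sup>2)) b = lat (int g') (int (m' div g'\<^sup>2)) b'" using z(3) by (simp add: zz F_def)
      from lat_inj[OF _ _ _ _ _ _ this] d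
      have eq: "int g = int g'" "int (m div g\<^sup>2) = int (m' div g'\<^sup>2)" "b = b'" by blast+
      hence "int m = int m'" using d by metis
      thus "z = z'" using eq by (simp add: zz)
    qed
    show "F ` Sigma {1..} ?B = nonzero_ideals R"
    proof (intro equalityI subsetI)
      fix J assume "J \<in> F ` Sigma {1..} ?B"
      then obtain m g b where "(m, g, b) \<in> Sigma {1..} ?B" "J = F (m, g, b)" by auto
      thus "J \<in> nonzero_ideals R" using data idl_lat by (auto simp: F_def nonzero_ideals_R)
    next
      fix J assume "J \<in> nonzero_ideals R"
      hence "idl J" "J \<noteq> {0}" by (auto simp: nonzero_ideals_R)
      then obtain g a b where J: "lat_data g a b" "0 \<le> b" "b < a" "J = lat g a b" by (rule idl_imp_lat)
      define g' a' where "g' = nat g" and "a' = nat a"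
      have ga: "g = int g'" "a = int a'" "g' > 0" "a' > 0" using J by (auto simp: lat_data_def g'_def a'_def)
      have div: "g'\<^sup>2 * a' div g'\<^sup>2 = a'" using ga by simp
      have "F (g'\<^sup>2 * a', g', b) = J" by (simp only: F_def case_prod_conv div J(4) ga)
      moreover have "(g'\<^sup>2 * a', g', b) \<in> Sigma {1..} ?B"
        using J ga by (auto simp: div roots_def lat_data_def Suc_le_eq)
      ultimately show "J \<in> F ` Sigma {1..} ?B" by blast
    qed
  qed
  define G where "G = (\<lambda>(m::nat, _::nat \<times> int). exp (- (t * m)))"
  have rows: "((\<lambda>z. G (m, z)) has_sum of_int (chi_divisor_sum m) * exp (- (t * m))) (?B m)" if m: "m \<in> {1..}" for m
  proof (rule has_sum_finiteI)
    have fin: "finite {g. g\<^sup>2 dvd m}" using finite_square_divisors[of m] m by simp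
    thus "finite (?B m)" by (intro finite_SigmaI) auto
    have "card (?B m) = ideal_count m"
      using fin by (simp add: ideal_count_def rho_def card_SigmaI)
    hence "of_int (chi_divisor_sum m) = real (card (?B m))"
      using ideal_count_eq[of m] m by (metis atLeast_iff of_int_of_nat_eq zero_less_one_class.zero_less_one less_le_trans)
    thus "of_int (chi_divisor_sum m) * exp (- (t * m)) = sum (\<lambda>z. G (m, z)) (?B m)"
      by (simp add: G_def)
  qed
  have "G summable_on Sigma {1..} ?B"
    by (rule summable_on_SigmaI[OF rows has_sum_imp_summable[OF lambert_has_sum(2)[OF t]]]) (auto simp: G_def)
  hence G: "(G has_sum lambert t) (Sigma {1..} ?B)"
    by (intro has_sum_SigmaI[OF rows lambert_has_sum(2)[OF t]])
  have "((\<lambda>z. exp (- (t * nrm (F z)))) has_sum lambert t) (Sigma {1..} ?B)"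
  proof (subst has_sum_cong[where g = G])
    fix z assume z: "z \<in> Sigma {1..} ?B"
    obtain m g b where zz: "z = (m, g, b)" by (cases z)
    have "nrm (F z) = of_int ((int g)\<^sup>2 * int (m div g\<^sup>2))"
      using data[OF z[unfolded zz]] nrm_lat unfolding zz F_def case_prod_conv by blast
    also have "(int g)\<^sup>2 * int (m div g\<^sup>2) = int m" using data[OF z[unfolded zz]] by simp
    finally show "exp (- (t * nrm (F z))) = G z" by (simp add: G_def zz)
  qed (rule G)
  thus ?thesis using has_sum_reindex_bij_betw[OF bij, of "\<lambda>J. exp (- (t * nrm J))"] by simp
qed

theorem class_number_formula: "real (class_number (quadratic_field (- int p))) = chi_mean"
proof -
  let ?I = "nonzero_ideals R"
  define \<H> where "\<H> = ?I // ideal_class_rel R"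
  \<comment> \<open>Each class receives a form of discriminant -p through one of its ideals in
    normal form.\<close>
  have "\<forall>C\<in>\<H>. \<exists>q. fst q > 0 \<and> 4 * fst q * snd (snd q) - (fst (snd q))\<^sup>2 = int p \<and>
    (\<forall>t>0. ((\<lambda>J. 2 * exp (- (t * nrm J))) has_sum (theta (fst q) (fst (snd q)) (snd (snd q)) t - 1)) C)"
  proof
    fix C assume "C \<in> \<H>"
    then obtain I where I: "I \<in> ?I" "C = ideal_class_rel R `` {I}" unfolding \<H>_def by (auto elim: quotientE)
    hence "idl I" "I \<noteq> {0}" by (auto simp: nonzero_ideals_R)
    then obtain g a b where lat: "lat_data g a b" "I = lat g a b" by (rule idl_imp_lat)
    have "a > 0" "nf b = a * (nf b div a)" using lat by (auto simp: lat_data_def)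
    moreover from this have "4 * a * (nf b div a) - (2 * b + 1)\<^sup>2 = int p" using nf_disc[of b] by simp
    ultimately show "\<exists>q. fst q > 0 \<and> 4 * fst q * snd (snd q) - (fst (snd q))\<^sup>2 = int p \<and>
      (\<forall>t>0. ((\<lambda>J. 2 * exp (- (t * nrm J))) has_sum (theta (fst q) (fst (snd q)) (snd (snd q)) t - 1)) C)"
      using class_theta[OF lat(1)] lat I(2) by (intro exI[of _ "(a, 2 * b + 1, nf b div a)"]) simp
  qed
  then obtain q where q: "\<And>C. C \<in> \<H> \<Longrightarrow> fst (q C) > 0"
    "\<And>C. C \<in> \<H> \<Longrightarrow> 4 * fst (q C) * snd (snd (q C)) - (fst (snd (q C)))\<^sup>2 = int p"
    "\<And>C t. C \<in> \<H> \<Longrightarrow> t > 0 \<Longrightarrow>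
      ((\<lambda>J. 2 * exp (- (t * nrm J))) has_sum (theta (fst (q C)) (fst (snd (q C))) (snd (snd (q C))) t - 1)) C"
    unfolding bchoice_iff by blast
  define th where "th C t = theta (fst (q C)) (fst (snd (q C))) (snd (snd (q C))) t" for C t
  have disc: "4 * fst (q C) * snd (snd (q C)) - (fst (snd (q C)))\<^sup>2 > 0" if "C \<in> \<H>" for C
    using q(2)[OF that] p_gt_3 by simp
  have union: "((\<lambda>J. 2 * exp (- (t * nrm J))) has_sum (\<Sum>C\<in>X. th C t - 1)) (\<Union>X)"
    if X: "finite X" "X \<subseteq> \<H>" and t: "t > 0" for X t
  proof -
    have "((\<lambda>J. 2 * exp (- (t * nrm J))) has_sum (\<Sum>C\<in>X. th C t - 1)) (\<Union>C\<in>X. C)"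
    proof (rule sum_has_sum[OF X(1)])
      show "((\<lambda>J. 2 * exp (- (t * nrm J))) has_sum (th C t - 1)) C" if "C \<in> X" for C
        using q(3)[of C t] that X t unfolding th_def by blast
      show "C \<inter> C' = {}" if "C \<in> X" "C' \<in> X" "C \<noteq> C'" for C C'
        using quotient_disj[OF equiv_class_rel] that X unfolding \<H>_def by blast
    qed
    thus ?thesis by simp
  qed
  have total: "((\<lambda>J. 2 * exp (- (t * nrm J))) has_sum 2 * lambert t) ?I" if "t > 0" for t
    by (intro has_sum_cmult_right all_ideals_sum that)
  obtain \<kappa> where \<kappa>: "\<kappa> > 0" "\<And>A B C. A > 0 \<Longrightarrow> 4 * A * C - B\<^sup>2 > 0 \<Longrightarrow>
      ((\<lambda>t. t * theta A B C t) \<longlongrightarrow> \<kappa> / sqrt (of_int (4 * A * C - B\<^sup>2))) (at_right 0)"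
    using theta_growth by metis
  define \<delta> where "\<delta> = \<kappa> / sqrt p"
  have \<delta>: "\<delta> > 0" using \<kappa>(1) p_gt_3 by (simp add: \<delta>_def)
  \<comment> \<open>Finitely many classes contribute part of a series of nonnegative terms. After
    multiplication by t their share tends to \<delta> times their number, while the whole stays
    below 2 * p.\<close>
  have bound: "card X \<le> nat \<lceil>2 * p / \<delta>\<rceil>" if X: "finite X" "X \<subseteq> \<H>" for X
  proof -
    have "(\<Sum>C\<in>X. t * th C t - t) \<le> 2 * p" if t: "t > 0" for t
    proof -
      have "(\<Sum>C\<in>X. th C t - 1) \<le> 2 * lambert t"
      proof (rule has_sum_mono2[OF union[OF X t] total[OF t]])
        show "\<Union>X \<subseteq> ?I" using X Union_quotient[OF equiv_class_rel] unfolding \<H>_def by blast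
      qed auto
      hence "t * (\<Sum>C\<in>X. th C t - 1) \<le> t * (2 * lambert t)" using t by (intro mult_left_mono) auto
      also have "\<dots> \<le> 2 * p" using lambert_bound[OF t] by (simp add: abs_le_iff)
      finally show ?thesis by (simp add: sum_distrib_left right_diff_distrib)
    qed
    hence ev: "\<forall>\<^sub>F t in at_right 0. (\<Sum>C\<in>X. t * th C t - t) \<le> 2 * p"
      by (auto simp: eventually_at_right_field intro!: exI[of _ 1])
    have lim: "((\<lambda>t. t * th C t) \<longlongrightarrow> \<delta>) (at_right 0)" if "C \<in> \<H>" for C
      using \<kappa>(2)[OF q(1)[OF that] disc[OF that]] unfolding th_def q(2)[OF that] \<delta>_def by simp
    have "((\<lambda>t. \<Sum>C\<in>X. t * th C t - t) \<longlongrightarrow> (\<Sum>C\<in>X. \<delta> - 0)) (at_right 0)"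
      using X by (intro tendsto_sum tendsto_diff lim tendsto_ident_at) auto
    hence "(\<Sum>C\<in>X. \<delta> - 0) \<le> 2 * p"
      by (rule tendsto_upperbound[OF _ ev]) simp
    hence "card X \<le> 2 * p / \<delta>" using \<delta> by (simp add: field_simps)
    thus ?thesis by linarith
  qed
  have fin: "finite \<H>"
    using bound by (intro finite_if_finite_subsets_card_bdd[of \<H> "nat \<lceil>2 * p / \<delta>\<rceil>", THEN conjunct1]) blast
  have eq: "(\<Sum>C\<in>\<H>. th C t - 1) = 2 * lambert t" if t: "t > 0" for t
    using has_sum_unique[OF union[OF fin order_refl t]] total[OF t] Union_quotient[OF equiv_class_rel]
    unfolding \<H>_def by metis
  \<comment> \<open>The constants do not cancel: -1 + 2 leaves 1 for each class.\<close>
  have key: "(\<Sum>C\<in>\<H>. th C t - 2 * th C (2 * t)) + card \<H> = 2 * (lambert t - 2 * lambert (2 * t))" if t: "t > 0" for t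
  proof -
    have "2 * (lambert t - 2 * lambert (2 * t)) = (\<Sum>C\<in>\<H>. th C t - 1) - 2 * (\<Sum>C\<in>\<H>. th C (2 * t) - 1)"
      using eq[of t] eq[of "2 * t"] t by simp
    thus ?thesis by (simp add: sum_subtractf sum_distrib_left)
  qed
  have "((\<lambda>t. (\<Sum>C\<in>\<H>. th C t - 2 * th C (2 * t)) + card \<H>) \<longlongrightarrow> (\<Sum>C\<in>\<H>. 0) + real (card \<H>)) (at_right 0)"
    unfolding th_def using q(1) disc by (intro tendsto_intros theta_cancel) auto
  moreover have "\<forall>\<^sub>F t in at_right 0. (\<Sum>C\<in>\<H>. th C t - 2 * th C (2 * t)) + card \<H> = 2 * (lambert t - 2 * lambert (2 * t))"
    using key by (auto simp: eventually_at_right_field intro!: exI[of _ 1])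
  ultimately have "((\<lambda>t. 2 * (lambert t - 2 * lambert (2 * t))) \<longlongrightarrow> (\<Sum>C\<in>\<H>. 0) + real (card \<H>)) (at_right 0)"
    by (rule Lim_transform_eventually)
  moreover have "((\<lambda>t. 2 * (lambert t - 2 * lambert (2 * t))) \<longlongrightarrow> 2 * (chi_mean / 2)) (at_right 0)"
    by (intro tendsto_intros lambert_limit)
  ultimately have "(\<Sum>C\<in>\<H>. 0) + real (card \<H>) = 2 * (chi_mean / 2)"
    by (intro tendsto_unique[of "at_right (0::real)"]) auto
  thus ?thesis by (simp add: class_number_def \<H>_def)
qed

end

section \<open>The central binomial coefficient\<close>

lemma sum_partial_sums:
  fixes f :: "nat \<Rightarrow> 'a::comm_ring_1"
  shows "(\<Sum>x<n. \<Sum>j<Suc x. f j) = (\<Sum>j<n. (of_nat n - of_nat j) * f j)"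
proof (induction n)
  case (Suc n)
  have "(\<Sum>j<Suc n. (of_nat (Suc n) - of_nat j) * f j) = (\<Sum>j<n. (of_nat n - of_nat j) * f j + f j) + f n"
    by (simp add: algebra_simps)
  also have "\<dots> = (\<Sum>x<Suc n. \<Sum>j<Suc x. f j)" using Suc by (simp add: sum.distrib)
  finally show ?case ..
qed simp

context prime_3_mod_4
begin

abbreviation "h \<equiv> class_number (quadratic_field (- int p))"

abbreviation "half_p \<equiv> (p - 1) div 2"

lemma p_half: "p = 2 * half_p + 1" using p_mod_4 by presburger

text \<open>The value at j enters p - j partial sums, and the multiple of p drops out because a full
  period sums to 0.\<close>

lemma class_number_first_moment: "int p * int h = - (\<Sum>j\<in>{1..<p}. int j * chi (int j))"
proof -
  have "real p * real h = (\<Sum>x<p. \<Sum>j<Suc x. chr j)"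
    using p_gt_3 by (simp add: class_number_formula chi_mean_def del: sum.lessThan_Suc)
  also have "\<dots> = (\<Sum>j<p. (real p - real j) * chr j)" by (rule sum_partial_sums)
  also have "\<dots> = of_int (\<Sum>j<p. (int p - int j) * chi (int j))" by (simp add: chr_def)
  finally have "real_of_int (int p * int h) = of_int (\<Sum>j<p. (int p - int j) * chi (int j))" by simp
  hence "int p * int h = (\<Sum>j<p. (int p - int j) * chi (int j))" unfolding of_int_eq_iff .
  also have "\<dots> = - (\<Sum>j<p. int j * chi (int j))"
    using sum_chi_period by (simp add: left_diff_distrib sum_subtractf flip: sum_distrib_left)
  also have "{..<p} = insert 0 {1..<p}" using p_gt_3 by auto
  finally show ?thesis by simp
qed

text \<open>
  Splitting the range of the first moment once in the middle and once by parity
  gives two linear relations that eliminate the first moment over the half range.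
\<close>

lemma class_number_half_sum: "(2 - chi 2) * int h = (\<Sum>j\<in>{1..half_p}. chi (int j))"
proof -
  define n where "n = half_p"
  have p: "p = 2 * n + 1" using p_half by (simp add: n_def)
  define S where "S = (\<Sum>j\<in>{1..n}. chi (int j))"
  define T where "T = (\<Sum>j\<in>{1..n}. int j * chi (int j))"
  define A where "A = (\<Sum>j\<in>{1..<p}. int j * chi (int j))"
  have "{1..<p} = {1..n} \<union> {n+1..<p}" using p by auto
  hence "A = T + (\<Sum>j\<in>{n+1..<p}. int j * chi (int j))"
    unfolding A_def T_def by (simp only:) (subst sum.union_disjoint, auto)
  also have "(\<Sum>j\<in>{n+1..<p}. int j * chi (int j)) = (\<Sum>j\<in>{1..n}. (int p - int j) * chi (int p - int j))"
    by (rule sum.reindex_bij_witness[of _ "\<lambda>j. p - j" "\<lambda>j. p - j"]) (use p in \<open>auto simp: of_nat_diff\<close>)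
  also have "\<dots> = T - int p * S"
    by (simp add: chi_reflect S_def T_def sum_distrib_left left_diff_distrib sum_subtractf sum_negf)
  finally have 1: "A = 2 * T - int p * S" by simp
  have "{1..<p} = {j\<in>{1..<p}. even j} \<union> {j\<in>{1..<p}. odd j}" by auto
  hence "A = (\<Sum>j | j \<in> {1..<p} \<and> even j. int j * chi (int j)) + (\<Sum>j | j \<in> {1..<p} \<and> odd j. int j * chi (int j))"
    unfolding A_def by (metis (mono_tags, lifting) finite_atLeastLessThan sum.Int_Diff sum.union_disjoint disjoint_iff finite_Un mem_Collect_eq)
  also have "(\<Sum>j | j \<in> {1..<p} \<and> even j. int j * chi (int j)) = (\<Sum>k\<in>{1..n}. (2 * int k) * chi (2 * int k))"
    by (rule sum.reindex_bij_witness[of _ "\<lambda>k. 2 * k" "\<lambda>j. j div 2"]) (use p in \<open>auto elim!: evenE\<close>)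
  also have "\<dots> = 2 * chi 2 * T" by (simp add: chi_mult T_def sum_distrib_left mult_ac)
  also have "(\<Sum>j | j \<in> {1..<p} \<and> odd j. int j * chi (int j)) = (\<Sum>k\<in>{1..n}. (int p - 2 * int k) * chi (int p - 2 * int k))"
    by (rule sum.reindex_bij_witness[of _ "\<lambda>k. p - 2 * k" "\<lambda>j. (p - j) div 2"]) (use p in \<open>auto elim!: oddE simp: of_nat_diff simp flip: diff_mult_distrib2\<close>)
  also have "\<dots> = (\<Sum>k\<in>{1..n}. 2 * chi 2 * (int k * chi (int k)) - chi 2 * int p * chi (int k))"
    by (intro sum.cong refl) (simp add: chi_reflect chi_mult algebra_simps)
  also have "\<dots> = 2 * chi 2 * T - chi 2 * int p * S"
    by (simp only: sum_subtractf S_def T_def sum_distrib_left)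
  finally have 2: "A = 4 * chi 2 * T - chi 2 * int p * S" by simp
  have c2: "chi 2 * chi 2 = 1" using chi_square[of 2] zdvd_imp_le[of "int p" 2] p_gt_3 by fastforce
  have "chi 2 * (chi 2 * int p * S) = int p * S" using c2 by (metis mult.assoc mult_1)
  moreover have "A * (2 * chi 2 - 1) = - (chi 2 * int p * S)"
  proof -
    have "A * (2 * chi 2 - 1) = 2 * chi 2 * A - A" by (simp add: algebra_simps)
    also have "\<dots> = 2 * chi 2 * (2 * T - int p * S) - (4 * chi 2 * T - chi 2 * int p * S)"
      by (simp only: 1[symmetric] 2[symmetric])
    finally show ?thesis by (simp add: algebra_simps)
  qed
  \<comment> \<open>A further factor \<open>chi 2\<close>, whose square is 1, turns 2 *
    \<open>chi 2\<close> - 1 into 2 - \<open>chi 2\<close>.\<close>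
  hence "chi 2 * (A * (2 * chi 2 - 1)) = chi 2 * - (chi 2 * int p * S)" by simp
  moreover have "chi 2 * (A * (2 * chi 2 - 1)) = A * (2 * (chi 2 * chi 2) - chi 2)" by (simp add: algebra_simps)
  ultimately have "A * (2 - chi 2) = - (int p * S)" using c2 by simp
  have "int p * ((2 - chi 2) * int h) = (2 - chi 2) * (int p * int h)" by simp
  also have "\<dots> = - (A * (2 - chi 2))" unfolding class_number_first_moment A_def by simp
  also have "\<dots> = int p * S" using \<open>A * (2 - chi 2) = - (int p * S)\<close> by simp
  finally have "int p * ((2 - chi 2) * int h) = int p * S" .
  thus ?thesis using p_gt_3 by (simp add: S_def n_def)
qed

section \<open>The quadratic character of factorials and of the central binomial\<close>

text \<open>N is the number of nonresidues up to k. It determines both the sign of the factorial and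
  the character sum, which links the binomial coefficient to the class number.\<close>

lemma chi_fact:
  assumes "k < p"
  shows "\<exists>N. chi (fact k) = (-1) ^ N \<and> (\<Sum>j\<in>{1..k}. chi (int j)) = int k - 2 * int N"
  using assms
proof (induction k)
  case 0
  thus ?case by (intro exI[of _ 0]) simp
next
  case (Suc k)
  then obtain N where N: "chi (fact k) = (-1) ^ N" "(\<Sum>j\<in>{1..k}. chi (int j)) = int k - 2 * int N" by auto
  have "\<not> int p dvd int (Suc k)" using Suc.prems by (simp only: of_nat_dvd_iff) (auto dest: dvd_imp_le)
  hence "chi (int (Suc k)) = 1 \<or> chi (int (Suc k)) = - 1"
    using chi_values[of "int (Suc k)"] chi_0_iff[of "int (Suc k)"] by auto
  moreover have "chi (fact (Suc k)) = chi (int (Suc k)) * chi (fact k)"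
    by (simp only: fact_Suc of_nat_mult chi_mult)
  moreover have "(\<Sum>j\<in>{1..Suc k}. chi (int j)) = (\<Sum>j\<in>{1..k}. chi (int j)) + chi (int (Suc k))" by simp
  ultimately show ?case using N
    by (elim disjE) (auto intro: exI[of _ N] exI[of _ "Suc N"])
qed

text \<open>In the factorial expression (m + 1)! enters squared, 2 * m + 2 is inverse to 2 modulo p,
  and (2 * m + 1)! contributes the parity of the number of nonresidues, which the half sum relates
  to h modulo 4.\<close>

lemma chi_central_binomial:
  assumes pm: "p = 4 * m + 3"
  shows "chi ((-1) ^ m * int ((2 * m + 2) choose (m + 1))) = (-1) ^ ((h - 1) div 2)"
proof -
  have n: "half_p = 2 * m + 1" and c0: "c0 = int m + 1" using pm p_eq by simp_all
  obtain N where N: "chi (fact (2 * m + 1)) = (-1) ^ N" "(\<Sum>j\<in>{1..2 * m + 1}. chi (int j)) = int (2 * m + 1) - 2 * int N"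
    using chi_fact[of "2 * m + 1"] pm by auto
  have h: "(2 - chi 2) * int h = int (2 * m + 1) - 2 * int N"
    using class_number_half_sum N(2) unfolding n by simp
  have chi2: "chi 2 = (-1) ^ (m + 1)" unfolding chi_2 c0 by (auto simp: minus_one_power_iff)
  have c2: "chi 2 * chi 2 = 1" by (simp add: chi2 flip: power_add)
  have "chi 2 * chi (int (2 * m + 2)) = chi (int p + 1)"
    unfolding chi_mult[symmetric] by (simp add: pm algebra_simps)
  also have "chi (int p + 1) = 1" using chi_cong[of "int p + 1" 1] by (simp add: Cong.cong_def)
  finally have 1: "chi (int (2 * m + 2)) = chi 2" using c2 by (metis mult.assoc mult_1 mult_1_right)
  have "fact (m + 1) * fact (m + 1) * ((2 * m + 2) choose (m + 1)) = (fact (2 * m + 2) :: nat)"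
  proof -
    have "m + 1 \<le> 2 * m + 2" "2 * m + 2 - (m + 1) = m + 1" by simp_all
    thus ?thesis using binomial_fact_lemma[of "m + 1" "2 * m + 2"] by (simp only:)
  qed
  also have "\<dots> = (2 * m + 2) * fact (2 * m + 1)"
  proof -
    have "2 * m + 2 = Suc (2 * m + 1)" by simp
    thus ?thesis by (simp only: fact_Suc of_nat_id)
  qed
  finally have "int (fact (m + 1)) * int (fact (m + 1)) * int ((2 * m + 2) choose (m + 1)) = int (2 * m + 2) * int (fact (2 * m + 1))"
    by (simp only: of_nat_mult[symmetric])
  hence "chi (fact (m + 1)) * chi (fact (m + 1)) * chi (int ((2 * m + 2) choose (m + 1))) = chi 2 * (-1) ^ N"
    by (metis chi_mult 1 N(1) of_nat_fact)
  moreover obtain N' where "chi (fact (m + 1)) = (-1) ^ N'" using chi_fact[of "m + 1"] pm by auto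
  hence "chi (fact (m + 1)) * chi (fact (m + 1)) = 1" by (simp flip: power_add)
  ultimately have "chi (int ((2 * m + 2) choose (m + 1))) = (-1) ^ (m + 1) * (-1) ^ N" by (simp add: chi2)
  moreover have "chi ((-1) ^ m) = (-1) ^ m" by (induction m) (auto simp: chi_minus)
  ultimately have "chi ((-1) ^ m * int ((2 * m + 2) choose (m + 1))) = (-1) ^ m * ((-1) ^ (m + 1) * (-1) ^ N)"
    unfolding chi_mult by simp
  also have "\<dots> = (-1) ^ (N + 1)" by (auto simp: minus_one_power_iff)
  also have "\<dots> = (-1) ^ ((h - 1) div 2)"
  proof -
    \<comment> \<open>The factor 2 - \<open>chi 2\<close> is 1 for odd m and 3 for even m. Either
      relation makes h odd, so that h - 1 is not truncated, and fixes h modulo 4.\<close>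
    have "even (N + 1) = even ((h - 1) div 2)"
    proof (cases "odd m")
      case True
      hence "int h = 2 * int m + 1 - 2 * int N" using h chi2 by simp
      thus ?thesis using True by presburger
    next
      case False
      hence "3 * int h = 2 * int m + 1 - 2 * int N" using h chi2 by simp
      thus ?thesis using False by presburger
    qed
    thus ?thesis by (simp only: minus_one_power_iff)
  qed
  finally show ?thesis .
qed

end

section \<open>Transfer to the field of prime order\<close>

text \<open>A sign b satisfies \<open>chi b = b\<close> because -1 is a nonresidue. So the integer
  times b is a nonzero square modulo q, and its square root is carried into the field through the
  characteristic.\<close>

lemma central_binomial_square_class:
  assumes char: "CHAR('a::field) = q" and q: "prime q" "q = 4 * m + 3" "q > 3"
  shows "\<exists>u::'a. u \<noteq> 0 \<and> (-1) ^ m * of_nat ((2 * m + 2) choose (m + 1)) =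
    (-1) ^ ((class_number (quadratic_field (- int q)) - 1) div 2) * u\<^sup>2"
proof -
  interpret prime_3_mod_4 q by unfold_locales (use q in auto)
  define a where "a = (-1) ^ m * int ((2 * m + 2) choose (m + 1))"
  define b :: int where "b = (-1) ^ ((h - 1) div 2)"
  have b: "b * b = 1" "chi b = b" unfolding b_def
    by (auto simp: minus_one_power_iff chi_minus_1)
  have "chi a = b" unfolding a_def b_def by (rule chi_central_binomial[OF q(2)])
  hence "chi (a * b) = 1" by (simp add: chi_mult b)
  hence "QuadRes (int q) (a * b)" and nz: "\<not> int q dvd a * b"
    by (auto simp: chi_def Legendre_def cong_0_iff split: if_splits)
  then obtain y where y: "[y\<^sup>2 = a * b] (mod int q)" by (auto simp: QuadRes_def)
  hence "of_int (y\<^sup>2) = (of_int (a * b) :: 'a)" by (simp only: of_int_eq_iff_cong_CHAR char)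
  hence "of_int b * (of_int y)\<^sup>2 = (of_int (a * (b * b)) :: 'a)" by (simp add: mult_ac)
  hence eq: "of_int a = of_int b * (of_int y :: 'a)\<^sup>2" by (simp add: b)
  have "\<not> int q dvd y"
  proof
    assume "int q dvd y"
    hence "int q dvd y\<^sup>2" by (simp add: power2_eq_square)
    thus False using nz y by (simp add: cong_dvd_iff)
  qed
  hence "(of_int y :: 'a) \<noteq> 0" by (simp add: of_int_eq_0_iff_char_dvd char)
  thus ?thesis using eq by (intro exI[of _ "of_int y"]) (simp add: a_def b_def)
qed

theorem theorem1p2:
  fixes d :: "'a::{field, finite}" and \<alpha> :: "nat \<Rightarrow> 'a" and n q :: nat
  assumes "q = CARD('a)"
    and "q = 2 * n + 1"
    and "CHAR('a) > 3"
    and "d \<noteq> 0"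
    and "bij_betw \<alpha> {..<n} (nonzero_squares :: 'a set)"
  shows "([q = 1] (mod 4) \<longrightarrow>
            (\<exists>x::'a. det (D_matrix n \<alpha> d) = d ^ ((q - 1) div 4) * x ^ 2) \<and>
            (prime q \<longrightarrow>
              (\<exists>x::'a. x \<noteq> 0 \<and> det (D_matrix n \<alpha> d) = d ^ ((q - 1) div 4) * x ^ 2)))
       \<and> ([q = 3] (mod 4) \<longrightarrow>
            (\<exists>y::'a. det (D_matrix n \<alpha> d) =
               d ^ ((q + 1) div 4) * (- 1) ^ ((q - 3) div 4) *
               of_nat (((q + 1) div 2) choose ((q + 1) div 4)) * y ^ 2) \<and>
            (prime q \<longrightarrow>
              (\<exists>z::'a. z \<noteq> 0 \<and> det (D_matrix n \<alpha> d) =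
                 d ^ ((q + 1) div 4) *
                 (- 1) ^ ((class_number (quadratic_field (- int q)) - 1) div 2) * z ^ 2)))"
proof (intro conjI impI)
  have card: "CARD('a) = 2 * n + 1" using assms(1,2) by simp
  note classes = D_matrix_square_classes[OF card assms(3-5)]
  {
    assume "[q = 1] (mod 4)"
    hence "q mod 4 = 1" by (simp add: Cong.cong_def)
    define m where "m = q div 4"
    have m: "n = 2 * m" "(q - 1) div 4 = m"
      using \<open>q mod 4 = 1\<close> assms(2) unfolding m_def by presburger+
    obtain x where x: "det (D_matrix n \<alpha> d) = d ^ m * x\<^sup>2" "prime q \<longrightarrow> x \<noteq> 0"
      using classes(1)[OF m(1)] assms(2) by auto
    show "\<exists>x::'a. det (D_matrix n \<alpha> d) = d ^ ((q - 1) div 4) * x ^ 2" using x m by auto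
    show "\<exists>x::'a. x \<noteq> 0 \<and> det (D_matrix n \<alpha> d) = d ^ ((q - 1) div 4) * x ^ 2" if "prime q"
      using x m that by auto
  }
  {
    assume "[q = 3] (mod 4)"
    hence "q mod 4 = 3" by (simp add: Cong.cong_def)
    define m where "m = q div 4"
    have q: "q = 4 * m + 3" using \<open>q mod 4 = 3\<close> unfolding m_def by presburger
    hence m: "n = 2 * m + 1" "(q + 1) div 4 = m + 1" "(q - 3) div 4 = m" "(q + 1) div 2 = 2 * m + 2"
      using assms(2) by auto
    obtain y where y: "det (D_matrix n \<alpha> d) = d ^ (m + 1) * (-1) ^ m * of_nat ((2 * m + 2) choose (m + 1)) * y\<^sup>2"
      "prime q \<longrightarrow> y \<noteq> 0"
      using classes(2)[OF m(1)] assms(2) by auto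
    show "\<exists>y::'a. det (D_matrix n \<alpha> d) = d ^ ((q + 1) div 4) * (- 1) ^ ((q - 3) div 4) *
        of_nat (((q + 1) div 2) choose ((q + 1) div 4)) * y ^ 2"
      using y(1) unfolding m by blast
    assume prime: "prime q"
    have "CHAR('a) dvd q" using CHAR_dvd_CARD[where 'a = 'a] assms(1) by simp
    hence char: "CHAR('a) = q" using prime assms(3) by (auto simp: prime_nat_iff)
    \<comment> \<open>The constant left over by the determinant is a sign times a nonzero square,
      and that square is merged with y.\<close>
    obtain u :: 'a where u: "u \<noteq> 0" "(-1) ^ m * of_nat ((2 * m + 2) choose (m + 1)) =
        (-1) ^ ((class_number (quadratic_field (- int q)) - 1) div 2) * u\<^sup>2"
      using central_binomial_square_class[OF char prime q] char assms(3) by auto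
    have "det (D_matrix n \<alpha> d) = d ^ (m + 1) * ((-1) ^ m * of_nat ((2 * m + 2) choose (m + 1))) * y\<^sup>2"
      unfolding y(1) by (simp only: mult.assoc)
    hence "det (D_matrix n \<alpha> d) = d ^ (m + 1) * (-1) ^ ((class_number (quadratic_field (- int q)) - 1) div 2) * (u * y)\<^sup>2"
      unfolding u(2) by (simp only: power_mult_distrib mult.assoc)
    thus "\<exists>z::'a. z \<noteq> 0 \<and> det (D_matrix n \<alpha> d) = d ^ ((q + 1) div 4) *
        (- 1) ^ ((class_number (quadratic_field (- int q)) - 1) div 2) * z ^ 2"
      unfolding m using u(1) y(2) prime by (intro exI[of _ "u * y"]) simp
  }
qed

end
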